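(* Let $p$ be a prime, let $s>0$ be a real number, and let $f:\partial T_p\to\mathbb{R}$ be a locally constant function on the boundary $\partial T_p\cong\mathbb{P}^1(\mathbb{Q}_p)$ of the Bruhat–Tits tree $T_p$ of $PGL(2,\mathbb{Q}_p)$ with base vertex $C$. Let $\varphi$ be the solution of the extension problem $$\begin{cases}\tilde{D}^s\varphi(i)=0, & i\in T_p \text{ (vertices)},\\ \varphi|_{\partial T_p}=f,\end{cases}$$ where $\tilde D^s\varphi(i)=\sum_{j\sim i}w_{ij}(\varphi(i)-\varphi(j))$ is the weighted graph Laplacian on $T_p$ with weights $w_{ij}=p^{d(C,i)(s-1)}+p^{d(C,j)(s-1)}$ for $i\sim j$. Then $$\sum_{i}\sum_{j\sim i}(\varphi(j)-\varphi(i))^2p^{d(C,i)(s-1)}=\frac{(1-p^{-s})(p^{s-1}-p^{1-s})}{(1+p^{-1})(1-p^{-1-s})}\left(\int_{\partial T_p}f(x)\,d\mu_0(x)\right)^2+(1-p^{-s})(1+p^{1-s})\int_{\mathbb{Q}_p}a(x)f(x)\,D^s(af)(x)\,dx,$$ where $i$ runs over all vertices of $T_p$ and $$a(x)=\begin{cases}1,& x\in\mathbb{Z}_p,\\ |x|_p^{s-1},& x\in\mathbb{Q}_p\setminus\mathbb{Z}_p.\end{cases}$$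
   Context: $T_p=PGL(2,\mathbb{Q}_p)/PGL(2,\mathbb{Z}_p)$ is the Bruhat–Tits tree, a $(p+1)$-regular tree; $C$ is its base vertex (the class of the identity, i.e. of the lattice $\mathbb{Z}_p^2$), $d(i,j)$ is the graph distance, and $j\sim i$ means that $i,j$ are adjacent. The boundary $\partial T_p$ is the set of infinite simple rays from $C$. For a vertex $i$, $\partial B_i\subset\partial T_p$ denotes the set of boundary points $x$ whose ray $C\to x$ passes through $i$; these sets form a basis of the (compact) topology of $\partial T_p$. The boundary is identified with $\mathbb{P}^1(\mathbb{Q}_p)=\mathbb{Q}_p\cup\{\infty\}$ in the standard way: for $n\ge1$, the sets $\partial B_i$ with $d(C,i)=n$ are exactly the sets $a+p^n\mathbb{Z}_p$ with $a\in\mathbb{Z}_p$ and the sets $\{x: x^{-1}\in b+p^n\mathbb{Z}_p\}$ with $b\in p\mathbb{Z}_p$ (with $\infty^{-1}=0$), inclusion of these sets corresponding to the descendant relation in the tree rooted at $C$. $\mu_0$ is the measure on $\partial T_p$ with $\mu_0(\partial B_i)=p^{-d(C,i)}$ for every vertex $i\ne C$ (so the total mass is $1+p^{-1}$). Under the identification, $d\mu_0(x)=dx$ for $|x|_p\le1$ and $d\mu_0(x)=dx/|x|_p^2$ for $|x|_p>1$, where $dx$ is the Haar measure on $\mathbb{Q}_p$ with $\int_{\mathbb{Z}_p}dx=1$; the point $\infty$ has measure $0$. In integrals over $\mathbb{Q}_p$, $f$ is viewed as a function on $\mathbb{Q}_p\subset\mathbb{P}^1(\mathbb{Q}_p)$.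 The boundary condition $\varphi|_{\partial T_p}=f$ means $\lim_{i\to x}\varphi(i)=f(x)$ for every $x\in\partial T_p$, where the vertices $i$ tend to $x$ in the usual topology of $T_p\cup\partial T_p$ (for every vertex $w$ on the ray $C\to x$, eventually the path from $C$ to $i$ passes through $w$). The generalised Vladimirov derivative is $$D^su(x)=-\frac{1}{\Gamma_p(-s)}\int_{\mathbb{Q}_p}\frac{u(x)-u(z)}{|x-z|_p^{1+s}}\,dz,\qquad \Gamma_p(\alpha)=\frac{1-p^{\alpha-1}}{1-p^{-\alpha}}.$$ *)

theory Defs
  imports "HOL-Analysis.Analysis" "Berlekamp_Zassenhaus.Finite_Field"
begin

section \<open>The p-adic absolute value on the rationals\<close>

definition rat_padic_abs :: "nat \<Rightarrow> rat \<Rightarrow> real" where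
  "rat_padic_abs p r = (if r = 0 then 0 else
     real p powi (int (multiplicity (int p) (snd (quotient_of r)))
                - int (multiplicity (int p) (fst (quotient_of r)))))"

lemma rat_padic_abs_0 [simp]: "rat_padic_abs p 0 = 0"
  by (simp add: rat_padic_abs_def)

lemma rat_padic_abs_frac:
  assumes p: "prime p" and a: "a \<noteq> 0" and b: "b \<noteq> 0"
  shows "rat_padic_abs p (of_int a / of_int b) =
    real p powi (int (multiplicity (int p) b) - int (multiplicity (int p) a))"
proof -
  define r :: rat where "r = of_int a / of_int b"
  obtain c d where cd: "quotient_of r = (c, d)" by fastforce
  have d: "d > 0" using cd quotient_of_denom_pos by blast
  have r: "r = of_int c / of_int d" using cd quotient_of_div by blast
  have r0: "r \<noteq> 0" using a b by (simp add: r_def)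
  then have c: "c \<noteq> 0" using r by auto
  have "of_int (a * d) = (of_int (c * b) :: rat)"
    using r b d unfolding r_def by (simp add: field_simps)
  then have eq: "a * d = c * b" by (simp only: of_int_eq_iff)
  have pe: "prime_elem (int p)" using p by auto
  have "multiplicity (int p) (a * d) = multiplicity (int p) (c * b)" by (simp add: eq)
  then have "multiplicity (int p) a + multiplicity (int p) d
           = multiplicity (int p) c + multiplicity (int p) b"
    using a b c d pe by (simp add: prime_elem_multiplicity_mult_distrib)
  then have "int (multiplicity (int p) d) - int (multiplicity (int p) c)
           = int (multiplicity (int p) b) - int (multiplicity (int p) a)" by linarith
  then show ?thesis using r0 cd unfolding r_def[symmetric] rat_padic_abs_def by simp
qed

lemma rat_eq_frac: obtains a b where "b \<noteq> 0" "(r::rat) = of_int a / of_int b"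
  by (metis quotient_of_div quotient_of_denom_pos prod.collapse less_irrefl)

lemma rat_padic_abs_mult:
  assumes p: "prime p"
  shows "rat_padic_abs p (x * y) = rat_padic_abs p x * rat_padic_abs p y"
proof (cases "x = 0 \<or> y = 0")
  case False
  obtain a b where ab: "b \<noteq> 0" "x = of_int a / of_int b" using rat_eq_frac .
  obtain c d where cd: "d \<noteq> 0" "y = of_int c / of_int d" using rat_eq_frac .
  have nz: "a \<noteq> 0" "c \<noteq> 0" using False ab cd by auto
  have pe: "prime_elem (int p)" using p by auto
  have p0: "real p \<noteq> 0" using p prime_gt_0_nat by auto
  have "x * y = of_int (a * c) / of_int (b * d)" using ab cd by simp
  then have "rat_padic_abs p (x * y) = real p powi
     (int (multiplicity (int p) (b * d)) - int (multiplicity (int p) (a * c)))"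
    using rat_padic_abs_frac[OF p, of "a * c" "b * d"] nz ab cd by simp
  also have "\<dots> = real p powi
     ((int (multiplicity (int p) b) - int (multiplicity (int p) a)) +
      (int (multiplicity (int p) d) - int (multiplicity (int p) c)))"
    using nz ab cd pe by (simp add: prime_elem_multiplicity_mult_distrib algebra_simps)
  also have "\<dots> = rat_padic_abs p x * rat_padic_abs p y"
    using rat_padic_abs_frac[OF p] nz ab cd p0 by (simp add: power_int_add)
  finally show ?thesis .
qed auto

lemma rat_padic_abs_nonneg [simp]: "0 \<le> rat_padic_abs p x"
  by (simp add: rat_padic_abs_def)

lemma rat_padic_abs_eq_0_iff:
  assumes "prime p" shows "rat_padic_abs p x = 0 \<longleftrightarrow> x = 0"
  using assms prime_gt_0_nat by (auto simp: rat_padic_abs_def)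

lemma rat_padic_abs_1: "prime p \<Longrightarrow> rat_padic_abs p 1 = 1"
  using rat_padic_abs_frac[of p 1 1] by simp

lemma rat_padic_abs_minus: assumes "prime p" shows "rat_padic_abs p (- x) = rat_padic_abs p x"
proof -
  have "(rat_padic_abs p (-1))\<^sup>2 = 1"
    using rat_padic_abs_mult[OF assms, of "-1" "-1"] rat_padic_abs_1[OF assms]
    by (simp add: power2_eq_square)
  then have "rat_padic_abs p (-1) = 1"
    using rat_padic_abs_nonneg[of p "-1"] by (auto simp: power2_eq_1_iff)
  then show ?thesis using rat_padic_abs_mult[OF assms, of "-1" x] by simp
qed

lemma rat_padic_abs_inverse:
  assumes p: "prime p" shows "rat_padic_abs p (inverse x) = inverse (rat_padic_abs p x)"
proof (cases "x = 0")
  case False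
  then have "rat_padic_abs p x * rat_padic_abs p (inverse x) = 1"
    using rat_padic_abs_mult[OF p, of x "inverse x"] rat_padic_abs_1[OF p] by simp
  then show ?thesis by (simp add: inverse_unique)
qed simp

lemma rat_padic_abs_add_le:
  assumes p: "prime p"
  shows "rat_padic_abs p (x + y) \<le> max (rat_padic_abs p x) (rat_padic_abs p y)"
proof (cases "x = 0 \<or> y = 0 \<or> x + y = 0")
  case True
  then show ?thesis by (auto simp: le_max_iff_disj)
next
  case False
  obtain a b where ab: "b \<noteq> 0" "x = of_int a / of_int b" using rat_eq_frac .
  obtain c d where cd: "d \<noteq> 0" "y = of_int c / of_int d" using rat_eq_frac .
  define u v where "u = a * d" and "v = c * b"
  have x: "x = of_int u / of_int (b * d)" and y: "y = of_int v / of_int (b * d)"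
    and xy: "x + y = of_int (u + v) / of_int (b * d)"
    using ab cd by (auto simp: u_def v_def field_simps)
  have nz: "u \<noteq> 0" "v \<noteq> 0" "b * d \<noteq> 0" using False x y ab cd by auto
  have nz': "u + v \<noteq> 0" using False unfolding xy by auto
  have p1: "1 < real p" using p prime_gt_1_nat by auto
  let ?m = "multiplicity (int p)"
  have nu: "\<not> is_unit (int p)" using p by (metis not_prime_unit prime_nat_int_transfer)
  have "int p ^ min (?m u) (?m v) dvd u + v"
    by (intro dvd_add) (meson multiplicity_dvd' min.cobounded1 min.cobounded2)+
  then have "min (?m u) (?m v) \<le> ?m (u + v)"
    using nu nz' by (intro multiplicity_geI) auto
  then have "int (?m (b*d)) - int (?m (u+v)) \<le> int (?m (b*d)) - int (?m u) \<or>
      int (?m (b*d)) - int (?m (u+v)) \<le> int (?m (b*d)) - int (?m v)" by linarith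
  then show ?thesis
    unfolding x y xy[unfolded x y] using rat_padic_abs_frac[OF p] nz nz' p1
    by (auto simp del: of_int_add of_int_mult simp: le_max_iff_disj intro: power_int_increasing)
qed

lemma rat_padic_abs_triangle:
  assumes p: "prime p"
  shows "\<bar>rat_padic_abs p x - rat_padic_abs p y\<bar> \<le> rat_padic_abs p (x - y)"
proof -
  have sub: "rat_padic_abs p (a + b) \<le> rat_padic_abs p a + rat_padic_abs p b" for a b
    using rat_padic_abs_add_le[OF p, of a b] rat_padic_abs_nonneg[of p a] rat_padic_abs_nonneg[of p b]
    by linarith
  show ?thesis
    using sub[of "x - y" y] sub[of "y - x" x] rat_padic_abs_minus[OF p, of "x - y"] by simp
qed

section \<open>The field of p-adic numbers as the completion of the rationals\<close>

text \<open>The prime is \<open>p = CARD('p)\<close>; the p-adic numbers are p-adic Cauchy sequences of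
  rationals modulo p-adic null sequences.\<close>

definition padic_cauchy :: "nat \<Rightarrow> (nat \<Rightarrow> rat) \<Rightarrow> bool" where
  "padic_cauchy p X \<longleftrightarrow> (\<forall>e>0. \<exists>N. \<forall>m\<ge>N. \<forall>n\<ge>N. rat_padic_abs p (X m - X n) < e)"

definition padic_rel :: "'p::prime_card itself \<Rightarrow> (nat \<Rightarrow> rat) \<Rightarrow> (nat \<Rightarrow> rat) \<Rightarrow> bool" where
  "padic_rel _ X Y \<longleftrightarrow> padic_cauchy CARD('p) X \<and> padic_cauchy CARD('p) Y \<and>
     (\<lambda>n. rat_padic_abs CARD('p) (X n - Y n)) \<longlonglongrightarrow> 0"

lemma padic_cauchyD:
  "padic_cauchy p X \<Longrightarrow> 0 < e \<Longrightarrow> \<exists>N. \<forall>m\<ge>N. \<forall>n\<ge>N. rat_padic_abs p (X m - X n) < e"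
  by (simp add: padic_cauchy_def)

lemma padic_cauchy_const: "padic_cauchy p (\<lambda>n. c)"
  by (simp add: padic_cauchy_def)

lemma padic_cauchy_add:
  assumes p: "prime p" and X: "padic_cauchy p X" and Y: "padic_cauchy p Y"
  shows "padic_cauchy p (\<lambda>n. X n + Y n)"
  unfolding padic_cauchy_def
proof (intro allI impI)
  fix e :: real assume e: "e > 0"
  obtain M N where M: "\<forall>m\<ge>M. \<forall>n\<ge>M. rat_padic_abs p (X m - X n) < e"
    and N: "\<forall>m\<ge>N. \<forall>n\<ge>N. rat_padic_abs p (Y m - Y n) < e"
    using padic_cauchyD[OF X e] padic_cauchyD[OF Y e] by blast
  have "rat_padic_abs p (X m + Y m - (X n + Y n)) < e" if "m \<ge> max M N" "n \<ge> max M N" for m n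
  proof -
    have "rat_padic_abs p (X m + Y m - (X n + Y n)) \<le>
        max (rat_padic_abs p (X m - X n)) (rat_padic_abs p (Y m - Y n))"
      using rat_padic_abs_add_le[OF p, of "X m - X n" "Y m - Y n"] by (simp add: algebra_simps)
    then show ?thesis using M N that by (meson max.boundedE max_less_iff_conj le_less_trans)
  qed
  then show "\<exists>N. \<forall>m\<ge>N. \<forall>n\<ge>N. rat_padic_abs p (X m + Y m - (X n + Y n)) < e" by blast
qed

lemma padic_cauchy_minus:
  assumes p: "prime p" and X: "padic_cauchy p X"
  shows "padic_cauchy p (\<lambda>n. - X n)"
proof -
  have "rat_padic_abs p (- X m - - X n) = rat_padic_abs p (X m - X n)" for m n
    using rat_padic_abs_minus[OF p, of "X m - X n"] by simp
  then show ?thesis using X unfolding padic_cauchy_def by simp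
qed

lemma padic_cauchy_convergent:
  assumes p: "prime p" and X: "padic_cauchy p X"
  shows "convergent (\<lambda>n. rat_padic_abs p (X n))"
proof -
  have "Cauchy (\<lambda>n. rat_padic_abs p (X n))"
    unfolding Cauchy_def dist_real_def
    using padic_cauchyD[OF X] rat_padic_abs_triangle[OF p] by (meson le_less_trans)
  then show ?thesis by (simp add: Cauchy_convergent_iff)
qed

lemma padic_cauchy_bounded:
  assumes "prime p" "padic_cauchy p X"
  obtains B where "B > 0" "\<And>n. rat_padic_abs p (X n) \<le> B"
proof -
  have "Bseq (\<lambda>n. rat_padic_abs p (X n))"
    using padic_cauchy_convergent[OF assms] by (rule convergent_imp_Bseq)
  then show ?thesis using that unfolding Bseq_def by auto
qed

lemma padic_null_add:
  assumes p: "prime p" and "(\<lambda>n. rat_padic_abs p (X n)) \<longlonglongrightarrow> 0" "(\<lambda>n. rat_padic_abs p (Y n)) \<longlonglongrightarrow> 0"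
  shows "(\<lambda>n. rat_padic_abs p (X n + Y n)) \<longlonglongrightarrow> 0"
proof (rule tendsto_sandwich[OF _ _ tendsto_const])
  show "(\<lambda>n. max (rat_padic_abs p (X n)) (rat_padic_abs p (Y n))) \<longlonglongrightarrow> 0"
    using tendsto_max[OF assms(2,3)] by simp
qed (auto simp: rat_padic_abs_add_le[OF p])

lemma padic_null_minus:
  assumes p: "prime p" and "(\<lambda>n. rat_padic_abs p (X n - Y n)) \<longlonglongrightarrow> 0"
  shows "(\<lambda>n. rat_padic_abs p (Y n - X n)) \<longlonglongrightarrow> 0"
  using assms(2) rat_padic_abs_minus[OF p, of "X n - Y n" for n] by simp

lemma padic_null_mult:
  assumes p: "prime p" and X: "padic_cauchy p X"
    and Y: "(\<lambda>n. rat_padic_abs p (Y n)) \<longlonglongrightarrow> 0"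
  shows "(\<lambda>n. rat_padic_abs p (X n * Y n)) \<longlonglongrightarrow> 0"
proof -
  obtain B where B: "B > 0" "\<And>n. rat_padic_abs p (X n) \<le> B"
    using padic_cauchy_bounded[OF p X] by blast
  show ?thesis
  proof (rule tendsto_sandwich[OF _ _ tendsto_const])
    show "(\<lambda>n. B * rat_padic_abs p (Y n)) \<longlonglongrightarrow> 0"
      using tendsto_mult_left[OF Y, of B] by simp
    show "\<forall>\<^sub>F n in sequentially. rat_padic_abs p (X n * Y n) \<le> B * rat_padic_abs p (Y n)"
      using B by (auto simp: rat_padic_abs_mult[OF p] mult_right_mono)
  qed auto
qed

lemma padic_cauchy_mult:
  assumes p: "prime p" and X: "padic_cauchy p X" and Y: "padic_cauchy p Y"
  shows "padic_cauchy p (\<lambda>n. X n * Y n)"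
  unfolding padic_cauchy_def
proof (intro allI impI)
  fix e :: real assume e: "e > 0"
  obtain B where B: "B > 0" "\<And>n. rat_padic_abs p (X n) \<le> B"
    using padic_cauchy_bounded[OF p X] by blast
  obtain C where C: "C > 0" "\<And>n. rat_padic_abs p (Y n) \<le> C"
    using padic_cauchy_bounded[OF p Y] by blast
  obtain M N where M: "\<forall>m\<ge>M. \<forall>n\<ge>M. rat_padic_abs p (X m - X n) < e / C"
    and N: "\<forall>m\<ge>N. \<forall>n\<ge>N. rat_padic_abs p (Y m - Y n) < e / B"
    using padic_cauchyD[OF X, of "e / C"] padic_cauchyD[OF Y, of "e / B"] e B C by auto
  have "rat_padic_abs p (X m * Y m - X n * Y n) < e" if "m \<ge> max M N" "n \<ge> max M N" for m n
  proof -
    have "rat_padic_abs p (X m * Y m - X n * Y n) \<le>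
        max (rat_padic_abs p (X m * (Y m - Y n))) (rat_padic_abs p ((X m - X n) * Y n))"
      using rat_padic_abs_add_le[OF p, of "X m * (Y m - Y n)" "(X m - X n) * Y n"]
      by (simp add: algebra_simps)
    moreover have "rat_padic_abs p (X m * (Y m - Y n)) < e"
    proof -
      have "rat_padic_abs p (X m * (Y m - Y n)) \<le> B * rat_padic_abs p (Y m - Y n)"
        using B by (simp add: rat_padic_abs_mult[OF p] mult_right_mono)
      also have "\<dots> < B * (e / B)" using N that B by (intro mult_strict_left_mono) auto
      finally show ?thesis using B by simp
    qed
    moreover have "rat_padic_abs p ((X m - X n) * Y n) < e"
    proof -
      have "rat_padic_abs p ((X m - X n) * Y n) \<le> rat_padic_abs p (X m - X n) * C"
        using C by (simp add: rat_padic_abs_mult[OF p] mult_left_mono)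
      also have "\<dots> < e / C * C" using M that C by (intro mult_strict_right_mono) auto
      finally show ?thesis using C by simp
    qed
    ultimately show ?thesis by linarith
  qed
  then show "\<exists>N. \<forall>m\<ge>N. \<forall>n\<ge>N. rat_padic_abs p (X m * Y m - X n * Y n) < e" by blast
qed

lemma padic_cauchy_not_null:
  assumes p: "prime p" and X: "padic_cauchy p X" and nz: "\<not> (\<lambda>n. rat_padic_abs p (X n)) \<longlonglongrightarrow> 0"
  obtains c N where "c > 0" "\<And>n. n \<ge> N \<Longrightarrow> c \<le> rat_padic_abs p (X n)"
proof -
  obtain L where L: "(\<lambda>n. rat_padic_abs p (X n)) \<longlonglongrightarrow> L"
    using padic_cauchy_convergent[OF p X] unfolding convergent_def by blast
  have "L \<ge> 0" using L by (rule LIMSEQ_le_const) auto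
  moreover have "L \<noteq> 0" using L nz by auto
  ultimately have "L > 0" by simp
  then have "\<forall>\<^sub>F n in sequentially. L / 2 < rat_padic_abs p (X n)"
    using order_tendstoD(1)[OF L, of "L / 2"] by simp
  then obtain N where "\<And>n. n \<ge> N \<Longrightarrow> L / 2 < rat_padic_abs p (X n)"
    unfolding eventually_sequentially by blast
  then show ?thesis using that[of "L / 2" N] \<open>L > 0\<close> by force
qed

lemma rat_padic_abs_inverse_diff:
  assumes p: "prime p" and "c > 0" "c \<le> rat_padic_abs p x" "c \<le> rat_padic_abs p y"
  shows "rat_padic_abs p (inverse x - inverse y) \<le> rat_padic_abs p (x - y) / c\<^sup>2"
proof -
  have nz: "x \<noteq> 0" "y \<noteq> 0" using assms by auto
  have "inverse x - inverse y = - (x - y) * inverse (x * y)"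
    using nz by (simp add: field_simps)
  then have eq: "rat_padic_abs p (inverse x - inverse y) =
      rat_padic_abs p (x - y) / (rat_padic_abs p x * rat_padic_abs p y)"
    using rat_padic_abs_minus[OF p, of "x - y"]
    by (simp add: rat_padic_abs_mult[OF p] rat_padic_abs_inverse[OF p] divide_inverse)
  have "c\<^sup>2 \<le> rat_padic_abs p x * rat_padic_abs p y"
    unfolding power2_eq_square using assms by (intro mult_mono) auto
  then show ?thesis unfolding eq using assms by (intro divide_left_mono) (auto intro: mult_pos_pos)
qed

lemma padic_cauchy_inverse:
  assumes p: "prime p" and X: "padic_cauchy p X" and nz: "\<not> (\<lambda>n. rat_padic_abs p (X n)) \<longlonglongrightarrow> 0"
  shows "padic_cauchy p (\<lambda>n. inverse (X n))"
  unfolding padic_cauchy_def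
proof (intro allI impI)
  fix e :: real assume e: "e > 0"
  obtain c M where c: "c > 0" and M: "\<And>n. n \<ge> M \<Longrightarrow> c \<le> rat_padic_abs p (X n)"
    using padic_cauchy_not_null[OF assms] by blast
  obtain N where N: "\<forall>m\<ge>N. \<forall>n\<ge>N. rat_padic_abs p (X m - X n) < e * c\<^sup>2"
    using padic_cauchyD[OF X, of "e * c\<^sup>2"] e c by auto
  have "rat_padic_abs p (inverse (X m) - inverse (X n)) < e" if "m \<ge> max M N" "n \<ge> max M N" for m n
  proof -
    have "rat_padic_abs p (inverse (X m) - inverse (X n)) \<le> rat_padic_abs p (X m - X n) / c\<^sup>2"
      using that M c by (intro rat_padic_abs_inverse_diff[OF p]) auto
    also have "\<dots> < e" using N that c by (simp add: pos_divide_less_eq)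
    finally show ?thesis .
  qed
  then show "\<exists>N. \<forall>m\<ge>N. \<forall>n\<ge>N. rat_padic_abs p (inverse (X m) - inverse (X n)) < e" by blast
qed

lemma padic_null_diff_iff:
  assumes p: "prime p" and XY: "(\<lambda>n. rat_padic_abs p (X n - Y n)) \<longlonglongrightarrow> 0"
  shows "(\<lambda>n. rat_padic_abs p (X n)) \<longlonglongrightarrow> 0 \<longleftrightarrow> (\<lambda>n. rat_padic_abs p (Y n)) \<longlonglongrightarrow> 0"
  using padic_null_add[OF p XY, of Y] padic_null_add[OF p padic_null_minus[OF p XY], of X] by auto

lemma padic_null_inverse_diff:
  assumes p: "prime p" and X: "padic_cauchy p X" and Y: "padic_cauchy p Y"
    and nz: "\<not> (\<lambda>n. rat_padic_abs p (X n)) \<longlonglongrightarrow> 0"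
    and XY: "(\<lambda>n. rat_padic_abs p (X n - Y n)) \<longlonglongrightarrow> 0"
  shows "(\<lambda>n. rat_padic_abs p (inverse (X n) - inverse (Y n))) \<longlonglongrightarrow> 0"
proof -
  have nz': "\<not> (\<lambda>n. rat_padic_abs p (Y n)) \<longlonglongrightarrow> 0"
    using padic_null_diff_iff[OF p XY] nz by simp
  obtain c M where c: "c > 0" "\<And>n. n \<ge> M \<Longrightarrow> c \<le> rat_padic_abs p (X n)"
    using padic_cauchy_not_null[OF p X nz] by blast
  obtain d N where d: "d > 0" "\<And>n. n \<ge> N \<Longrightarrow> d \<le> rat_padic_abs p (Y n)"
    using padic_cauchy_not_null[OF p Y nz'] by blast
  define b where "b = min c d"
  have b: "b > 0" using c d by (simp add: b_def)
  show ?thesis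
  proof (rule tendsto_sandwich[OF _ _ tendsto_const])
    show "(\<lambda>n. rat_padic_abs p (X n - Y n) / b\<^sup>2) \<longlonglongrightarrow> 0"
      using tendsto_divide[OF XY tendsto_const, of "b\<^sup>2"] b by simp
    show "\<forall>\<^sub>F n in sequentially. rat_padic_abs p (inverse (X n) - inverse (Y n))
        \<le> rat_padic_abs p (X n - Y n) / b\<^sup>2"
      unfolding eventually_sequentially
      using c d b by (intro exI[of _ "max M N"] allI impI rat_padic_abs_inverse_diff[OF p])
        (force simp: b_def)+
  qed auto
qed

lemma part_equivp_padic_rel: "part_equivp (padic_rel TYPE('p::prime_card))"
proof (rule part_equivpI)
  show "\<exists>X. padic_rel TYPE('p) X X"
    by (rule exI[of _ "\<lambda>_. 0"]) (simp add: padic_rel_def padic_cauchy_const)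
  show "symp (padic_rel TYPE('p))"
    by (auto intro!: sympI simp: padic_rel_def intro: padic_null_minus[OF prime_card])
  show "transp (padic_rel TYPE('p))"
  proof (rule transpI)
    fix X Y Z assume "padic_rel TYPE('p) X Y" "padic_rel TYPE('p) Y Z"
    then show "padic_rel TYPE('p) X Z"
      using padic_null_add[OF prime_card[where 'a='p], of "\<lambda>n. X n - Y n" "\<lambda>n. Y n - Z n"]
      by (simp add: padic_rel_def)
  qed
qed

typedef (overloaded) 'p padic = "{C. \<exists>X. padic_rel TYPE('p::prime_card) X X \<and> C = Collect (padic_rel TYPE('p) X)}"
  using part_equivp_padic_rel[where 'p='p] by (auto elim: part_equivpE)

definition padic_of_seq :: "(nat \<Rightarrow> rat) \<Rightarrow> 'p::prime_card padic" where
  "padic_of_seq X = Abs_padic (Collect (padic_rel TYPE('p) X))"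

definition seq_of_padic :: "'p::prime_card padic \<Rightarrow> nat \<Rightarrow> rat" where
  "seq_of_padic x = (SOME X. X \<in> Rep_padic x)"

definition cr_padic :: "(nat \<Rightarrow> rat) \<Rightarrow> 'p::prime_card padic \<Rightarrow> bool" where
  "cr_padic X x \<longleftrightarrow> padic_rel TYPE('p) X X \<and> padic_of_seq X = x"

lemma Quotient_padic:
  "Quotient (padic_rel TYPE('p::prime_card)) (padic_of_seq :: _ \<Rightarrow> 'p padic) seq_of_padic cr_padic"
proof -
  interpret quot_type "padic_rel TYPE('p)" "Abs_padic :: _ \<Rightarrow> 'p padic" Rep_padic
  proof
    show "part_equivp (padic_rel TYPE('p))" by (rule part_equivp_padic_rel)
    show "\<exists>x. padic_rel TYPE('p) x x \<and> Rep_padic y = Collect (padic_rel TYPE('p) x)" for y :: "'p padic"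
      using Rep_padic[of y] by auto
    show "Abs_padic (Rep_padic x) = x" for x :: "'p padic" by (rule Rep_padic_inverse)
    show "Rep_padic (Abs_padic c :: 'p padic) = c"
      if "\<exists>x. padic_rel TYPE('p) x x \<and> c = Collect (padic_rel TYPE('p) x)" for c
      using that by (intro Abs_padic_inverse) simp
    show "(Rep_padic x = Rep_padic y) = (x = y)" for x y :: "'p padic" by (rule Rep_padic_inject)
  qed
  have abs_eq: "(padic_of_seq :: _ \<Rightarrow> 'p padic) = abs" by (auto simp: padic_of_seq_def abs_def)
  have rep_eq: "(seq_of_padic :: 'p padic \<Rightarrow> _) = rep" by (auto simp: seq_of_padic_def rep_def)
  have cr: "(cr_padic :: _ \<Rightarrow> 'p padic \<Rightarrow> _) \<equiv> \<lambda>x y. padic_rel TYPE('p) x x \<and> padic_of_seq x = y"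
    by (rule eq_reflection) (auto simp: cr_padic_def fun_eq_iff)
  show ?thesis
    using Quotient3_to_Quotient[OF Quotient cr[unfolded abs_eq]] by (simp add: abs_eq rep_eq)
qed

setup_lifting Quotient_padic

instantiation padic :: (prime_card) field
begin

lift_definition zero_padic :: "'a padic" is "\<lambda>n. 0"
  by (simp add: padic_rel_def padic_cauchy_const)

lift_definition one_padic :: "'a padic" is "\<lambda>n. 1"
  by (simp add: padic_rel_def padic_cauchy_const)

lift_definition plus_padic :: "'a padic \<Rightarrow> 'a padic \<Rightarrow> 'a padic" is "\<lambda>X Y n. X n + Y n"
proof -
  fix X X' Y Y' assume "padic_rel TYPE('a) X X'" "padic_rel TYPE('a) Y Y'"
  then show "padic_rel TYPE('a) (\<lambda>n. X n + Y n) (\<lambda>n. X' n + Y' n)"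
    using padic_null_add[OF prime_card[where 'a='a], of "\<lambda>n. X n - X' n" "\<lambda>n. Y n - Y' n"]
    by (auto simp: padic_rel_def padic_cauchy_add[OF prime_card] algebra_simps)
qed

lift_definition uminus_padic :: "'a padic \<Rightarrow> 'a padic" is "\<lambda>X n. - X n"
proof -
  fix X X' assume "padic_rel TYPE('a) X X'"
  then show "padic_rel TYPE('a) (\<lambda>n. - X n) (\<lambda>n. - X' n)"
    using padic_null_minus[OF prime_card[where 'a='a], of X X']
    by (auto simp: padic_rel_def padic_cauchy_minus[OF prime_card])
qed

lift_definition times_padic :: "'a padic \<Rightarrow> 'a padic \<Rightarrow> 'a padic" is "\<lambda>X Y n. X n * Y n"
proof -
  fix X X' Y Y' assume *: "padic_rel TYPE('a) X X'" "padic_rel TYPE('a) Y Y'"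
  have "(\<lambda>n. rat_padic_abs CARD('a) (X n * (Y n - Y' n) + Y' n * (X n - X' n))) \<longlonglongrightarrow> 0"
    using * by (intro padic_null_add padic_null_mult prime_card) (auto simp: padic_rel_def)
  moreover have "X n * (Y n - Y' n) + Y' n * (X n - X' n) = X n * Y n - X' n * Y' n" for n
    by (simp add: algebra_simps)
  ultimately show "padic_rel TYPE('a) (\<lambda>n. X n * Y n) (\<lambda>n. X' n * Y' n)"
    using * by (simp add: padic_rel_def padic_cauchy_mult[OF prime_card])
qed

lift_definition inverse_padic :: "'a padic \<Rightarrow> 'a padic"
  is "\<lambda>X. if (\<lambda>n. rat_padic_abs CARD('a) (X n)) \<longlonglongrightarrow> 0 then (\<lambda>n. 0) else (\<lambda>n. inverse (X n))"
proof -
  fix X Y assume XY: "padic_rel TYPE('a) X Y"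
  then have d: "(\<lambda>n. rat_padic_abs CARD('a) (X n - Y n)) \<longlonglongrightarrow> 0"
    and X: "padic_cauchy CARD('a) X" and Y: "padic_cauchy CARD('a) Y"
    by (simp_all add: padic_rel_def)
  note null_iff = padic_null_diff_iff[OF prime_card d]
  show "padic_rel TYPE('a)
      (if (\<lambda>n. rat_padic_abs CARD('a) (X n)) \<longlonglongrightarrow> 0 then (\<lambda>n. 0) else (\<lambda>n. inverse (X n)))
      (if (\<lambda>n. rat_padic_abs CARD('a) (Y n)) \<longlonglongrightarrow> 0 then (\<lambda>n. 0) else (\<lambda>n. inverse (Y n)))"
  proof (cases "(\<lambda>n. rat_padic_abs CARD('a) (X n)) \<longlonglongrightarrow> 0")
    case True
    then show ?thesis using null_iff by (simp add: padic_rel_def padic_cauchy_const)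
  next
    case False
    then have "\<not> (\<lambda>n. rat_padic_abs CARD('a) (Y n)) \<longlonglongrightarrow> 0" using null_iff by blast
    then show ?thesis
      using False padic_cauchy_inverse[OF prime_card X] padic_cauchy_inverse[OF prime_card Y]
        padic_null_inverse_diff[OF prime_card X Y False d] by (simp add: padic_rel_def)
  qed
qed

definition "x - y = (x :: 'a padic) + - y"

definition "x div y = (x :: 'a padic) * inverse y"

instance
proof
  fix a b c :: "'a padic"
  note defs = padic_rel_def padic_cauchy_add[OF prime_card] padic_cauchy_mult[OF prime_card]
    padic_cauchy_minus[OF prime_card] padic_cauchy_const
  show "a + b + c = a + (b + c)" by transfer (simp add: defs algebra_simps)
  show "a + b = b + a" by transfer (simp add: defs algebra_simps)
  show "0 + a = a" by transfer (simp add: defs)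
  show "- a + a = 0" by transfer (simp add: defs)
  show "a - b = a + - b" by (simp add: minus_padic_def)
  show "a * b * c = a * (b * c)" by transfer (simp add: defs algebra_simps)
  show "a * b = b * a" by transfer (simp add: defs algebra_simps)
  show "1 * a = a" by transfer (simp add: defs)
  show "(a + b) * c = a * c + b * c" by transfer (simp add: defs algebra_simps)
  show "(0::'a padic) \<noteq> 1"
    by transfer (simp add: defs rat_padic_abs_minus[OF prime_card] rat_padic_abs_1[OF prime_card] tendsto_const_iff)
  show "a \<noteq> 0 \<Longrightarrow> inverse a * a = 1"
  proof transfer
    fix X assume X: "padic_rel TYPE('a) X X" and "\<not> padic_rel TYPE('a) X (\<lambda>n. 0)"
    then have c: "padic_cauchy CARD('a) X" and nz: "\<not> (\<lambda>n. rat_padic_abs CARD('a) (X n)) \<longlonglongrightarrow> 0"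
      by (auto simp: defs)
    obtain d N where d: "d > 0" "\<And>n. n \<ge> N \<Longrightarrow> d \<le> rat_padic_abs CARD('a) (X n)"
      using padic_cauchy_not_null[OF prime_card c nz] by blast
    have "\<forall>\<^sub>F n in sequentially. rat_padic_abs CARD('a) (inverse (X n) * X n - 1) = 0"
      unfolding eventually_sequentially
    proof (intro exI[of _ N] allI impI)
      fix n assume "N \<le> n"
      then have "X n \<noteq> 0" using d by force
      then show "rat_padic_abs CARD('a) (inverse (X n) * X n - 1) = 0" by simp
    qed
    then have "(\<lambda>n. rat_padic_abs CARD('a) (inverse (X n) * X n - 1)) \<longlonglongrightarrow> 0"
      by (rule tendsto_eventually)
    then show "padic_rel TYPE('a) (\<lambda>n. (if (\<lambda>n. rat_padic_abs CARD('a) (X n)) \<longlonglongrightarrow> 0 then \<lambda>n. 0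
        else (\<lambda>n. inverse (X n))) n * X n) (\<lambda>n. 1)"
      using nz by (simp add: defs c padic_cauchy_inverse[OF prime_card c nz])
  qed
  show "a div b = a * inverse b" by (simp add: divide_padic_def)
  show "inverse (0::'a padic) = 0" by transfer (simp add: defs)
qed

end

lift_definition padic_abs :: "'p::prime_card padic \<Rightarrow> real"
  is "\<lambda>X. lim (\<lambda>n. rat_padic_abs CARD('p) (X n))"
proof -
  fix X Y assume XY: "padic_rel TYPE('p) X Y"
  have d: "(\<lambda>n. rat_padic_abs CARD('p) (X n - Y n)) \<longlonglongrightarrow> 0" using XY by (simp add: padic_rel_def)
  have "(\<lambda>n. rat_padic_abs CARD('p) (X n) - rat_padic_abs CARD('p) (Y n)) \<longlonglongrightarrow> 0"
    by (rule Lim_null_comparison[OF _ d]) (simp add: rat_padic_abs_triangle[OF prime_card])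
  moreover have "convergent (\<lambda>n. rat_padic_abs CARD('p) (Y n))"
    using padic_cauchy_convergent[OF prime_card] XY by (auto simp: padic_rel_def)
  then have "(\<lambda>n. rat_padic_abs CARD('p) (Y n)) \<longlonglongrightarrow> lim (\<lambda>n. rat_padic_abs CARD('p) (Y n))"
    by (simp add: convergent_LIMSEQ_iff)
  ultimately have "(\<lambda>n. rat_padic_abs CARD('p) (X n)) \<longlonglongrightarrow> lim (\<lambda>n. rat_padic_abs CARD('p) (Y n))"
    using tendsto_add by fastforce
  then show "lim (\<lambda>n. rat_padic_abs CARD('p) (X n)) = lim (\<lambda>n. rat_padic_abs CARD('p) (Y n))"
    by (rule limI)
qed

lemma padic_abs_LIMSEQ:
  assumes "padic_rel TYPE('p::prime_card) X X"
  shows "(\<lambda>n. rat_padic_abs CARD('p) (X n)) \<longlonglongrightarrow> lim (\<lambda>n. rat_padic_abs CARD('p) (X n))"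
  using assms padic_cauchy_convergent[OF prime_card[where 'a='p]]
  by (auto simp: padic_rel_def convergent_LIMSEQ_iff)

lemma padic_abs_eq_0_iff [simp]: "padic_abs x = 0 \<longleftrightarrow> x = 0"
proof transfer
  fix X assume X: "padic_rel TYPE('a) X X"
  note L = padic_abs_LIMSEQ[OF X]
  show "lim (\<lambda>n. rat_padic_abs CARD('a) (X n)) = 0 \<longleftrightarrow> padic_rel TYPE('a) X (\<lambda>n. 0)"
  proof
    assume "lim (\<lambda>n. rat_padic_abs CARD('a) (X n)) = 0"
    then show "padic_rel TYPE('a) X (\<lambda>n. 0)"
      using X L by (simp add: padic_rel_def padic_cauchy_const)
  next
    assume "padic_rel TYPE('a) X (\<lambda>n. 0)"
    then have "(\<lambda>n. rat_padic_abs CARD('a) (X n)) \<longlonglongrightarrow> 0" by (simp add: padic_rel_def)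
    then show "lim (\<lambda>n. rat_padic_abs CARD('a) (X n)) = 0" by (rule limI)
  qed
qed

lemma padic_abs_nonneg [simp]: "0 \<le> padic_abs x"
proof transfer
  fix X assume "padic_rel TYPE('a) X X"
  from padic_abs_LIMSEQ[OF this] show "0 \<le> lim (\<lambda>n. rat_padic_abs CARD('a) (X n))"
    by (rule LIMSEQ_le_const) auto
qed

lemma padic_abs_mult: "padic_abs (x * y) = padic_abs x * padic_abs y"
proof transfer
  fix X Y assume "padic_rel TYPE('a) X X" "padic_rel TYPE('a) Y Y"
  from tendsto_mult[OF this[THEN padic_abs_LIMSEQ]]
  show "lim (\<lambda>n. rat_padic_abs CARD('a) (X n * Y n)) =
      lim (\<lambda>n. rat_padic_abs CARD('a) (X n)) * lim (\<lambda>n. rat_padic_abs CARD('a) (Y n))"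
    by (intro limI) (simp add: rat_padic_abs_mult[OF prime_card])
qed

lemma padic_abs_add_le: "padic_abs (x + y) \<le> max (padic_abs x) (padic_abs y)"
proof transfer
  fix X Y assume X: "padic_rel TYPE('a) X X" and Y: "padic_rel TYPE('a) Y Y"
  have XY: "padic_rel TYPE('a) (\<lambda>n. X n + Y n) (\<lambda>n. X n + Y n)"
    using X Y by (auto simp: padic_rel_def padic_cauchy_add[OF prime_card])
  note lim = padic_abs_LIMSEQ[OF XY] tendsto_max[OF padic_abs_LIMSEQ[OF X] padic_abs_LIMSEQ[OF Y]]
  have "\<forall>n\<ge>0. rat_padic_abs CARD('a) (X n + Y n) \<le>
      max (rat_padic_abs CARD('a) (X n)) (rat_padic_abs CARD('a) (Y n))"
    by (intro allI impI rat_padic_abs_add_le prime_card)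
  then show "lim (\<lambda>n. rat_padic_abs CARD('a) (X n + Y n)) \<le>
      max (lim (\<lambda>n. rat_padic_abs CARD('a) (X n))) (lim (\<lambda>n. rat_padic_abs CARD('a) (Y n)))"
    using LIMSEQ_le[OF lim] by blast
qed

lemma padic_abs_minus [simp]: "padic_abs (- x) = padic_abs x"
  by transfer (simp add: rat_padic_abs_minus[OF prime_card])

instantiation padic :: (prime_card) metric_space
begin

definition dist_padic :: "'a padic \<Rightarrow> 'a padic \<Rightarrow> real" where
  "dist_padic x y = padic_abs (x - y)"

definition uniformity_padic :: "('a padic \<times> 'a padic) filter" where
  "uniformity_padic = (INF e\<in>{0 <..}. principal {(x, y). dist x y < e})"

definition open_padic :: "'a padic set \<Rightarrow> bool" where
  "open_padic U \<longleftrightarrow> (\<forall>x\<in>U. eventually (\<lambda>(x', y). x' = x \<longrightarrow> y \<in> U) uniformity)"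

instance
proof
  fix x y z :: "'a padic"
  show "dist x y = 0 \<longleftrightarrow> x = y" by (simp add: dist_padic_def)
  have "padic_abs (x - y) \<le> max (padic_abs (x - z)) (padic_abs (z - y))"
    using padic_abs_add_le[of "x - z" "z - y"] by simp
  also have "padic_abs (z - y) = padic_abs (y - z)"
    using padic_abs_minus[of "y - z"] by simp
  finally show "dist x y \<le> dist x z + dist y z"
    using padic_abs_nonneg[of "x - z"] padic_abs_nonneg[of "y - z"]
    unfolding dist_padic_def by linarith
  show "uniformity = (INF e\<in>{0 <..}. principal {(x :: 'a padic, y). dist x y < e})"
    by (rule uniformity_padic_def)
  show "open U \<longleftrightarrow> (\<forall>x\<in>U. \<forall>\<^sub>F (x', y) in uniformity. x' = x \<longrightarrow> y \<in> U)" for U :: "'a padic set"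
    by (rule open_padic_def)
qed

end

definition padic_ints :: "'p::prime_card padic set" where
  "padic_ints = {x. padic_abs x \<le> 1}"

section \<open>The Bruhat--Tits tree\<close>

definition gl2_padic :: "('p::prime_card padic^2^2) set" where
  "gl2_padic = {g. invertible g}"

definition gl2_padic_ints :: "('p::prime_card padic^2^2) set" where
  "gl2_padic_ints = {k. (\<forall>i j. k $ i $ j \<in> padic_ints) \<and>
     (\<exists>k'. (\<forall>i j. k' $ i $ j \<in> padic_ints) \<and> k ** k' = mat 1 \<and> k' ** k = mat 1)}"

text \<open>A vertex, that is an element of \<open>PGL(2,\<rat>\<^sub>p)/PGL(2,\<int>\<^sub>p)\<close>, is represented as a
  left coset of the subgroup \<open>\<rat>\<^sub>p\<^sup>\<times> GL(2,\<int>\<^sub>p)\<close> in \<open>GL(2,\<rat>\<^sub>p)\<close>.\<close>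

type_synonym 'p bt_vertex = "('p padic^2^2) set"

definition bt_class :: "'p::prime_card padic^2^2 \<Rightarrow> 'p bt_vertex" where
  "bt_class g = {mat c ** g ** k | c k. c \<noteq> 0 \<and> k \<in> gl2_padic_ints}"

definition bt_vertices :: "'p::prime_card bt_vertex set" where
  "bt_vertices = bt_class ` gl2_padic"

definition bt_base :: "'p::prime_card bt_vertex" where
  "bt_base = bt_class (mat 1)"

text \<open>The coset of \<open>g\<close> corresponds to the homothety class of the lattice \<open>g \<int>\<^sub>p\<^sup>2\<close>; two classes
  are adjacent iff they have representatives with \<open>pL \<subset> L' \<subset> L\<close>, both inclusions strict.\<close>

definition padic_lattice :: "'p::prime_card padic^2^2 \<Rightarrow> ('p padic^2) set" where
  "padic_lattice g = {g *v z | z. \<forall>i. z $ i \<in> padic_ints}"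

definition bt_adj :: "'p::prime_card bt_vertex \<Rightarrow> 'p bt_vertex \<Rightarrow> bool" where
  "bt_adj x y \<longleftrightarrow> x \<in> bt_vertices \<and> y \<in> bt_vertices \<and>
     (\<exists>g\<in>x. \<exists>h\<in>y. (\<lambda>v. of_nat CARD('p) *s v) ` padic_lattice g \<subset> padic_lattice h \<and>
        padic_lattice h \<subset> padic_lattice g)"

definition bt_dist :: "'p::prime_card bt_vertex \<Rightarrow> 'p bt_vertex \<Rightarrow> nat" where
  "bt_dist i j = (LEAST n. (i, j) \<in> {(x, y). bt_adj x y} ^^ n)"

definition bt_simple_path :: "'p::prime_card bt_vertex \<Rightarrow> 'p bt_vertex \<Rightarrow> 'p bt_vertex list \<Rightarrow> bool" where
  "bt_simple_path i j ps \<longleftrightarrow> ps \<noteq> [] \<and> hd ps = i \<and> last ps = j \<and> set ps \<subseteq> bt_vertices \<and>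
     distinct ps \<and> successively bt_adj ps"

text \<open>The vertices \<open>i\<close> such that the path from the base vertex to \<open>i\<close> passes through \<open>w\<close>.\<close>

definition bt_branch :: "'p::prime_card bt_vertex \<Rightarrow> 'p bt_vertex set" where
  "bt_branch w = {i. \<exists>ps. bt_simple_path bt_base i ps \<and> w \<in> set ps}"

section \<open>The boundary\<close>

definition bt_boundary :: "(nat \<Rightarrow> 'p::prime_card bt_vertex) set" where
  "bt_boundary = {r. r 0 = bt_base \<and> (\<forall>n. bt_adj (r n) (r (Suc n))) \<and> inj r}"

definition bt_boundary_ball :: "'p::prime_card bt_vertex \<Rightarrow> (nat \<Rightarrow> 'p bt_vertex) set" where
  "bt_boundary_ball i = {r \<in> bt_boundary. i \<in> range r}"

definition bt_boundary_topology :: "(nat \<Rightarrow> 'p::prime_card bt_vertex) topology" where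
  "bt_boundary_topology = topology_generated_by (bt_boundary_ball ` bt_vertices)"

definition locally_constant_on :: "'a topology \<Rightarrow> ('a \<Rightarrow> 'b) \<Rightarrow> bool" where
  "locally_constant_on T f \<longleftrightarrow> (\<forall>x\<in>topspace T. \<exists>U. openin T U \<and> x \<in> U \<and> (\<forall>y\<in>U. f y = f x))"

text \<open>The identification of the projective line over the p-adic numbers (\<open>None\<close> is the point at
  infinity) with the boundary. The point \<open>x\<close> stands for the line \<open>\<ell>\<close> through \<open>(x,1)\<close>, infinity for
  the line through \<open>(1,0)\<close>, and the \<open>n\<close>-th vertex of the ray is the class of the lattice
  \<open>(\<ell> \<inter> \<int>\<^sub>p\<^sup>2) + p\<^sup>n \<int>\<^sub>p\<^sup>2\<close>. This lattice is generated by \<open>(x,1)\<close> and \<open>(p\<^sup>n,0)\<close> if \<open>x\<close> is an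
  integer, and by \<open>(1,1/x)\<close> and \<open>(0,p\<^sup>n)\<close> otherwise, where \<open>1/\<infinity> = 0\<close>. So the boundary balls at
  distance \<open>n \<ge> 1\<close> from the base vertex are the sets \<open>a + p\<^sup>n \<int>\<^sub>p\<close> with integral \<open>a\<close> and the sets
  \<open>{x. 1/x \<in> b + p\<^sup>n \<int>\<^sub>p}\<close> with \<open>b\<close> in \<open>p \<int>\<^sub>p\<close>.\<close>

definition padic_ray_int :: "'p::prime_card padic \<Rightarrow> nat \<Rightarrow> 'p bt_vertex" where
  "padic_ray_int x n = bt_class (vector [vector [of_nat CARD('p) ^ n, x], vector [0, 1]])"

definition padic_ray_inv :: "'p::prime_card padic \<Rightarrow> nat \<Rightarrow> 'p bt_vertex" where
  "padic_ray_inv b n = bt_class (vector [vector [1, 0], vector [b, of_nat CARD('p) ^ n]])"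

fun proj_line_ray :: "'p::prime_card padic option \<Rightarrow> nat \<Rightarrow> 'p bt_vertex" where
  "proj_line_ray (Some x) = (if x \<in> padic_ints then padic_ray_int x else padic_ray_inv (inverse x))"
| "proj_line_ray None = padic_ray_inv 0"

section \<open>Measures\<close>

definition is_boundary_measure :: "(nat \<Rightarrow> 'p::prime_card bt_vertex) measure \<Rightarrow> bool" where
  "is_boundary_measure M \<longleftrightarrow> space M = bt_boundary \<and>
     sets M = sigma_sets bt_boundary {U. openin bt_boundary_topology U} \<and>
     (\<forall>i\<in>bt_vertices - {bt_base}.
        emeasure M (bt_boundary_ball i) = ennreal (1 / real CARD('p) ^ bt_dist bt_base i))"

definition is_padic_haar_measure :: "'p::prime_card padic measure \<Rightarrow> bool" where
  "is_padic_haar_measure M \<longleftrightarrow> sets M = sets borel \<and>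
     (\<forall>a. \<forall>B\<in>sets borel. emeasure M ((+) a ` B) = emeasure M B) \<and> emeasure M padic_ints = 1"

section \<open>The extension problem and the Vladimirov derivative\<close>

definition bt_weight :: "real \<Rightarrow> 'p::prime_card bt_vertex \<Rightarrow> 'p bt_vertex \<Rightarrow> real" where
  "bt_weight s i j = real CARD('p) powr (real (bt_dist bt_base i) * (s - 1))
                   + real CARD('p) powr (real (bt_dist bt_base j) * (s - 1))"

definition bt_laplacian ::
    "real \<Rightarrow> ('p::prime_card bt_vertex \<Rightarrow> real) \<Rightarrow> 'p bt_vertex \<Rightarrow> real" where
  "bt_laplacian s \<phi> i = (\<Sum>j | bt_adj i j. bt_weight s i j * (\<phi> i - \<phi> j))"

definition bt_tends_to :: "(nat \<Rightarrow> 'p::prime_card bt_vertex) \<Rightarrow> 'p bt_vertex filter" where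
  "bt_tends_to x = (INF w\<in>range x. principal (bt_branch w))"

definition solves_extension_problem ::
    "real \<Rightarrow> ((nat \<Rightarrow> 'p::prime_card bt_vertex) \<Rightarrow> real) \<Rightarrow> ('p bt_vertex \<Rightarrow> real) \<Rightarrow> bool" where
  "solves_extension_problem s f \<phi> \<longleftrightarrow>
     (\<forall>i\<in>bt_vertices. bt_laplacian s \<phi> i = 0) \<and>
     (\<forall>x\<in>bt_boundary. (\<phi> \<longlongrightarrow> f x) (bt_tends_to x))"

definition padic_Gamma :: "real \<Rightarrow> real \<Rightarrow> real" where
  "padic_Gamma p \<alpha> = (1 - p powr (\<alpha> - 1)) / (1 - p powr (- \<alpha>))"

definition vladimirov_integrand ::
    "real \<Rightarrow> ('p::prime_card padic \<Rightarrow> real) \<Rightarrow> 'p padic \<Rightarrow> 'p padic \<Rightarrow> real" where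
  "vladimirov_integrand s u x z = (u x - u z) / padic_abs (x - z) powr (1 + s)"

definition vladimirov ::
    "'p::prime_card padic measure \<Rightarrow> real \<Rightarrow> ('p padic \<Rightarrow> real) \<Rightarrow> 'p padic \<Rightarrow> real" where
  "vladimirov M s u x =
     - (1 / padic_Gamma (real CARD('p)) (- s)) * (\<integral>z. vladimirov_integrand s u x z \<partial>M)"

definition boundary_factor :: "real \<Rightarrow> 'p::prime_card padic \<Rightarrow> real" where
  "boundary_factor s x = (if x \<in> padic_ints then 1 else padic_abs x powr (s - 1))"

end

theory Submission
  imports Defs
begin

text \<open>Both sides of the identity are quadratic forms in \<open>f\<close>, and both are diagonalised by the
  martingale \<open>F v\<close> of averages of \<open>f\<close> over the boundary balls. With \<open>\<theta> = p powr (-s)\<close>, the solution of the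
  extension problem is \<open>\<phi> v = \<theta> \<phi> (parent v) + (1 - \<theta>) F v\<close> with \<open>\<phi> = F\<close> at the base vertex, so the
  edge differences of \<open>\<phi>\<close> satisfy a linear recurrence driven by the martingale differences. By
  orthogonality of these differences, the energy depends only on the mean squares \<open>A\<^sub>n\<close> of \<open>F\<close> at
  level \<open>n\<close> and equals
  \<open>(1 + p\<theta>)(1 - \<theta>) \<Sum>\<^sub>n (A\<^sub>n - A\<^sub>n\<^sub>-\<^sub>1) / \<theta>\<^sup>n\<close>.

  On the other side, writing \<open>M(x) = max(1, \<bar>x\<bar>)\<close>, the measure \<open>dx / M(x)\<^sup>2\<close> corresponds to \<open>\<mu>\<^sub>0\<close>, and
  \<open>\<bar>x - z\<bar> = \<delta>(x,z) M(x) M(z)\<close>, where \<open>\<delta>(x,z) = p\<^sup>-\<^sup>k\<close> if the rays to \<open>x\<close> and \<open>z\<close> share exactly \<open>k\<close> edges.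
  Since \<open>a\<close> is a power of \<open>M\<close>, the form \<open>\<integral> a f D\<^sup>s(af) dx\<close> splits into a multiple of the mean square
  of \<open>f\<close>, coming from \<open>D\<^sup>s a\<close>, and the kernel \<open>\<delta>\<^sup>-\<^sup>1\<^sup>-\<^sup>s\<close>. Expanding the latter over the common
  ancestors of \<open>x\<close> and \<open>z\<close> gives a combination of the \<open>A\<^sub>n\<close>, and Abel summation matches the two sides.\<close>

subsection \<open>p-adic numbers\<close>

text \<open>The factor \<open>\<theta>\<close> comes from the weights. With b = p powr (s - 1), the
  edges at a vertex of level n > 0 have weight b^n (1 + b) towards the children and b^(n-1) (1 + b)
  towards the parent, so harmonicity equates the sum of the increments to the children with 1/b = p
  \<open>\<theta>\<close> times the increment from the parent. Smoothing by \<open>\<theta>\<close>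
  produces exactly this flux, because such a vertex has p children. The explicit extension must be
  shown to be the given solution: an increase of the difference of two solutions is pursued along a
  ray to infinity, where the boundary values cancel. The p-adic side meets the tree through the
  vertices \<open>ray z n\<close>. Infinity causes no separate case for vertices, since every vertex
  lies on the ray of a finite point. Hence the masses of all balls can be computed on Q_p, and
  comparing masses also yields the number of children of a vertex. From there on the argument lives
  on an abstract rooted tree, and the only genuinely p-adic integral left is that of D^s a, whose
  integrand depends on x and z only through their levels.\<close>

lift_definition padic_of_rat :: "rat \<Rightarrow> 'p::prime_card padic" is "\<lambda>r n. r"
  by (simp add: padic_rel_def padic_cauchy_const)

lemma padic_of_rat_add: "padic_of_rat (a + b) = padic_of_rat a + padic_of_rat b"
  by transfer (simp add: padic_rel_def padic_cauchy_const)

lemma padic_of_rat_minus: "padic_of_rat (- a) = - padic_of_rat a"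
  by transfer (simp add: padic_rel_def padic_cauchy_const)

lemma padic_of_rat_0: "padic_of_rat 0 = 0"
  by transfer (simp add: padic_rel_def padic_cauchy_const)

lemma padic_of_rat_1: "padic_of_rat 1 = 1"
  by transfer (simp add: padic_rel_def padic_cauchy_const)

lemma padic_of_rat_diff: "padic_of_rat (a - b) = padic_of_rat a - padic_of_rat b"
  using padic_of_rat_add[of a "- b"] by (simp add: padic_of_rat_minus)

lemma padic_of_rat_of_nat: "padic_of_rat (of_nat n) = of_nat n"
  by (induction n) (simp_all add: padic_of_rat_0 padic_of_rat_1 padic_of_rat_add)

lemma padic_abs_of_rat: "padic_abs (padic_of_rat r :: 'p::prime_card padic) = rat_padic_abs CARD('p) r"
  by transfer simp

text \<open>A representing Cauchy sequence supplies r: a term from which on all differences stay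
  below e/2, a bound that survives the limit as \<open>\<le>\<close> e/2.\<close>

lemma padic_approx_rat:
  assumes "e > 0"
  obtains r where "padic_abs (x - padic_of_rat r :: 'p::prime_card padic) < e"
proof -
  have "\<exists>r. padic_abs (x - padic_of_rat r :: 'p::prime_card padic) < e"
  proof -
    have "\<exists>r. padic_abs (x + - padic_of_rat r :: 'p::prime_card padic) < e"
      using assms
    proof (transfer fixing: e)
      fix X assume e: "e > 0" and X: "padic_rel TYPE('p) X X"
      then have c: "padic_cauchy CARD('p) X" by (simp add: padic_rel_def)
      obtain N where N: "\<And>m n. m \<ge> N \<Longrightarrow> n \<ge> N \<Longrightarrow> rat_padic_abs CARD('p) (X m - X n) < e / 2"
        using padic_cauchyD[OF c, of "e / 2"] e by auto
      have "padic_rel TYPE('p) (\<lambda>n. X n + - X N) (\<lambda>n. X n + - X N)"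
        using padic_cauchy_add[OF prime_card c padic_cauchy_const[of _ "- X N"]]
        by (simp add: padic_rel_def)
      from padic_abs_LIMSEQ[OF this]
      have "lim (\<lambda>n. rat_padic_abs CARD('p) (X n + - X N)) \<le> e / 2"
        by (rule LIMSEQ_le_const2) (use N in \<open>auto intro!: exI[of _ N] less_imp_le\<close>)
      then show "\<exists>r. lim (\<lambda>n. rat_padic_abs CARD('p) (X n + - r)) < e"
        using e by (intro exI[of _ "X N"]) simp
    qed
    then show ?thesis by simp
  qed
  then show ?thesis using that by blast
qed

section \<open>Ultrametric rules, the values of the absolute value, and residues\<close>

lemma padic_abs_0 [simp]: "padic_abs 0 = 0" by simp

lemma padic_abs_1 [simp]: "padic_abs (1 :: 'p::prime_card padic) = 1"
  using padic_abs_of_rat[of 1, where 'p='p] rat_padic_abs_1[OF prime_card[where 'a='p]]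
  by (simp add: padic_of_rat_1)

lemma padic_abs_inverse: "padic_abs (inverse x) = inverse (padic_abs x)"
proof (cases "x = 0")
  case False
  then have "padic_abs x * padic_abs (inverse x) = 1" by (simp flip: padic_abs_mult)
  then show ?thesis by (simp add: inverse_unique)
qed simp

lemma padic_abs_divide: "padic_abs (x / y) = padic_abs x / padic_abs y"
  by (simp add: divide_inverse padic_abs_mult padic_abs_inverse)

lemma padic_abs_power: "padic_abs (x ^ n) = padic_abs x ^ n"
  by (induction n) (simp_all add: padic_abs_mult)

lemma padic_abs_power_int: "padic_abs (x powi n) = padic_abs x powi n"
  by (simp add: power_int_def padic_abs_power padic_abs_inverse)

lemma padic_abs_minus_commute: "padic_abs (x - y) = padic_abs (y - x)"
  using padic_abs_minus[of "x - y"] by simp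

lemma padic_abs_diff_le: "padic_abs (x - y) \<le> max (padic_abs x) (padic_abs y)"
  using padic_abs_add_le[of x "- y"] by simp

lemma padic_abs_add_eq:
  assumes "padic_abs x < padic_abs y" shows "padic_abs (x + y) = padic_abs y"
proof (rule antisym)
  show "padic_abs (x + y) \<le> padic_abs y" using padic_abs_add_le[of x y] assms by simp
  show "padic_abs y \<le> padic_abs (x + y)" using padic_abs_diff_le[of "x + y" x] assms by simp
qed

lemma padic_abs_diff_eq_right:
  assumes "padic_abs x < padic_abs y" shows "padic_abs (x - y) = padic_abs y"
  using padic_abs_add_eq[of x "- y"] assms by simp

lemma padic_abs_diff_eq_left:
  assumes "padic_abs y < padic_abs x" shows "padic_abs (x - y) = padic_abs x"
  using padic_abs_diff_eq_right[OF assms] by (simp add: padic_abs_minus_commute)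

lemma padic_abs_diff_eq_max:
  assumes "padic_abs x \<noteq> padic_abs y" shows "padic_abs (x - y) = max (padic_abs x) (padic_abs y)"
  using assms padic_abs_diff_eq_left[of y x] padic_abs_diff_eq_right[of x y] by linarith

lemma padic_abs_eq_if_close:
  assumes "padic_abs (x - y) < padic_abs y" shows "padic_abs x = padic_abs y"
  using padic_abs_add_eq[OF assms] by simp

lemma padic_abs_prime: "padic_abs (of_nat CARD('p) :: 'p::prime_card padic) = 1 / real CARD('p)"
proof -
  have p: "prime CARD('p)" by (rule prime_card)
  have "padic_abs (of_nat CARD('p) :: 'p padic) = rat_padic_abs CARD('p) (of_int (int CARD('p)) / of_int 1)"
    using padic_abs_of_rat[of "of_nat CARD('p)", where 'p='p] by (simp add: padic_of_rat_of_nat)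
  also have "\<dots> = 1 / real CARD('p)"
    using p by (subst rat_padic_abs_frac[OF p])
      (auto simp: multiplicity_self prime_gt_0_nat power_int_minus divide_inverse not_prime_unit)
  finally show ?thesis .
qed

lemma prime_card_gt_1: "1 < real CARD('p::prime_card)"
  using prime_gt_1_nat[OF prime_card[where 'a='p]] by simp

lemma prime_card_gt_0: "0 < real CARD('p::prime_card)"
  using prime_card_gt_1[where 'p='p] by simp

lemma prime_padic_nonzero: "(of_nat CARD('p) :: 'p::prime_card padic) \<noteq> 0"
  using padic_abs_prime[where 'p='p] prime_card_gt_0[where 'p='p] padic_abs_0 by (metis less_irrefl zero_less_divide_1_iff)

text \<open>A rational closer to x than the absolute value of x has the same absolute value as x, so
  completion adds no new values.\<close>

lemma padic_abs_value:
  assumes "x \<noteq> (0 :: 'p::prime_card padic)"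
  obtains k :: int where "padic_abs x = real CARD('p) powi k"
proof -
  obtain r where r: "padic_abs (x - padic_of_rat r) < padic_abs x"
    using padic_approx_rat[of "padic_abs x" x] assms by (metis less_eq_real_def padic_abs_eq_0_iff padic_abs_nonneg)
  have eq: "padic_abs x = rat_padic_abs CARD('p) r"
    using padic_abs_eq_if_close[of "padic_of_rat r" x] r
    by (simp add: padic_abs_minus_commute padic_abs_of_rat)
  then have "r \<noteq> 0" using assms by auto
  then show ?thesis using that eq by (auto simp: rat_padic_abs_def)
qed

text \<open>By density x may be replaced by a p-integral rational a/b in lowest terms. Then b is
  prime to p, and k is a times the inverse of b modulo p.\<close>

lemma padic_residue:
  assumes "padic_abs (x :: 'p::prime_card padic) \<le> 1"
  obtains k where "k < CARD('p)" "padic_abs (x - of_nat k) \<le> 1 / real CARD('p)"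
proof -
  let ?p = "CARD('p)"
  have p: "prime ?p" by (rule prime_card)
  have p0: "real ?p > 1" by (rule prime_card_gt_1)
  obtain r where r: "padic_abs (x - padic_of_rat r) < 1 / real ?p"
    using padic_approx_rat[of "1 / real ?p" x] p0 by auto
  have r1: "rat_padic_abs ?p r \<le> 1"
  proof -
    have "padic_abs (x - (x - padic_of_rat r)) \<le> max (padic_abs x) (padic_abs (x - padic_of_rat r))"
      by (rule padic_abs_diff_le)
    also have "\<dots> \<le> 1" using assms r p0 by (auto intro: order.trans[OF less_imp_le])
    finally show ?thesis by (simp add: padic_abs_of_rat)
  qed
  obtain a b where ab: "quotient_of r = (a, b)" by fastforce
  have b: "b > 0" using ab quotient_of_denom_pos by blast
  have req: "r = of_int a / of_int b" using ab quotient_of_div by blast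
  have cop: "coprime a b" using ab quotient_of_coprime by blast
  have ndvd: "\<not> int ?p dvd b"
  proof
    assume d: "int ?p dvd b"
    then have nd: "\<not> int ?p dvd a" using cop p
      by (meson coprime_common_divisor not_prime_unit prime_nat_int_transfer)
    then have a0: "a \<noteq> 0" by auto
    have "multiplicity (int ?p) a = 0" using nd by (simp add: not_dvd_imp_multiplicity_0)
    moreover have "multiplicity (int ?p) b > 0"
      using d b p by (simp add: prime_multiplicity_gt_zero_iff)
    ultimately have "rat_padic_abs ?p r = real ?p ^ multiplicity (int ?p) b" and "multiplicity (int ?p) b > 0"
      using rat_padic_abs_frac[OF p a0, of b] b req by (auto simp: power_int_def)
    then have "rat_padic_abs ?p r > 1" using p0 by (simp add: one_less_power)
    then show False using r1 by simp
  qed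
  have "coprime b (int ?p)" using ndvd p by (metis coprime_commute prime_imp_coprime prime_nat_int_transfer)
  then obtain c where c: "[b * c = 1] (mod int ?p)" using cong_solve_coprime_int by blast
  define k where "k = nat ((a * c) mod int ?p)"
  have kint: "int k = (a * c) mod int ?p" unfolding k_def using p0 by simp
  have k: "k < ?p" using kint p0 by (metis of_nat_less_iff pos_mod_bound of_nat_0_less_iff prime_gt_0_nat p)
  have "[b * int k = a] (mod int ?p)"
  proof -
    have "[int k = a * c] (mod int ?p)" by (simp add: kint cong_def)
    then have "[b * int k = b * (a * c)] (mod int ?p)" by (rule cong_scalar_left)
    also have "b * (a * c) = a * (b * c)" by simp
    also have "[a * (b * c) = a * 1] (mod int ?p)" using c by (rule cong_scalar_left)
    finally show ?thesis by simp
  qed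
  then have dv: "int ?p dvd a - b * int k" by (metis cong_iff_dvd_diff cong_sym)
  have "rat_padic_abs ?p (r - of_nat k) \<le> 1 / real ?p"
  proof (cases "a - b * int k = 0")
    case True
    have "(of_int (a - b * int k) :: rat) = 0" unfolding True by simp
    then have "r - of_nat k = 0" using req b by (simp add: field_simps)
    then show ?thesis by simp
  next
    case False
    have e: "r - of_nat k = of_int (a - b * int k) / of_int b" using req b by (simp add: field_simps)
    have mb: "multiplicity (int ?p) b = 0" using ndvd by (simp add: not_dvd_imp_multiplicity_0)
    have m: "multiplicity (int ?p) (a - b * int k) \<ge> 1"
      using dv False p by (simp add: prime_multiplicity_gt_zero_iff Suc_le_eq)
    have "rat_padic_abs ?p (r - of_nat k) = real ?p powi (- int (multiplicity (int ?p) (a - b * int k)))"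
      unfolding e using rat_padic_abs_frac[OF p False, of b] b mb by simp
    also have "\<dots> \<le> real ?p powi (- 1)" using m p0 by (intro power_int_increasing) auto
    finally show ?thesis by (simp add: power_int_minus divide_inverse)
  qed
  then have "padic_abs (padic_of_rat r - of_nat k :: 'p padic) \<le> 1 / real ?p"
    by (simp flip: padic_of_rat_of_nat padic_of_rat_diff add: padic_abs_of_rat)
  then have "padic_abs ((x - padic_of_rat r) + (padic_of_rat r - of_nat k)) \<le> 1 / real ?p"
    using padic_abs_add_le[of "x - padic_of_rat r" "padic_of_rat r - of_nat k"] r by linarith
  then show ?thesis using that k by simp
qed

lemma padic_abs_of_nat_le: "padic_abs (of_nat k :: 'p::prime_card padic) \<le> 1"
proof (induction k)
  case (Suc k)
  then show ?case using padic_abs_add_le[of 1 "of_nat k :: 'p padic"] by (simp add: max_absorb1)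
qed simp

lemma padic_abs_of_nat_diff_eq_1:
  assumes "k < CARD('p)" "l < CARD('p)" "k \<noteq> l"
  shows "padic_abs (of_nat k - of_nat l :: 'p::prime_card padic) = 1"
proof -
  let ?p = "CARD('p)"
  have p: "prime ?p" by (rule prime_card)
  have "\<not> int ?p dvd int k - int l"
  proof
    assume d: "int ?p dvd int k - int l"
    have "\<bar>int k - int l\<bar> < int ?p" using assms by linarith
    moreover have "int ?p \<le> \<bar>int k - int l\<bar>" using dvd_imp_le_int[OF _ d] assms by simp
    ultimately show False by simp
  qed
  then have "multiplicity (int ?p) (int k - int l) = 0" by (simp add: not_dvd_imp_multiplicity_0)
  then have "rat_padic_abs ?p (of_int (int k - int l) / of_int 1) = 1"
    using assms by (subst rat_padic_abs_frac[OF p]) auto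
  then show ?thesis
    by (simp flip: padic_of_rat_of_nat padic_of_rat_diff add: padic_abs_of_rat)
qed

subsection \<open>Haar measure of balls and spheres\<close>

definition pball :: "'p::prime_card padic \<Rightarrow> int \<Rightarrow> 'p padic set" where
  "pball a n = {x. padic_abs (x - a) \<le> real CARD('p) powi n}"

lemma pball_eq_cball: "pball a n = cball (a :: 'p::prime_card padic) (real CARD('p) powi n)"
  by (auto simp: pball_def dist_padic_def padic_abs_minus_commute)

lemma pball_borel [measurable]: "pball a n \<in> sets borel"
  by (simp add: pball_eq_cball)

lemma pball_translate: "pball a n = (+) a ` pball 0 n"
  by (force simp: pball_def image_iff)

lemma padic_abs_prime_power_int:
  "padic_abs (of_nat CARD('p) powi n :: 'p::prime_card padic) = real CARD('p) powi (- n)"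
  by (simp add: padic_abs_power_int padic_abs_prime power_int_minus power_int_one_over divide_inverse power_int_inverse)

text \<open>Multiplication by p^(n+1) carries the larger ball to the unit ball and the smaller ones
  to the residue classes of \<open>padic_residue\<close>; hence the centres k p^(-n-1).\<close>

lemma pball_split:
  "pball (0 :: 'p::prime_card padic) (n + 1) =
    (\<Union>k<CARD('p). pball (of_nat k * of_nat CARD('p) powi (- (n + 1))) n)" (is "?L = ?R")
proof
  let ?P = "real CARD('p)" and ?w = "of_nat CARD('p) :: 'p padic"
  have P: "?P > 1" by (rule prime_card_gt_1)
  show "?L \<subseteq> ?R"
  proof
    fix x assume "x \<in> ?L"
    then have x: "padic_abs x \<le> ?P powi (n + 1)" by (simp add: pball_def)
    define y where "y = x * ?w powi (n + 1)"
    have "padic_abs y \<le> ?P powi (n + 1) * ?P powi (- (n + 1))"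
      unfolding y_def padic_abs_mult padic_abs_prime_power_int using x by (intro mult_right_mono) auto
    also have "\<dots> = 1" using P by (simp flip: power_int_add)
    finally obtain k where k: "k < CARD('p)" "padic_abs (y - of_nat k) \<le> 1 / ?P"
      using padic_residue by blast
    have "x - of_nat k * ?w powi (- (n + 1)) = (y - of_nat k) * ?w powi (- (n + 1))"
      unfolding y_def using prime_padic_nonzero[where 'p='p]
      by (simp add: algebra_simps flip: power_int_add)
    then have "padic_abs (x - of_nat k * ?w powi (- (n + 1))) = padic_abs (y - of_nat k) * ?P powi (n + 1)"
      by (simp add: padic_abs_mult padic_abs_prime_power_int add.commute)
    also have "\<dots> \<le> 1 / ?P * ?P powi (n + 1)" using k by (intro mult_right_mono) auto
    also have "\<dots> = ?P powi n" using P by (simp add: power_int_add)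
    finally show "x \<in> ?R" using k by (auto simp: pball_def)
  qed
  show "?R \<subseteq> ?L"
  proof
    fix x assume "x \<in> ?R"
    then obtain k where k: "padic_abs (x - of_nat k * ?w powi (- (n + 1))) \<le> ?P powi n"
      by (auto simp: pball_def)
    have "?P powi n \<le> ?P powi (n + 1)" using P by (intro power_int_increasing) auto
    moreover have "padic_abs (of_nat k * ?w powi (- (n + 1))) \<le> 1 * ?P powi (n + 1)"
      unfolding padic_abs_mult padic_abs_prime_power_int
      by (intro mult_mono padic_abs_of_nat_le) (auto simp: add.commute)
    ultimately have "padic_abs ((x - of_nat k * ?w powi (- (n + 1))) + of_nat k * ?w powi (- (n + 1))) \<le> ?P powi (n + 1)"
      using k by (intro order.trans[OF padic_abs_add_le]) auto
    then show "x \<in> ?L" by (simp add: pball_def)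
  qed
qed

lemma disjoint_pball_split:
  "disjoint_family_on (\<lambda>k. pball (of_nat k * of_nat CARD('p) powi (- (n + 1)) :: 'p::prime_card padic) n) {..<CARD('p)}"
  unfolding disjoint_family_on_def
proof (intro ballI impI, rule ccontr)
  let ?P = "real CARD('p)" and ?w = "of_nat CARD('p) :: 'p padic"
  have P: "?P > 1" by (rule prime_card_gt_1)
  fix k l assume kl: "k \<in> {..<CARD('p)}" "l \<in> {..<CARD('p)}" "k \<noteq> l"
    and "pball (of_nat k * ?w powi (- (n + 1))) n \<inter> pball (of_nat l * ?w powi (- (n + 1))) n \<noteq> {}"
  then obtain x where x: "padic_abs (x - of_nat k * ?w powi (- (n + 1))) \<le> ?P powi n"
     "padic_abs (x - of_nat l * ?w powi (- (n + 1))) \<le> ?P powi n"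
    by (auto simp: pball_def)
  have "padic_abs ((x - of_nat l * ?w powi (- (n + 1))) - (x - of_nat k * ?w powi (- (n + 1)))) \<le> ?P powi n"
    using x by (intro order.trans[OF padic_abs_diff_le]) auto
  also have "(x - of_nat l * ?w powi (- (n + 1))) - (x - of_nat k * ?w powi (- (n + 1)))
      = (of_nat k - of_nat l) * ?w powi (- (n + 1))" by (simp add: algebra_simps)
  also have "padic_abs \<dots> = ?P powi (n + 1)"
    unfolding padic_abs_mult padic_abs_prime_power_int using kl
    by (subst padic_abs_of_nat_diff_eq_1) (auto simp: add.commute)
  finally show False using P by (simp add: power_int_add)
qed

text \<open>By translation invariance the p balls of \<open>pball_split\<close> have equal measure,
  so each step in the radius is a factor p, and the normalisation on Z_p propagates in both
  directions.\<close>

lemma emeasure_pball: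
  assumes M: "is_padic_haar_measure (M :: 'p::prime_card padic measure)"
  shows "emeasure M (pball a n) = ennreal (real CARD('p) powi n)"
proof -
  let ?P = "real CARD('p)"
  have P: "?P > 1" by (rule prime_card_gt_1)
  have sM: "sets M = sets borel" using M by (simp add: is_padic_haar_measure_def)
  have tr: "emeasure M (pball a n) = emeasure M (pball 0 n)" for a n
    using M pball_borel[of 0 n] unfolding pball_translate[of a n] is_padic_haar_measure_def by blast
  have step: "emeasure M (pball 0 (n + 1)) = of_nat CARD('p) * emeasure M (pball 0 n)" for n
  proof -
    have "emeasure M (pball 0 (n + 1)) =
        (\<Sum>k<CARD('p). emeasure M (pball (of_nat k * of_nat CARD('p) powi (- (n + 1))) n))"
      unfolding pball_split
      by (rule sum_emeasure[symmetric]) (use disjoint_pball_split sM pball_borel in auto)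
    then show ?thesis by (simp add: tr[of "of_nat k * b" for k b])
  qed
  have "emeasure M (pball 0 n) = ennreal (?P powi n)"
  proof (induction n rule: int_induct[where k = 0])
    case base
    have "pball 0 0 = (padic_ints :: 'p padic set)" by (auto simp: pball_def padic_ints_def)
    then show ?case using M by (simp add: is_padic_haar_measure_def)
  next
    case (step1 i)
    show ?case unfolding step step1.IH using P
      by (simp add: power_int_add ennreal_of_nat_eq_real_of_nat mult.commute flip: ennreal_mult)
  next
    case (step2 i)
    have eq: "ennreal (?P powi i) = ennreal ?P * emeasure M (pball 0 (i - 1))"
      using step[of "i - 1"] step2.IH by (simp add: ennreal_of_nat_eq_real_of_nat)
    show ?case
    \<comment> \<open>Dividing by p in the extended reals requires a finite value; an infinite one
      would make the next larger ball infinite as well.\<close>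
    proof (cases "emeasure M (pball 0 (i - 1))")
      case (real r)
      then have "ennreal (?P powi i) = ennreal (?P * r)" using eq P by (simp add: ennreal_mult)
      then have "?P powi i = ?P * r" using real P by (subst (asm) ennreal_inj) auto
      then show ?thesis using real P by (simp add: power_int_diff)
    next
      case top
      then show ?thesis using eq P by (simp add: ennreal_mult_top)
    qed
  qed
  then show ?thesis by (subst tr)
qed

lemma measure_pball:
  assumes "is_padic_haar_measure (M :: 'p::prime_card padic measure)"
  shows "measure M (pball a n) = real CARD('p) powi n"
  by (simp add: measure_def emeasure_pball[OF assms])

section \<open>Levels of p-adic numbers and integrals of functions of the level\<close>

definition pmax :: "'p::prime_card padic \<Rightarrow> real" where
  "pmax x = max 1 (padic_abs x)"

text \<open>The base-p logarithm of \<open>pmax x\<close>, by \<open>pmax_eq\<close>. On the tree it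
  is the number of edges that the ray to x shares with the ray to infinity.\<close>

definition plev :: "'p::prime_card padic \<Rightarrow> nat" where
  "plev x = (LEAST n. padic_abs x \<le> real CARD('p) ^ n)"

lemma pmax_pos: "0 < pmax x"
  by (simp add: pmax_def)

lemma plev_le_iff: "plev (x :: 'p::prime_card padic) \<le> n \<longleftrightarrow> padic_abs x \<le> real CARD('p) ^ n"
proof
  have P: "real CARD('p) > 1" by (rule prime_card_gt_1)
  have "\<exists>n. padic_abs x \<le> real CARD('p) ^ n"
    using real_arch_pow[OF P, of "padic_abs x"] less_imp_le by blast
  then have "padic_abs x \<le> real CARD('p) ^ plev x" unfolding plev_def by (rule LeastI_ex)
  also assume "plev x \<le> n"
  then have "real CARD('p) ^ plev x \<le> real CARD('p) ^ n" using P by (intro power_increasing) auto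
  finally show "padic_abs x \<le> real CARD('p) ^ n" .
qed (auto simp: plev_def intro: Least_le)

lemma padic_abs_eq_power:
  assumes "1 \<le> padic_abs (x :: 'p::prime_card padic)"
  obtains n where "padic_abs x = real CARD('p) ^ n"
proof -
  have P: "real CARD('p) > 1" by (rule prime_card_gt_1)
  obtain k where k: "padic_abs x = real CARD('p) powi k"
    using padic_abs_value[of x] assms by (metis padic_abs_0 not_one_le_zero)
  have "0 \<le> k"
  proof (rule ccontr)
    assume "\<not> 0 \<le> k"
    then have "real CARD('p) powi k < real CARD('p) powi 0" using P by (intro power_int_strict_increasing) auto
    then show False using assms k by simp
  qed
  then show ?thesis using k that[of "nat k"] by (simp add: power_int_def)
qed

lemma pmax_eq: "pmax (x :: 'p::prime_card padic) = real CARD('p) ^ plev x"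
proof (cases "padic_abs x \<le> 1")
  case True
  then have "plev x = 0" using plev_le_iff[of x 0] by simp
  then show ?thesis using True by (simp add: pmax_def max_absorb1)
next
  case False
  have P: "real CARD('p) > 1" by (rule prime_card_gt_1)
  obtain n where n: "padic_abs x = real CARD('p) ^ n" using padic_abs_eq_power[of x] False by auto
  have "plev x \<le> m \<longleftrightarrow> n \<le> m" for m using P by (simp add: plev_le_iff n)
  then have "plev x = n" by (meson antisym order_refl)
  then show ?thesis using n False by (simp add: pmax_def max_absorb2)
qed

lemma plev_eq_iff: "plev x = m \<longleftrightarrow> pmax (x :: 'p::prime_card padic) = real CARD('p) ^ m"
  using prime_card_gt_1[where 'p='p] by (simp add: pmax_eq)

text \<open>For P = p this is the Haar measure of the set of x with \<open>plev x = m\<close>: all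
  of Z_p for m = 0, the sphere of radius p^m otherwise.\<close>

definition pvol :: "real \<Rightarrow> nat \<Rightarrow> real" where
  "pvol P m = (if m = 0 then 1 else P ^ m - P ^ (m - 1))"

lemma plev_le_eq_pball: "{x. plev x \<le> m} = pball (0 :: 'p::prime_card padic) (int m)"
  by (auto simp: plev_le_iff pball_def)

lemma plev_measurable [measurable]: "plev \<in> measurable borel (count_space UNIV)"
proof (subst measurable_count_space_eq2_countable, safe)
  show "plev -` {m} \<inter> space borel \<in> sets (borel :: 'p::prime_card padic measure)" for m
  proof -
    have "plev -` {m} = {x :: 'p padic. plev x \<le> m} - (if m = 0 then {} else {x. plev x \<le> m - 1})"
      by auto
    then show ?thesis by (auto simp: plev_le_eq_pball)
  qed
qed auto

lemma measure_plev:
  assumes M: "is_padic_haar_measure (M :: 'p::prime_card padic measure)"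
  shows "measure M {x. plev x = m} = pvol (real CARD('p)) m" "emeasure M {x. plev x = m} < \<infinity>"
proof -
  have sM: "sets M = sets borel" using M by (simp add: is_padic_haar_measure_def)
  have fin: "emeasure M (pball 0 n) < \<infinity>" for n using emeasure_pball[OF M, of 0 n] by simp
  have "{x. plev x = m} \<subseteq> pball (0 :: 'p padic) (int m)" by (auto simp flip: plev_le_eq_pball)
  then show "emeasure M {x. plev x = m} < \<infinity>"
    by (rule le_less_trans[OF emeasure_mono fin]) (simp add: sM pball_borel)
  show "measure M {x. plev x = m} = pvol (real CARD('p)) m"
  proof (cases m)
    case 0
    then have "{x. plev x = m} = pball (0 :: 'p padic) 0" using plev_le_eq_pball[of 0] by simp
    then show ?thesis using 0 by (simp add: pvol_def measure_pball[OF M])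
  next
    case (Suc l)
    have "{x :: 'p padic. plev x = m} = {x. plev x \<le> m} - {x. plev x \<le> l}"
      using Suc by auto
    then have "{x. plev x = m} = pball (0 :: 'p padic) (int m) - pball 0 (int l)"
      by (simp only: plev_le_eq_pball)
    moreover have sub: "pball (0 :: 'p padic) (int l) \<subseteq> pball 0 (int m)"
      using Suc unfolding plev_le_eq_pball[symmetric] by auto
    moreover have "measure M (pball (0 :: 'p padic) (int m) - pball 0 (int l)) =
        measure M (pball (0 :: 'p padic) (int m)) - measure M (pball (0 :: 'p padic) (int l))"
      using fin[of "int m"] sM sub by (intro measure_Diff) auto
    ultimately show ?thesis using Suc prime_card_gt_0[where 'p='p]
      by (simp add: pvol_def measure_pball[OF M] power_int_add)
  qed
qed

text \<open>The integrand is a series over the level sets with at most one nonzero term at each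
  point; absolute summability licenses integration term by term.\<close>

lemma has_integral_plev:
  assumes M: "is_padic_haar_measure (M :: 'p::prime_card padic measure)"
    and c: "summable (\<lambda>m. \<bar>c m\<bar> * pvol (real CARD('p)) m)"
    and sum: "(\<lambda>m. c m * pvol (real CARD('p)) m) sums S"
  shows "has_bochner_integral M (\<lambda>x. c (plev x)) S"
proof -
  have sM [measurable_cong]: "sets M = sets borel" using M by (simp add: is_padic_haar_measure_def)
  have spM: "space M = UNIV" using sets_eq_imp_space_eq[OF sM] by simp
  let ?f = "\<lambda>m x. c m * indicator {x :: 'p padic. plev x = m} x :: real"
  have S [measurable]: "{x. plev x = m} \<in> sets M" for m
    using measurable_sets[OF plev_measurable, of "{m}"] sM by (simp add: vimage_def)
  have sums: "(\<lambda>m. ?f m x) sums c (plev x)" for x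
  proof -
    have "?f m x = (if m = plev x then c m else 0)" for m by auto
    then show ?thesis using sums_single[of "plev x" c] by simp
  qed
  have int: "integrable M (?f m)" for m
    by (intro integrable_mult_right integrable_real_indicator S measure_plev(2)[OF M])
  have nrm: "(\<lambda>m. norm (?f m x)) sums \<bar>c (plev x)\<bar>" for x
  proof -
    have "norm (?f m x) = (if m = plev x then \<bar>c m\<bar> else 0)" for m by auto
    then show ?thesis using sums_single[of "plev x" "\<lambda>m. \<bar>c m\<bar>"] by simp
  qed
  have "(\<integral>x. norm (?f m x) \<partial>M) = \<bar>c m\<bar> * pvol (real CARD('p)) m" for m
    using measure_plev(1)[OF M] spM by (simp add: abs_mult)
  then have sint: "summable (\<lambda>m. \<integral>x. norm (?f m x) \<partial>M)" using c by simp
  have eq: "(\<lambda>x. \<Sum>m. ?f m x) = (\<lambda>x. c (plev x))" using sums_unique[OF sums] by simp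
  have ae: "AE x in M. summable (\<lambda>m. norm (?f m x))" using nrm by (auto intro!: AE_I2 sums_summable)
  have int': "integrable M (\<lambda>x. c (plev x))"
    using integrable_suminf[OF int ae sint] unfolding eq .
  have "integral\<^sup>L M (?f m) = c m * pvol (real CARD('p)) m" for m
    using measure_plev(1)[OF M] spM by simp
  then have "(\<lambda>m. c m * pvol (real CARD('p)) m) sums (\<integral>x. c (plev x) \<partial>M)"
    using sums_integral[OF int ae sint] unfolding eq by presburger
  then show ?thesis using int' sums_unique2[OF sum] by (simp add: has_bochner_integral_iff)
qed

subsection \<open>Lattices\<close>

text \<open>The area form. For primitive e, the absolute value of \<open>det2 e w\<close> is the
  distance of w from the line of e.\<close>

definition det2 :: "'p::prime_card padic^2 \<Rightarrow> 'p padic^2 \<Rightarrow> 'p padic" where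
  "det2 v w = v $ 1 * w $ 2 - v $ 2 * w $ 1"

definition vmax :: "'p::prime_card padic^2 \<Rightarrow> real" where
  "vmax v = max (padic_abs (v $ 1)) (padic_abs (v $ 2))"

text \<open>For a primitive vector \<open>e\<close> this is the lattice generated by \<open>e\<close> and \<open>p\<^sup>n \<int>\<^sub>p\<^sup>2\<close>.\<close>

definition lat :: "'p::prime_card padic^2 \<Rightarrow> nat \<Rightarrow> ('p padic^2) set" where
  "lat e n = {w. vmax w \<le> 1 \<and> padic_abs (det2 e w) \<le> 1 / real CARD('p) ^ n}"

lemma padic_ints_0: "0 \<in> padic_ints" and padic_ints_1: "1 \<in> padic_ints"
  by (auto simp: padic_ints_def)

lemma padic_ints_add: "x \<in> padic_ints \<Longrightarrow> y \<in> padic_ints \<Longrightarrow> x + y \<in> padic_ints"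
  unfolding padic_ints_def using padic_abs_add_le[of x y] by auto

lemma padic_ints_mult: "x \<in> padic_ints \<Longrightarrow> y \<in> padic_ints \<Longrightarrow> x * y \<in> padic_ints"
  by (auto simp: padic_ints_def padic_abs_mult mult_le_one)

lemma padic_abs_le_vmax: "padic_abs (v $ i) \<le> vmax v"
  using exhaust_2[of i] by (auto simp: vmax_def)

lemma vmax_attained: obtains i where "vmax v = padic_abs (v $ i)"
  unfolding vmax_def by (metis max_def)

lemma vmax_nonneg: "0 \<le> vmax v"
  by (simp add: vmax_def le_max_iff_disj)

lemma vmax_le_1_iff: "vmax v \<le> 1 \<longleftrightarrow> (\<forall>i. v $ i \<in> padic_ints)"
  by (auto simp: vmax_def forall_2 padic_ints_def)

lemma vmax_scale: "vmax (c *s v) = padic_abs c * vmax v"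
  by (simp add: vmax_def padic_abs_mult max_mult_distrib_left)

lemma vmax_axis: "vmax (axis i 1) = 1"
  using exhaust_2[of i] by (auto simp: vmax_def axis_def)

lemma det2_scale: "det2 e (c *s w) = c * det2 e w"
  by (simp add: det2_def algebra_simps)

lemma det2_commute: "det2 v w = - det2 w v"
  by (simp add: det2_def)

lemma det2_self: "det2 v v = 0"
  by (simp add: det2_def)

lemma padic_abs_det2_commute: "padic_abs (det2 v w) = padic_abs (det2 w v)"
  using det2_commute[of v w] by simp

lemma padic_abs_det2_le: "padic_abs (det2 v w) \<le> vmax v * vmax w"
proof -
  have "padic_abs (v $ i * w $ j) \<le> vmax v * vmax w" for i j
    unfolding padic_abs_mult by (intro mult_mono padic_abs_le_vmax vmax_nonneg padic_abs_nonneg)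
  then show ?thesis unfolding det2_def by (intro order.trans[OF padic_abs_diff_le]) simp
qed

text \<open>Three vectors in the plane are dependent: this is the expansion of the 3 by 3
  determinant with columns e, e', w in which row i is repeated.\<close>

lemma det2_three_vectors: "e $ i * det2 e' w = - (e' $ i * det2 w e + w $ i * det2 e e')"
  using exhaust_2[of i] by (auto simp: det2_def algebra_simps)

text \<open>In the relation between three vectors, a coordinate i in which e is a unit can be
  cancelled, and the two remaining terms are bounded by r. For primitive vectors this is the
  ultrametric inequality of the chordal distance.\<close>

lemma padic_abs_det2_ultrametric:
  assumes e: "vmax e = 1" and e': "vmax e' \<le> 1" and w: "vmax w \<le> 1"
    and "padic_abs (det2 e e') \<le> r" and "padic_abs (det2 e w) \<le> r"
  shows "padic_abs (det2 e' w) \<le> r"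
proof -
  obtain i where i: "padic_abs (e $ i) = 1" using vmax_attained[of e] e by auto
  have m: "padic_abs (a * b) \<le> r" if "padic_abs a \<le> 1" "padic_abs b \<le> r" for a b :: "'a padic"
    unfolding padic_abs_mult using mult_mono[OF that] that(2) padic_abs_nonneg[of b] by simp
  have "padic_abs (det2 e' w) = padic_abs (e $ i * det2 e' w)" by (simp add: padic_abs_mult i)
  also have "\<dots> = padic_abs (e' $ i * det2 w e + w $ i * det2 e e')"
    by (subst det2_three_vectors[of e i e' w]) (rule padic_abs_minus)
  also have "\<dots> \<le> r"
    using assms order.trans[OF padic_abs_le_vmax e'] order.trans[OF padic_abs_le_vmax w]
    by (intro order.trans[OF padic_abs_add_le] max.boundedI m) (auto simp: padic_abs_det2_commute)
  finally show ?thesis .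
qed

lemma inverse_power_mono_card:
  "1 / real CARD('p::prime_card) ^ m \<le> 1 / real CARD('p) ^ n \<longleftrightarrow> n \<le> m"
  using prime_card_gt_1[where 'p='p] by (simp add: field_simps)

lemma unimodular_axis:
  assumes "vmax e = 1" obtains i where "padic_abs (det2 e (axis i 1)) = 1"
proof -
  have "det2 e (axis 2 1) = e $ 1" "det2 e (axis 1 1) = - (e $ 2)"
    by (simp_all add: det2_def axis_def)
  moreover obtain j where "padic_abs (e $ j) = 1" using vmax_attained[of e] assms by auto
  ultimately show ?thesis using that exhaust_2[of j] by (metis padic_abs_minus)
qed

lemma prime_power_axis_mem_lat:
  assumes "vmax e \<le> 1"
  shows "of_nat CARD('p) ^ n *s axis i 1 \<in> lat (e :: 'p::prime_card padic^2) n"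
proof -
  let ?P = "real CARD('p)"
  have P: "?P > 1" by (rule prime_card_gt_1)
  have "padic_abs (det2 e (axis i 1)) \<le> 1"
    using padic_abs_det2_le[of e "axis i 1"] assms by (simp add: vmax_axis)
  then show ?thesis using P
    by (auto simp: lat_def vmax_scale vmax_axis det2_scale padic_abs_mult padic_abs_power padic_abs_prime
        power_one_over divide_simps)
qed

lemma self_mem_lat: "vmax e = 1 \<Longrightarrow> e \<in> lat e n"
  by (simp add: lat_def det2_self)

text \<open>Two test vectors of \<open>lat e' m\<close> suffice for necessity: e' itself gives the
  determinant condition, and p^m times a coordinate vector of unit determinant against e gives n
  \<open>\<le>\<close> m. Sufficiency is the ultrametric inequality.\<close>

lemma lat_subset_iff:
  assumes e: "vmax e = 1" and e': "vmax e' = 1"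
  shows "lat e' m \<subseteq> lat (e :: 'p::prime_card padic^2) n \<longleftrightarrow> n \<le> m \<and> padic_abs (det2 e e') \<le> 1 / real CARD('p) ^ n"
proof
  assume sub: "lat e' m \<subseteq> lat e n"
  have "e' \<in> lat e n" using sub self_mem_lat[OF e'] by blast
  moreover obtain i where i: "padic_abs (det2 e (axis i 1)) = 1" using unimodular_axis[OF e] by blast
  have "of_nat CARD('p) ^ m *s axis i 1 \<in> lat e n"
    using sub prime_power_axis_mem_lat[of e' m i] e' by auto
  then have "1 / real CARD('p) ^ m \<le> 1 / real CARD('p) ^ n"
    by (simp add: lat_def det2_scale padic_abs_mult padic_abs_power padic_abs_prime i power_one_over)
  ultimately show "n \<le> m \<and> padic_abs (det2 e e') \<le> 1 / real CARD('p) ^ n"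
    unfolding inverse_power_mono_card by (simp add: lat_def)
next
  assume *: "n \<le> m \<and> padic_abs (det2 e e') \<le> 1 / real CARD('p) ^ n"
  show "lat e' m \<subseteq> lat e n"
  proof
    fix w assume w: "w \<in> lat e' m"
    then have "padic_abs (det2 e' w) \<le> 1 / real CARD('p) ^ n"
      using * inverse_power_mono_card[of m n, where 'p='p] by (auto simp: lat_def intro: order.trans)
    then show "w \<in> lat e n"
      using padic_abs_det2_ultrametric[of e' e w "1 / real CARD('p) ^ n"] w e e' *
      by (auto simp: lat_def padic_abs_det2_commute)
  qed
qed

lemma lat_eq_iff:
  assumes e: "vmax e = 1" and e': "vmax e' = 1"
  shows "lat e' m = lat (e :: 'p::prime_card padic^2) n \<longleftrightarrow> n = m \<and> padic_abs (det2 e e') \<le> 1 / real CARD('p) ^ n"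
  unfolding set_eq_subset lat_subset_iff[OF assms] lat_subset_iff[OF assms(2,1)]
  by (auto simp: padic_abs_det2_commute)

lemma mem_scaled_iff:
  assumes "c \<noteq> 0" shows "w \<in> (*s) c ` A \<longleftrightarrow> inverse c *s w \<in> (A :: ('p::prime_card padic^2) set)"
proof
  assume "inverse c *s w \<in> A"
  moreover have "w = c *s (inverse c *s w)" using assms by (simp add: vector_smult_assoc)
  ultimately show "w \<in> (*s) c ` A" by blast
qed (use assms in \<open>auto simp: vector_smult_assoc\<close>)

lemma mem_scaled_lat_iff:
  assumes "c \<noteq> (0 :: 'p::prime_card padic)"
  shows "w \<in> (*s) c ` lat e n \<longleftrightarrow>
    vmax w \<le> padic_abs c \<and> padic_abs (det2 e w) \<le> padic_abs c / real CARD('p) ^ n"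
proof -
  have "padic_abs c > 0" using assms by (simp add: less_le)
  then have "inverse (padic_abs c) * a \<le> b \<longleftrightarrow> a \<le> padic_abs c * b" for a b
    by (simp add: field_simps)
  then show ?thesis
    unfolding mem_scaled_iff[OF assms] lat_def mem_Collect_eq vmax_scale det2_scale padic_abs_mult padic_abs_inverse
    by simp
qed

lemma scaled_lat_cong:
  assumes "c \<noteq> 0" "padic_abs c = padic_abs d"
  shows "(*s) c ` lat e n = (*s) d ` lat e n"
proof -
  have "d \<noteq> 0" using assms by auto
  then show ?thesis using assms by (auto simp: mem_scaled_lat_iff set_eq_iff)
qed

lemma scaled_scaled: "(*s) c ` (*s) d ` A = (*s) (c * d :: 'p::prime_card padic) ` A"
  by (simp add: image_image vector_smult_assoc)

lemma scaled_subset_iff: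
  assumes "c \<noteq> (0 :: 'p::prime_card padic)" shows "(*s) c ` A \<subseteq> (*s) c ` B \<longleftrightarrow> A \<subseteq> B"
proof -
  have "inj ((*s) c)" using assms by (simp add: inj_on_def vector_mul_lcancel)
  then show ?thesis by (rule inj_image_subset_iff)
qed

lemma scaled_psubset_iff:
  assumes "c \<noteq> (0 :: 'p::prime_card padic)" shows "(*s) c ` A \<subset> (*s) c ` B \<longleftrightarrow> A \<subset> B"
  unfolding less_le_not_le scaled_subset_iff[OF assms] ..

lemma scaled_lat_subset_unit_cube:
  assumes "vmax e = 1" "c \<noteq> (0 :: 'p::prime_card padic)" "(*s) c ` lat e n \<subseteq> (*s) d ` lat e' m" "d \<noteq> 0"
  shows "padic_abs c \<le> padic_abs d"
proof -
  have "c *s e \<in> (*s) d ` lat e' m" using assms self_mem_lat[of e n] by blast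
  then show ?thesis using assms by (simp add: mem_scaled_lat_iff vmax_scale)
qed

text \<open>The largest \<open>vmax\<close> on \<open>lat e n\<close> is 1, attained at e. A
  homothety between two such lattices therefore has a factor of absolute value 1, which does not
  change the lattice.\<close>

lemma homothetic_lat:
  assumes "vmax e = 1" "vmax e' = 1" "c \<noteq> (0 :: 'p::prime_card padic)" "lat e' m = (*s) c ` lat e n"
  shows "lat e' m = lat e n"
proof -
  have "padic_abs c = 1"
    using scaled_lat_subset_unit_cube[of e c n 1 e' m] scaled_lat_subset_unit_cube[of e' 1 m c e n] assms
    by simp
  then show ?thesis using assms scaled_lat_cong[of c 1 e n] by simp
qed

lemma padic_abs_between:
  assumes "1 / real CARD('p) \<le> padic_abs c" "padic_abs c \<le> 1"
  shows "padic_abs c = 1 \<or> padic_abs (c :: 'p::prime_card padic) = 1 / real CARD('p)"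
proof -
  let ?P = "real CARD('p)"
  have P: "?P > 1" by (rule prime_card_gt_1)
  have "c \<noteq> 0" using assms P by (auto simp: divide_le_0_iff)
  then obtain k where k: "padic_abs c = ?P powi k" using padic_abs_value by blast
  have "k \<le> 0"
  proof (rule ccontr)
    assume "\<not> k \<le> 0"
    then have "?P powi 0 < ?P powi k" using P by (intro power_int_strict_increasing) auto
    then show False using assms k by simp
  qed
  moreover have "- 1 \<le> k"
  proof (rule ccontr)
    assume "\<not> - 1 \<le> k"
    then have "?P powi k < ?P powi (- 1)" using P by (intro power_int_strict_increasing) auto
    then show False using assms k by (simp add: power_int_minus divide_inverse)
  qed
  ultimately have "k = 0 \<or> k = - 1" by linarith
  then show ?thesis using k by (auto simp: power_int_minus divide_inverse)
qed

text \<open>p^(n+1) times any coordinate vector lies in p times \<open>lat e n\<close>. For a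
  coordinate vector of unit determinant against e', membership in \<open>lat e' m\<close> bounds
  m.\<close>

lemma le_Suc_if_prime_scaled_subset:
  assumes "vmax e = 1" and e': "vmax e' = 1"
    and sub: "(*s) (of_nat CARD('p)) ` lat e n \<subseteq> lat (e' :: 'p::prime_card padic^2) m"
  shows "m \<le> Suc n"
proof -
  let ?w = "of_nat CARD('p) :: 'p padic"
  have "?w ^ Suc n *s axis i 1 \<in> (*s) ?w ` lat e n" for i
    using prime_power_axis_mem_lat[of e n i] assms(1)
    by (intro image_eqI[of _ _ "?w ^ n *s axis i 1"]) (simp_all add: vector_smult_assoc)
  then have mem: "?w ^ Suc n *s axis i 1 \<in> lat e' m" for i using sub by blast
  obtain i where i: "padic_abs (det2 e' (axis i 1)) = 1" using unimodular_axis[OF e'] by blast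
  have "1 / real CARD('p) ^ Suc n \<le> 1 / real CARD('p) ^ m"
    using mem[of i] unfolding lat_def mem_Collect_eq det2_scale padic_abs_mult padic_abs_power padic_abs_prime i
    by (simp add: power_one_over)
  then show ?thesis unfolding inverse_power_mono_card .
qed

lemma neighbouring_lat_below:
  assumes e: "vmax e = 1" and e': "vmax e' = 1"
    and sub1: "(*s) (of_nat CARD('p)) ` lat e n \<subset> lat e' m" and sub2: "lat e' m \<subset> lat (e :: 'p::prime_card padic^2) n"
  shows "m = Suc n \<and> lat e' n = lat e n"
proof -
  have nm: "n \<le> m" and d: "padic_abs (det2 e e') \<le> 1 / real CARD('p) ^ n"
    using sub2 lat_subset_iff[OF e e', of m n] by auto
  have "n \<noteq> m" using sub2 d lat_eq_iff[OF e e', of m n] by auto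
  moreover have "m \<le> Suc n" using sub1 by (intro le_Suc_if_prime_scaled_subset[OF e e']) auto
  ultimately show ?thesis using nm d lat_eq_iff[OF e e'] by auto
qed

text \<open>Comparing the largest norms forces c to have absolute value 1 or 1/p. In the first case
  \<open>lat e' m\<close> lies one level below \<open>lat e n\<close>; in the second, division by p
  exchanges the roles of the two lattices.\<close>

lemma neighbouring_lat:
  assumes e: "vmax e = 1" and e': "vmax e' = 1" and c: "c \<noteq> (0 :: 'p::prime_card padic)"
    and sub1: "(*s) (of_nat CARD('p)) ` lat e n \<subset> (*s) c ` lat e' m" and sub2: "(*s) c ` lat e' m \<subset> lat e n"
  shows "m = Suc n \<and> lat e' n = lat e n \<or> n = Suc m \<and> lat e m = lat e' m"
proof -
  let ?P = "real CARD('p)" and ?w = "of_nat CARD('p) :: 'p padic"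
  have w: "?w \<noteq> 0" by (rule prime_padic_nonzero)
  have "padic_abs c \<le> 1"
    using scaled_lat_subset_unit_cube[of e' c m 1 e n] sub2 e' c by (simp add: psubset_eq)
  moreover have "1 / ?P \<le> padic_abs c"
    using scaled_lat_subset_unit_cube[of e ?w n c e' m] sub1 e c w
    by (simp add: psubset_eq padic_abs_prime)
  ultimately consider "padic_abs c = 1" | "padic_abs c = 1 / ?P" using padic_abs_between by blast
  then show ?thesis
  proof cases
    case 1
    then have eq: "(*s) c ` lat e' m = lat e' m" using scaled_lat_cong[of c 1 e' m] c by simp
    show ?thesis using neighbouring_lat_below[OF e e' sub1[unfolded eq] sub2[unfolded eq]] by blast
  next
    case 2
    then have eq: "(*s) c ` lat e' m = (*s) ?w ` lat e' m"
      using scaled_lat_cong[of c ?w e' m] c by (simp add: padic_abs_prime)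
    have "lat e n \<subset> lat e' m" using sub1 unfolding eq scaled_psubset_iff[OF w] .
    then show ?thesis using neighbouring_lat_below[OF e' e sub2[unfolded eq]] by blast
  qed
qed

lemma lat_Suc_neighbouring:
  assumes e: "vmax e = 1" and e': "vmax e' = 1" and eq: "lat e' n = lat e n"
  shows "(*s) (of_nat CARD('p)) ` lat e n \<subset> lat e' (Suc n)" "lat e' (Suc n) \<subset> lat (e :: 'p::prime_card padic^2) n"
proof -
  let ?P = "real CARD('p)" and ?w = "of_nat CARD('p) :: 'p padic"
  have w: "?w \<noteq> 0" by (rule prime_padic_nonzero)
  have P: "?P > 1" by (rule prime_card_gt_1)
  have "(*s) ?w ` lat e' n \<subseteq> lat e' (Suc n)"
  proof
    fix v assume "v \<in> (*s) ?w ` lat e' n"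
    then have v: "vmax v \<le> 1 / ?P" "padic_abs (det2 e' v) \<le> 1 / ?P / ?P ^ n"
      by (simp_all add: mem_scaled_lat_iff[OF w] padic_abs_prime)
    note v(1)
    also have "1 / ?P \<le> 1" using P by simp
    finally show "v \<in> lat e' (Suc n)" using v(2) by (simp add: lat_def)
  qed
  moreover have "e' \<notin> (*s) ?w ` lat e' n"
    using P e' by (simp add: mem_scaled_lat_iff[OF w] padic_abs_prime)
  ultimately show "(*s) ?w ` lat e n \<subset> lat e' (Suc n)"
    using self_mem_lat[OF e', of "Suc n"] unfolding eq by blast
  have "lat e' (Suc n) \<subseteq> lat e' n" by (simp add: lat_subset_iff[OF e' e'] det2_self)
  moreover have "lat e' (Suc n) \<noteq> lat e' n" by (simp add: lat_eq_iff[OF e' e'])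
  ultimately show "lat e' (Suc n) \<subset> lat e n" unfolding eq by blast
qed

subsection \<open>Vertices of the tree as homothety classes of lattices\<close>

lemma matrix_vector_mult_2:
  "(g *v z) $ i = g $ i $ 1 * z $ 1 + g $ i $ 2 * (z $ 2 :: 'p::prime_card padic)" for g :: "'p::prime_card padic^2^2"
  by (simp add: matrix_vector_mult_def sum_2)

lemma mat_mult_vec: "mat c *v z = c *s (z :: 'p::prime_card padic^2)"
  by (simp add: vec_eq_iff forall_2 matrix_vector_mult_2 mat_def)

lemma mat_mult_mat: "mat c ** mat d = (mat (c * d) :: 'p::prime_card padic^2^2)"
  by (simp add: vec_eq_iff forall_2 matrix_matrix_mult_def sum_2 mat_def)

lemma mat_mult_component: "(mat c ** g) $ i $ j = c * (g $ i $ j :: 'p::prime_card padic)" for g :: "'p::prime_card padic^2^2"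
  using exhaust_2[of i] by (auto simp: matrix_matrix_mult_def sum_2 mat_def)

lemma integral_matrix_vector:
  "(\<And>i j. k $ i $ j \<in> padic_ints) \<Longrightarrow> (\<And>i. z $ i \<in> padic_ints) \<Longrightarrow> (k *v z) $ i \<in> padic_ints"
  for k :: "'p::prime_card padic^2^2"
  unfolding matrix_vector_mult_2 by (intro padic_ints_add padic_ints_mult)

lemma integral_matrix_matrix:
  "(\<And>i j. k $ i $ j \<in> padic_ints) \<Longrightarrow> (\<And>i j. l $ i $ j \<in> padic_ints) \<Longrightarrow> (k ** l) $ i $ j \<in> padic_ints"
  for k :: "'p::prime_card padic^2^2"
  unfolding matrix_matrix_mult_def sum_2 by (simp add: padic_ints_add padic_ints_mult)

lemma gl2_padic_ints_1: "mat 1 \<in> gl2_padic_ints"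
proof -
  have "(mat 1 :: 'a padic^2^2) $ i $ j \<in> padic_ints" for i j
    by (simp add: mat_def padic_ints_0 padic_ints_1)
  then show ?thesis unfolding gl2_padic_ints_def by (auto intro!: exI[of _ "mat 1"])
qed

lemma gl2_padic_ints_mult:
  assumes "k \<in> gl2_padic_ints" "l \<in> gl2_padic_ints" shows "k ** l \<in> gl2_padic_ints"
proof -
  obtain k' l' where k': "\<And>i j. k' $ i $ j \<in> padic_ints" "k ** k' = mat 1" "k' ** k = mat 1"
    and l': "\<And>i j. l' $ i $ j \<in> padic_ints" "l ** l' = mat 1" "l' ** l = mat 1"
    using assms unfolding gl2_padic_ints_def by blast
  have "(k ** l) ** (l' ** k') = k ** (l ** l') ** k'" "(l' ** k') ** (k ** l) = l' ** (k' ** k) ** l"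
    by (simp_all add: matrix_mul_assoc)
  then have "(k ** l) ** (l' ** k') = mat 1" "(l' ** k') ** (k ** l) = mat 1"
    by (simp_all add: k' l')
  moreover have "(k ** l) $ i $ j \<in> padic_ints" "(l' ** k') $ i $ j \<in> padic_ints" for i j
    using assms k' l' by (intro integral_matrix_matrix; simp add: gl2_padic_ints_def)+
  ultimately show ?thesis unfolding gl2_padic_ints_def by blast
qed

lemma gl2_padic_ints_inverse:
  assumes "k \<in> gl2_padic_ints"
  obtains k' where "k' \<in> gl2_padic_ints" "k ** k' = mat 1" "k' ** k = mat 1"
  using assms unfolding gl2_padic_ints_def by blast

lemma bt_class_self: "g \<in> bt_class g"
  unfolding bt_class_def using gl2_padic_ints_1
  by (auto intro!: exI[of _ 1] exI[of _ "mat 1"])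

lemma bt_class_subset:
  assumes "h \<in> bt_class g" shows "bt_class h \<subseteq> bt_class g"
proof
  fix x assume "x \<in> bt_class h"
  then obtain c k where x: "x = mat c ** h ** k" "c \<noteq> 0" "k \<in> gl2_padic_ints"
    by (auto simp: bt_class_def)
  obtain d l where h: "h = mat d ** g ** l" "d \<noteq> 0" "l \<in> gl2_padic_ints"
    using assms by (auto simp: bt_class_def)
  have "x = mat (c * d) ** g ** (l ** k)"
    unfolding x h mat_mult_mat[symmetric] by (simp add: matrix_mul_assoc)
  moreover have "c * d \<noteq> 0" "l ** k \<in> gl2_padic_ints" using x h gl2_padic_ints_mult by auto
  ultimately show "x \<in> bt_class g" unfolding bt_class_def by blast
qed

lemma bt_class_eq:
  assumes "h \<in> bt_class g" shows "bt_class h = bt_class g"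
proof (rule antisym[OF bt_class_subset[OF assms] bt_class_subset])
  obtain d l where h: "h = mat d ** g ** l" "d \<noteq> 0" "l \<in> gl2_padic_ints"
    using assms by (auto simp: bt_class_def)
  obtain l' where l': "l' \<in> gl2_padic_ints" "l ** l' = mat 1" using gl2_padic_ints_inverse[OF h(3)] by blast
  have "mat (inverse d) ** h ** l' = (mat (inverse d) ** mat d) ** g ** (l ** l')"
    unfolding h by (simp add: matrix_mul_assoc)
  then have "g = mat (inverse d) ** h ** l'" using h l' by (simp add: mat_mult_mat)
  moreover have "inverse d \<noteq> 0" using h by simp
  ultimately show "g \<in> bt_class h" unfolding bt_class_def using l'(1) by blast
qed

lemma padic_lattice_gl2_ints:
  assumes "k \<in> gl2_padic_ints" shows "padic_lattice (g ** k) = padic_lattice g"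
proof -
  obtain k' where k': "k' \<in> gl2_padic_ints" "k ** k' = mat 1" using gl2_padic_ints_inverse[OF assms] by blast
  have sub: "padic_lattice (h ** l) \<subseteq> padic_lattice h" if "l \<in> gl2_padic_ints" for h l :: "'a padic^2^2"
  proof
    fix v assume "v \<in> padic_lattice (h ** l)"
    then obtain z where z: "v = (h ** l) *v z" "\<forall>i. z $ i \<in> padic_ints" by (auto simp: padic_lattice_def)
    then have "v = h *v (l *v z)" by (simp add: matrix_vector_mul_assoc)
    moreover have "\<forall>i. (l *v z) $ i \<in> padic_ints"
      using that z by (intro allI integral_matrix_vector) (auto simp: gl2_padic_ints_def)
    ultimately show "v \<in> padic_lattice h" unfolding padic_lattice_def by blast
  qed
  have "g ** k ** k' = g" using k' by (simp flip: matrix_mul_assoc)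
  then show ?thesis using sub[OF assms, of g] sub[OF k'(1), of "g ** k"] by auto
qed

lemma padic_lattice_scale: "padic_lattice (mat c ** g) = (*s) c ` padic_lattice g"
  unfolding padic_lattice_def by (auto simp: image_iff mat_mult_vec simp flip: matrix_vector_mul_assoc)

lemma padic_lattice_bt_class:
  assumes "h \<in> bt_class g" obtains c where "c \<noteq> 0" "padic_lattice h = (*s) c ` padic_lattice g"
  using assms padic_lattice_gl2_ints padic_lattice_scale unfolding bt_class_def by blast

lemma padic_lattice_le_imp:
  assumes g: "invertible g" and sub: "padic_lattice h \<subseteq> padic_lattice (g :: 'p::prime_card padic^2^2)"
  obtains k where "h = g ** k" "\<And>i j. k $ i $ j \<in> padic_ints"
proof -
  obtain g' where g': "g ** g' = mat 1" "g' ** g = mat 1" using g unfolding invertible_def by blast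
  define k where "k = g' ** h"
  have h: "h = g ** k" unfolding k_def by (simp add: matrix_mul_assoc g')
  have "k $ i $ j \<in> padic_ints" for i j
  proof -
    have "\<forall>i. (axis j 1 :: 'p padic^2) $ i \<in> padic_ints" by (auto simp: axis_def padic_ints_0 padic_ints_1)
    then have "h *v axis j 1 \<in> padic_lattice g" using sub unfolding padic_lattice_def by blast
    then obtain z where z: "h *v axis j 1 = g *v z" "\<forall>i. z $ i \<in> padic_ints" by (auto simp: padic_lattice_def)
    have "k *v axis j 1 = (g' ** g) *v z"
      unfolding k_def by (simp add: z flip: matrix_vector_mul_assoc)
    then have "k *v axis j 1 = z" by (simp add: g')
    moreover have "(k *v axis j 1) $ i = k $ i $ j"
      using exhaust_2[of j] by (auto simp: matrix_vector_mult_2 axis_def)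
    ultimately show ?thesis using z by metis
  qed
  then show ?thesis using that h by blast
qed

text \<open>The two inclusions of lattices give integral transition matrices; they are inverse to
  each other because g and c h are invertible, and so belong to GL(2,Z_p).\<close>

lemma bt_class_eq_if_lattice_eq:
  assumes g: "invertible g" and h: "invertible h"
    and c: "c \<noteq> 0" and eq: "padic_lattice g = (*s) c ` padic_lattice (h :: 'p::prime_card padic^2^2)"
  shows "bt_class g = bt_class h"
proof -
  define h1 where "h1 = mat c ** h"
  have "invertible (mat c :: 'p padic^2^2)"
    unfolding invertible_def using c by (intro exI[of _ "mat (inverse c)"]) (simp add: mat_mult_mat)
  then have h1: "invertible h1" unfolding h1_def using h by (rule invertible_mult)
  have eq1: "padic_lattice g = padic_lattice h1" by (simp add: eq h1_def padic_lattice_scale)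
  obtain k where k: "g = h1 ** k" "\<And>i j. k $ i $ j \<in> padic_ints"
    using padic_lattice_le_imp[OF h1, of g] eq1 by blast
  obtain l where l: "h1 = g ** l" "\<And>i j. l $ i $ j \<in> padic_ints"
    using padic_lattice_le_imp[OF g, of h1] eq1 by blast
  obtain g' where g': "g' ** g = mat 1" using g unfolding invertible_def by blast
  obtain h' where h': "h' ** h1 = mat 1" using h1 unfolding invertible_def by blast
  have "l ** k = g' ** g ** l ** k" by (simp add: g')
  also have "\<dots> = g' ** (g ** l ** k)" by (simp add: matrix_mul_assoc)
  also have "\<dots> = mat 1" using k(1) l(1) g' by metis
  finally have lk: "l ** k = mat 1" .
  have "k ** l = h' ** h1 ** k ** l" by (simp add: h')
  also have "\<dots> = h' ** (h1 ** k ** l)" by (simp add: matrix_mul_assoc)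
  also have "\<dots> = mat 1" using k(1) l(1) h' by metis
  finally have kl: "k ** l = mat 1" .
  have "k \<in> gl2_padic_ints" using k(2) l(2) lk kl unfolding gl2_padic_ints_def by blast
  then have "g \<in> bt_class h" unfolding bt_class_def using k(1) c h1_def by blast
  then show ?thesis by (rule bt_class_eq)
qed

lemma integral_span_primitive:
  assumes e: "vmax e = 1" and e2: "vmax e2 \<le> 1" and d: "padic_abs (det2 e e2) = 1 / real CARD('p) ^ n"
  shows "{a *s e + b *s e2 | a b. a \<in> padic_ints \<and> b \<in> padic_ints} = lat (e :: 'p::prime_card padic^2) n"
    (is "?S = _")
proof
  have P: "real CARD('p) > 1" by (rule prime_card_gt_1)
  show "?S \<subseteq> lat e n"
  proof
    fix w assume "w \<in> ?S"
    then obtain a b where w: "w = a *s e + b *s e2" "a \<in> padic_ints" "b \<in> padic_ints" by blast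
    have "det2 e w = b * det2 e e2" by (simp add: w det2_def algebra_simps)
    then have "padic_abs (det2 e w) = padic_abs b * (1 / real CARD('p) ^ n)" by (simp add: padic_abs_mult d)
    also have "\<dots> \<le> 1 * (1 / real CARD('p) ^ n)"
      using w by (intro mult_right_mono) (auto simp: padic_ints_def)
    finally have "padic_abs (det2 e w) \<le> 1 / real CARD('p) ^ n" by simp
    moreover have "vmax w \<le> 1"
      using e e2 w unfolding vmax_le_1_iff
      by (auto simp: vmax_le_1_iff intro!: padic_ints_add padic_ints_mult)
        (metis order_refl vmax_le_1_iff)
    ultimately show "w \<in> lat e n" by (simp add: lat_def)
  qed
  show "lat e n \<subseteq> ?S"
  proof
    fix w assume w: "w \<in> lat e n"
    define D where "D = det2 e e2"
    have D: "D \<noteq> 0" "padic_abs D = 1 / real CARD('p) ^ n" using d P by (auto simp: D_def)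
    define b where "b = det2 e w / D"
    define a where "a = det2 w e2 / D"
    have b: "b \<in> padic_ints"
      using w D P by (simp add: b_def padic_ints_def lat_def padic_abs_divide) (simp add: field_simps)
    have "D * w $ i = det2 w e2 * e $ i + det2 e w * e2 $ i" for i
      using exhaust_2[of i] by (auto simp: D_def det2_def algebra_simps)
    then have comp: "w $ i = a * e $ i + b * e2 $ i" for i
      using D by (simp add: a_def b_def field_simps)
    \<comment> \<open>Cramer's rule alone bounds a only by p^n; a coordinate in which e is a unit
      gives integrality.\<close>
    obtain i where i: "padic_abs (e $ i) = 1" using vmax_attained[of e] e by auto
    have "padic_abs a = padic_abs (a * e $ i)" by (simp add: padic_abs_mult i)
    also have "\<dots> = padic_abs (w $ i - b * e2 $ i)" by (simp add: comp)
    also have "\<dots> \<le> 1"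
      using w b e2 padic_abs_le_vmax[of w i] padic_abs_le_vmax[of e2 i]
      by (intro order.trans[OF padic_abs_diff_le] max.boundedI)
        (auto simp: lat_def padic_ints_def padic_abs_mult intro: mult_le_one)
    finally have "a \<in> padic_ints" by (simp add: padic_ints_def)
    moreover have "w = a *s e + b *s e2" by (simp add: vec_eq_iff comp)
    ultimately show "w \<in> ?S" using b by blast
  qed
qed

lemma padic_lattice_columns:
  "padic_lattice g = {a *s column 1 g + b *s column 2 g | a b. a \<in> padic_ints \<and> b \<in> padic_ints}" (is "_ = ?S")
proof
  have "g *v z = z $ 1 *s column 1 g + z $ 2 *s column 2 g" for z
    by (simp add: vec_eq_iff matrix_vector_mult_2 column_def mult.commute)
  then show "padic_lattice g \<subseteq> ?S" by (auto simp: padic_lattice_def)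
  show "?S \<subseteq> padic_lattice g"
  proof
    fix w assume "w \<in> ?S"
    then obtain a b where w: "w = a *s column 1 g + b *s column 2 g" "a \<in> padic_ints" "b \<in> padic_ints" by blast
    then have "w = g *v vector [a, b]"
      by (simp add: vec_eq_iff matrix_vector_mult_2 column_def mult.commute)
    moreover have "\<forall>i. (vector [a, b] :: 'a padic^2) $ i \<in> padic_ints" using w by (simp add: forall_2)
    ultimately show "w \<in> padic_lattice g" unfolding padic_lattice_def by blast
  qed
qed

lemma padic_lattice_primitive_column:
  assumes g: "\<And>i. vmax (column i g) \<le> 1" and j: "vmax (column j g) = 1"
    and d: "padic_abs (det g) = 1 / real CARD('p) ^ n"
  shows "padic_lattice g = lat (column j g :: 'p::prime_card padic^2) n"
proof -
  have det: "det g = det2 (column 1 g) (column 2 g)" by (simp add: det_2 det2_def column_def mult.commute)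
  consider "j = 1" | "j = 2" using exhaust_2[of j] by blast
  then show ?thesis
  proof cases
    case 1
    then show ?thesis using integral_span_primitive[of "column 1 g" "column 2 g" n] g j d
      unfolding padic_lattice_columns det by simp
  next
    case 2
    have "padic_lattice g = {a *s column 2 g + b *s column 1 g | a b. a \<in> padic_ints \<and> b \<in> padic_ints}"
      unfolding padic_lattice_columns by (metis (lifting) add.commute)
    then show ?thesis using 2 integral_span_primitive[of "column 2 g" "column 1 g" n] g j d
      unfolding det by (simp add: padic_abs_det2_commute)
  qed
qed

text \<open>A primitive vector on the line through (x, 1): the scaling in which a point of the
  projective line enters \<open>lat\<close>.\<close>

definition prim :: "'p::prime_card padic \<Rightarrow> 'p padic^2" where
  "prim x = (if x \<in> padic_ints then vector [x, 1] else vector [1, inverse x])"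

definition ray_mat :: "'p::prime_card padic \<Rightarrow> nat \<Rightarrow> 'p padic^2^2" where
  "ray_mat x n = (if x \<in> padic_ints then vector [vector [of_nat CARD('p) ^ n, x], vector [0, 1]]
     else vector [vector [1, 0], vector [inverse x, of_nat CARD('p) ^ n]])"

abbreviation ray :: "'p::prime_card padic \<Rightarrow> nat \<Rightarrow> 'p bt_vertex" where
  "ray x \<equiv> proj_line_ray (Some x)"

lemma ray_eq_class: "ray x n = bt_class (ray_mat x n)"
  by (simp add: padic_ray_int_def padic_ray_inv_def ray_mat_def)

declare proj_line_ray.simps [simp del]

lemma inverse_padic_ints: "x \<notin> padic_ints \<Longrightarrow> padic_abs (inverse x) < 1"
  by (simp add: padic_ints_def padic_abs_inverse inverse_less_1_iff)

lemma vmax_prim [simp]: "vmax (prim x) = 1"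
  using inverse_padic_ints[of x]
  by (auto simp: prim_def vmax_def padic_ints_def)

lemma prime_power_integral: "padic_abs (of_nat CARD('p) ^ n :: 'p::prime_card padic) = 1 / real CARD('p) ^ n"
  by (simp add: padic_abs_power padic_abs_prime power_one_over)

lemma det_ray_mat: "det (ray_mat x n) = of_nat CARD('p) ^ n" for x :: "'p::prime_card padic"
  by (simp add: det_2 ray_mat_def)

lemma invertible_ray_mat: "invertible (ray_mat x n)" for x :: "'p::prime_card padic"
  unfolding invertible_det_nz det_ray_mat using prime_padic_nonzero[where 'p='p] by simp

lemma padic_lattice_ray_mat: "padic_lattice (ray_mat x n) = lat (prim x) n" for x :: "'p::prime_card padic"
proof -
  have P: "1 / real CARD('p) ^ n \<le> 1" using prime_card_gt_1[where 'p='p] by simp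
  define j :: 2 where "j = (if x \<in> padic_ints then 2 else 1)"
  have c: "column j (ray_mat x n) = prim x"
    by (auto simp: vec_eq_iff forall_2 column_def ray_mat_def prim_def j_def)
  have "vmax (column i (ray_mat x n)) \<le> 1" for i
    using exhaust_2[of i] P inverse_padic_ints[of x]
    by (auto simp: vmax_def column_def ray_mat_def prime_power_integral padic_ints_def simp del: of_nat_power)
  then have "padic_lattice (ray_mat x n) = lat (column j (ray_mat x n)) n"
    by (rule padic_lattice_primitive_column) (simp_all add: c det_ray_mat prime_power_integral del: of_nat_power)
  then show ?thesis by (simp add: c)
qed

lemma ray_in_vertices [simp]: "ray x n \<in> bt_vertices"
  unfolding ray_eq_class bt_vertices_def gl2_padic_def using invertible_ray_mat by blast

text \<open>The chordal distance on the projective line, written delta in the overview.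
  \<open>ray_eq_iff\<close> relates it to the number of common edges of two rays.\<close>

definition chord :: "'p::prime_card padic \<Rightarrow> 'p padic \<Rightarrow> real" where
  "chord x y = padic_abs (det2 (prim x) (prim y))"

lemma chord_commute: "chord x y = chord y x"
  by (simp add: chord_def padic_abs_det2_commute)

lemma lat_prim_eq_iff: "lat (prim x) n = lat (prim y) m \<longleftrightarrow> n = m \<and> chord x y \<le> 1 / real CARD('p) ^ n"
  for x :: "'p::prime_card padic"
  by (subst lat_eq_iff) (auto simp: chord_def padic_abs_det2_commute)

lemma ray_eq_iff: "ray x n = ray y m \<longleftrightarrow> n = m \<and> chord x y \<le> 1 / real CARD('p) ^ n"
  for x :: "'p::prime_card padic"
proof -
  have "ray x n = ray y m \<longleftrightarrow> lat (prim x) n = lat (prim y) m"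
  proof
    assume "ray x n = ray y m"
    then have "ray_mat x n \<in> bt_class (ray_mat y m)" using bt_class_self unfolding ray_eq_class by blast
    then obtain c where "c \<noteq> 0" "lat (prim x) n = (*s) c ` lat (prim y) m"
      using padic_lattice_bt_class unfolding padic_lattice_ray_mat[symmetric] by blast
    then show "lat (prim x) n = lat (prim y) m" by (intro homothetic_lat) auto
  next
    assume "lat (prim x) n = lat (prim y) m"
    then show "ray x n = ray y m" unfolding ray_eq_class
      by (intro bt_class_eq_if_lattice_eq[of _ _ 1] invertible_ray_mat)
        (simp_all add: padic_lattice_ray_mat)
  qed
  then show ?thesis by (simp only: lat_prim_eq_iff)
qed

text \<open>Finite points reach every such lattice: off the line at infinity the point is the slope
  of e, and on it any finite point close enough to infinity gives the same lattice.\<close>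

lemma lat_eq_lat_prim:
  assumes "vmax e = 1" obtains x where "lat e n = lat (prim x) n"
proof -
  have "\<exists>x. padic_abs (det2 e (prim x)) \<le> 1 / real CARD('a) ^ n"
  proof (cases "e $ 2 = 0")
    case True
    \<comment> \<open>The inverse of w is at chordal distance p^(-n-1) from infinity; the extra
      power of p keeps it outside Z_p when n = 0.\<close>
    define w where "w = (of_nat CARD('a) :: 'a padic) ^ Suc n"
    have w: "padic_abs w = 1 / real CARD('a) ^ Suc n" unfolding w_def by (rule prime_power_integral)
    have P: "real CARD('a) > 1" by (rule prime_card_gt_1)
    have "1 < real CARD('a) ^ Suc n" using P by (rule one_less_power) simp
    then have "inverse w \<notin> padic_ints" by (simp add: padic_ints_def padic_abs_inverse w)
    then have "det2 e (prim (inverse w)) = e $ 1 * w" using True by (simp add: det2_def prim_def)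
    moreover have "padic_abs (e $ 1) \<le> 1" using padic_abs_le_vmax[of e 1] assms by simp
    ultimately have "padic_abs (det2 e (prim (inverse w))) \<le> 1 * (1 / real CARD('a) ^ Suc n)"
      by (simp only: padic_abs_mult w) (rule mult_right_mono, simp_all)
    also have "\<dots> \<le> 1 / real CARD('a) ^ n"
      using inverse_power_mono_card[of "Suc n" n, where 'p='a] by simp
    finally show ?thesis by blast
  next
    case False
    have "det2 e (prim (e $ 1 / e $ 2)) = 0"
      using False by (auto simp: det2_def prim_def padic_ints_0 field_simps)
    then show ?thesis by (intro exI[of _ "e $ 1 / e $ 2"]) simp
  qed
  then obtain x where "padic_abs (det2 e (prim x)) \<le> 1 / real CARD('a) ^ n" by blast
  then show ?thesis using that assms lat_eq_iff[of "prim x" e n n] by (simp add: padic_abs_det2_commute)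
qed

text \<open>Dividing a representative by its entry of largest absolute value makes it integral with
  a primitive column. Its determinant then has absolute value p^(-n) for some n, so its lattice is
  \<open>lat\<close> of that column.\<close>

lemma vertex_eq_ray:
  assumes "v \<in> bt_vertices" obtains x n where "v = ray x n"
proof -
  obtain g where g: "invertible g" "v = bt_class g" using assms by (auto simp: bt_vertices_def gl2_padic_def)
  define r where "r = max (vmax (column 1 g)) (vmax (column 2 g))"
  have le: "padic_abs (g $ i $ j) \<le> r" for i j
    using exhaust_2[of i] exhaust_2[of j] by (auto simp: r_def vmax_def column_def)
  obtain i j where ij: "padic_abs (g $ i $ j) = r"
  proof -
    obtain j where "vmax (column j g) = r" unfolding r_def by (metis max_def)
    moreover obtain i where "vmax (column j g) = padic_abs (column j g $ i)" by (rule vmax_attained)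
    ultimately show ?thesis using that by (simp add: column_def)
  qed
  have "g \<noteq> 0"
  proof
    assume "g = 0"
    then have "det g = 0" by (simp add: det_2)
    then show False using g by (simp add: invertible_det_nz)
  qed
  then have r0: "r \<noteq> 0" using le by (metis padic_abs_eq_0_iff padic_abs_nonneg antisym vec_eq_iff zero_index)
  define c where "c = inverse (g $ i $ j)"
  have c0: "c \<noteq> 0" and cabs: "padic_abs c = inverse r" using r0 ij by (auto simp: c_def padic_abs_inverse)
  have rpos: "r > 0" using r0 ij by (metis less_le padic_abs_nonneg)
  define h where "h = mat c ** g"
  have hle: "padic_abs (h $ k $ l) \<le> 1" for k l
    unfolding h_def mat_mult_component padic_abs_mult cabs using le[of k l] rpos by (simp add: field_simps)
  have hij: "padic_abs (h $ i $ j) = 1"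
    unfolding h_def mat_mult_component padic_abs_mult cabs using ij rpos by simp
  have hcol: "vmax (column l h) \<le> 1" for l using hle by (simp add: vmax_def column_def)
  have hj: "vmax (column j h) = 1"
    using hcol[of j] hij padic_abs_le_vmax[of "column j h" i] by (simp add: column_def)
  have "h \<in> bt_class g" unfolding h_def bt_class_def using c0 gl2_padic_ints_1
    by (auto intro!: exI[of _ c] exI[of _ "mat 1"])
  then have vh: "v = bt_class h" using bt_class_eq g by metis
  have inv: "invertible h"
    unfolding h_def using c0 g
    by (intro invertible_mult) (auto simp: invertible_def mat_mult_mat intro!: exI[of _ "mat (inverse c)"])
  have d0: "det h \<noteq> 0" using inv by (simp add: invertible_det_nz)
  have "padic_abs (det h) \<le> 1"
  proof -
    have "det h = det2 (column 1 h) (column 2 h)" by (simp add: det_2 det2_def column_def mult.commute)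
    then show ?thesis using padic_abs_det2_le[of "column 1 h" "column 2 h"] hcol[of 1] hcol[of 2]
      by (metis mult_le_one order.trans vmax_nonneg)
  qed
  then have "1 \<le> padic_abs (inverse (det h))"
    using d0 by (simp add: padic_abs_inverse one_le_inverse_iff less_le)
  then obtain n where n: "padic_abs (inverse (det h)) = real CARD('a) ^ n" by (rule padic_abs_eq_power)
  then have "padic_abs (det h) = 1 / real CARD('a) ^ n"
    by (metis inverse_eq_divide inverse_inverse_eq padic_abs_inverse)
  then have L: "padic_lattice h = lat (column j h) n" by (rule padic_lattice_primitive_column[OF hcol hj])
  obtain x where "lat (column j h) n = lat (prim x) n" using lat_eq_lat_prim[OF hj] .
  then have "bt_class h = bt_class (ray_mat x n)"
    by (intro bt_class_eq_if_lattice_eq[of _ _ 1] inv invertible_ray_mat) (simp_all add: L padic_lattice_ray_mat)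
  then show ?thesis using that vh by (simp only: ray_eq_class)
qed

lemma bt_base_eq_ray: "bt_base = ray x 0"
proof -
  have "padic_lattice (mat 1) = lat (prim x) 0"
  proof -
    have "padic_abs (det2 (prim x) w) \<le> 1" if "vmax w \<le> 1" for w
      using padic_abs_det2_le[of "prim x" w] that by simp
    then show ?thesis by (auto simp: padic_lattice_def lat_def vmax_le_1_iff)
  qed
  then show ?thesis unfolding bt_base_def ray_eq_class
    by (intro bt_class_eq_if_lattice_eq[of _ _ 1] invertible_ray_mat)
      (simp_all add: padic_lattice_ray_mat invertible_det_nz)
qed

lemma bt_adj_ray_iff: "bt_adj (ray x n) (ray y m) \<longleftrightarrow>
    m = Suc n \<and> ray y n = ray x n \<or> n = Suc m \<and> ray x m = ray y m"
  for x :: "'p::prime_card padic"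
proof
  let ?w = "of_nat CARD('p) :: 'p padic"
  assume "bt_adj (ray x n) (ray y m)"
  then obtain g h where gh: "g \<in> ray x n" "h \<in> ray y m" "(*s) ?w ` padic_lattice g \<subset> padic_lattice h"
    "padic_lattice h \<subset> padic_lattice g" unfolding bt_adj_def by blast
  obtain c where c: "c \<noteq> 0" "padic_lattice g = (*s) c ` lat (prim x) n"
    using padic_lattice_bt_class gh(1) unfolding ray_eq_class padic_lattice_ray_mat[symmetric] by blast
  obtain d where d: "d \<noteq> 0" "padic_lattice h = (*s) d ` lat (prim y) m"
    using padic_lattice_bt_class gh(2) unfolding ray_eq_class padic_lattice_ray_mat[symmetric] by blast
  \<comment> \<open>Only the relative scale of the two representatives matters; it becomes the
    homothety factor of \<open>neighbouring_lat\<close>.\<close>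
  define b where "b = d / c"
  have b: "b \<noteq> 0" "d = c * b" using c d by (auto simp: b_def)
  have "(*s) c ` (*s) ?w ` lat (prim x) n \<subset> (*s) c ` (*s) b ` lat (prim y) m"
    using gh(3) unfolding c d b(2) scaled_scaled by (simp add: mult.commute)
  moreover have "(*s) c ` (*s) b ` lat (prim y) m \<subset> (*s) c ` lat (prim x) n"
    using gh(4) unfolding c d b(2) scaled_scaled .
  ultimately have "m = Suc n \<and> lat (prim y) n = lat (prim x) n \<or> n = Suc m \<and> lat (prim x) m = lat (prim y) m"
    unfolding scaled_psubset_iff[OF c(1)] by (intro neighbouring_lat[OF _ _ b(1)]) simp_all
  then show "m = Suc n \<and> ray y n = ray x n \<or> n = Suc m \<and> ray x m = ray y m"
    by (simp only: ray_eq_iff lat_prim_eq_iff)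
next
  let ?w = "of_nat CARD('p) :: 'p padic"
  assume *: "m = Suc n \<and> ray y n = ray x n \<or> n = Suc m \<and> ray x m = ray y m"
  show "bt_adj (ray x n) (ray y m)"
  proof (cases "m = Suc n")
    case True
    then have "lat (prim y) n = lat (prim x) n" using * by (simp only: ray_eq_iff lat_prim_eq_iff) simp
    from lat_Suc_neighbouring[OF _ _ this] True
    have "(*s) ?w ` padic_lattice (ray_mat x n) \<subset> padic_lattice (ray_mat y m)"
      "padic_lattice (ray_mat y m) \<subset> padic_lattice (ray_mat x n)"
      by (simp_all add: padic_lattice_ray_mat)
    then show ?thesis unfolding bt_adj_def using bt_class_self ray_in_vertices by (metis ray_eq_class)
  next
    case False
    then have n: "n = Suc m" and "lat (prim x) m = lat (prim y) m"
      using * by (simp_all only: ray_eq_iff lat_prim_eq_iff) simp_all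
    from lat_Suc_neighbouring[OF _ _ this(2)]
    have "(*s) ?w ` lat (prim y) m \<subset> lat (prim x) n" "lat (prim x) n \<subset> lat (prim y) m" using n by simp_all
    \<comment> \<open>Here y has the larger lattice, so its matrix is multiplied by p to fit between
      p times the lattice of x and the lattice of x.\<close>
    then have "(*s) ?w ` padic_lattice (ray_mat x n) \<subset> padic_lattice (mat ?w ** ray_mat y m)"
      "padic_lattice (mat ?w ** ray_mat y m) \<subset> padic_lattice (ray_mat x n)"
      by (simp_all add: padic_lattice_ray_mat padic_lattice_scale scaled_psubset_iff[OF prime_padic_nonzero])
    moreover have "mat ?w ** ray_mat y m \<in> ray y m"
      unfolding ray_eq_class bt_class_def using prime_padic_nonzero[where 'p='p] gl2_padic_ints_1
      by (auto intro!: exI[of _ ?w] exI[of _ "mat 1"])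
    ultimately show ?thesis unfolding bt_adj_def using bt_class_self[of "ray_mat x n"] ray_in_vertices
      by (metis ray_eq_class)
  qed
qed

subsection \<open>Leveled trees\<close>

text \<open>Levels and parents are all that the harmonic analysis uses of the tree, so it is carried
  out here without reference to p-adic numbers.\<close>

locale leveled_tree =
  fixes V :: "'v set" and root :: 'v and lev :: "'v \<Rightarrow> nat" and par :: "'v \<Rightarrow> 'v" and p :: nat
  assumes root_mem: "root \<in> V"
    and lev_eq_0_iff: "v \<in> V \<Longrightarrow> lev v = 0 \<longleftrightarrow> v = root"
    and par_mem: "v \<in> V \<Longrightarrow> lev v = Suc n \<Longrightarrow> par v \<in> V"
    and lev_par: "v \<in> V \<Longrightarrow> lev v = Suc n \<Longrightarrow> lev (par v) = n"
    and p_gt_1: "1 < p"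
    and card_children: "v \<in> V \<Longrightarrow>
      card {w \<in> V. lev w = Suc (lev v) \<and> par w = v} = (if v = root then Suc p else p)"
begin

definition children :: "'v \<Rightarrow> 'v set" where
  "children v = {w \<in> V. lev w = Suc (lev v) \<and> par w = v}"

definition level :: "nat \<Rightarrow> 'v set" where
  "level n = {v \<in> V. lev v = n}"

definition anc :: "nat \<Rightarrow> 'v \<Rightarrow> 'v" where
  "anc l v = (par ^^ (lev v - l)) v"

text \<open>The \<open>\<mu>\<^sub>0\<close>-mass of a boundary ball at level n; at the root it adds
  up the p + 1 children of mass 1/p.\<close>

definition mass :: "nat \<Rightarrow> real" where
  "mass n = (if n = 0 then 1 + 1 / real p else 1 / real p ^ n)"

text \<open>The boundary integral of the function sending a ray r to h (r n). As a finite sum it can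
  be compared with integrals over Q_p as well.\<close>

definition level_integral :: "nat \<Rightarrow> ('v \<Rightarrow> real) \<Rightarrow> real" where
  "level_integral n h = mass n * (\<Sum>v\<in>level n. h v)"

definition rays :: "(nat \<Rightarrow> 'v) set" where
  "rays = {r. r 0 = root \<and> (\<forall>n. r (Suc n) \<in> children (r n))}"

definition martingale :: "('v \<Rightarrow> real) \<Rightarrow> bool" where
  "martingale F \<longleftrightarrow> (\<forall>v\<in>V. (\<Sum>w\<in>children v. F w) = real (card (children v)) * F v)"

text \<open>The weighted Laplace equation: the edge weights grow by the factor \<open>1 / \<kappa>\<close> from each level
  to the next.\<close>

definition balanced :: "real \<Rightarrow> ('v \<Rightarrow> real) \<Rightarrow> bool" where
  "balanced \<kappa> g \<longleftrightarrow> (\<forall>v\<in>V. (\<Sum>w\<in>children v. g w - g v) = (if v = root then 0 else \<kappa> * (g v - g (par v))))"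

lemma lev_root: "lev root = 0"
  using lev_eq_0_iff root_mem by blast

lemma card_children': "v \<in> V \<Longrightarrow> card (children v) = (if v = root then Suc p else p)"
  unfolding children_def by (rule card_children)

lemma card_children_pos: "v \<in> V \<Longrightarrow> 0 < card (children v)"
  using card_children'[of v] p_gt_1 by (simp split: if_splits)

lemma finite_children: "v \<in> V \<Longrightarrow> finite (children v)"
  using card_children_pos card_gt_0_iff by blast

lemma children_nonempty: "v \<in> V \<Longrightarrow> children v \<noteq> {}"
  using card_children_pos card_gt_0_iff by blast

lemma childrenD: "w \<in> children v \<Longrightarrow> w \<in> V" "w \<in> children v \<Longrightarrow> lev w = Suc (lev v)" "w \<in> children v \<Longrightarrow> par w = v"
  by (auto simp: children_def)

lemma child_of_par: "v \<in> V \<Longrightarrow> lev v = Suc n \<Longrightarrow> v \<in> children (par v)"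
  using lev_par by (simp add: children_def)

lemma level_0: "level 0 = {root}"
  using lev_eq_0_iff root_mem lev_root by (auto simp: level_def)

lemma level_Suc: "level (Suc n) = (\<Union>v\<in>level n. children v)"
  using lev_par par_mem by (auto simp: level_def children_def)

lemma finite_level: "finite (level n)"
proof (induction n)
  case (Suc n)
  then show ?case unfolding level_Suc by (auto simp: level_def finite_children)
qed (simp add: level_0)

lemma sum_level_Suc: "(\<Sum>w\<in>level (Suc n). h w) = (\<Sum>v\<in>level n. \<Sum>w\<in>children v. h w)" for h :: "'v \<Rightarrow> real"
proof -
  have "(\<Sum>v\<in>level n. \<Sum>w\<in>{w \<in> level (Suc n). par w = v}. h w) = (\<Sum>w\<in>level (Suc n). h w)"
    using finite_level lev_par par_mem by (intro sum.group) (auto simp: level_def)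
  moreover have "{w \<in> level (Suc n). par w = v} = children v" if "v \<in> level n" for v
    using that by (auto simp: level_def children_def)
  ultimately show ?thesis by simp
qed

lemma mass_pos: "0 < mass n"
  using p_gt_1 by (simp add: mass_def add_pos_nonneg)

lemma mass_children: "v \<in> V \<Longrightarrow> mass (Suc (lev v)) * real (card (children v)) = mass (lev v)"
  using p_gt_1 card_children'[of v] lev_eq_0_iff[of v] by (auto simp: mass_def field_simps)

text \<open>Conditional expectation: the factor h of the parent is constant on siblings, so only the
  average of F over them enters.\<close>

lemma level_integral_Suc:
  assumes "martingale F"
  shows "level_integral (Suc n) (\<lambda>w. F w * h (par w)) = level_integral n (\<lambda>v. F v * h v)"
proof -
  have "level_integral (Suc n) (\<lambda>w. F w * h (par w)) =
      (\<Sum>v\<in>level n. mass (Suc n) * (\<Sum>w\<in>children v. F w * h (par w)))"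
    unfolding level_integral_def sum_level_Suc by (rule sum_distrib_left)
  also have "\<dots> = (\<Sum>v\<in>level n. mass n * (F v * h v))"
  proof (rule sum.cong[OF refl])
    fix v assume v: "v \<in> level n"
    then have V: "v \<in> V" "lev v = n" by (auto simp: level_def)
    have "(\<Sum>w\<in>children v. F w * h (par w)) = (\<Sum>w\<in>children v. F w) * h v"
      unfolding sum_distrib_right by (intro sum.cong) (auto simp: childrenD)
    then show "mass (Suc n) * (\<Sum>w\<in>children v. F w * h (par w)) = mass n * (F v * h v)"
      using assms V mass_children[OF V(1)] by (simp add: martingale_def algebra_simps)
  qed
  finally show ?thesis by (simp add: level_integral_def sum_distrib_left)
qed

lemma level_integral_cmult: "level_integral n (\<lambda>v. c * h v) = c * level_integral n h"
  by (simp add: level_integral_def sum_distrib_left mult.left_commute)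

lemma level_integral_add: "level_integral n (\<lambda>v. g v + h v) = level_integral n g + level_integral n h"
  by (simp add: level_integral_def sum.distrib distrib_left)

lemma level_integral_diff: "level_integral n (\<lambda>v. g v - h v) = level_integral n g - level_integral n h"
  by (simp add: level_integral_def sum_subtractf right_diff_distrib)

lemma level_integral_sum: "level_integral n (\<lambda>v. \<Sum>i\<in>I. h i v) = (\<Sum>i\<in>I. level_integral n (h i))"
  unfolding level_integral_def sum_distrib_left by (rule sum.swap)

lemma anc_self: "anc (lev v) v = v"
  by (simp add: anc_def)

lemma anc_par:
  assumes "v \<in> V" "lev v = Suc m" "l \<le> m" shows "anc l v = anc l (par v)"
proof -
  have "Suc m - l = Suc (m - l)" using assms by simp
  then show ?thesis using assms lev_par[of v m] by (simp add: anc_def funpow_swap1)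
qed

lemma anc_mem: "v \<in> V \<Longrightarrow> l \<le> lev v \<Longrightarrow> anc l v \<in> level l"
proof (induction "lev v - l" arbitrary: v)
  case 0
  then show ?case by (simp add: anc_def level_def)
next
  case (Suc k)
  then obtain m where m: "lev v = Suc m" "l \<le> m" by (cases "lev v") auto
  then show ?case using Suc anc_par[OF Suc(3) m] par_mem[of v m] lev_par[of v m] by simp
qed

lemma level_integral_anc:
  assumes "martingale F" "l \<le> m"
  shows "level_integral m (\<lambda>w. F w * h (anc l w)) = level_integral l (\<lambda>v. F v * h v)"
  using assms(2)
proof (induction m rule: dec_induct)
  case base
  show ?case unfolding level_integral_def by (intro arg_cong2[of _ _ _ _ "(*)"] sum.cong refl) (auto simp: level_def anc_self)
next
  case (step m)
  have "level_integral (Suc m) (\<lambda>w. F w * h (anc l w)) = level_integral (Suc m) (\<lambda>w. F w * h (anc l (par w)))"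
    unfolding level_integral_def using step anc_par
    by (intro arg_cong2[of _ _ _ _ "(*)"] sum.cong refl) (auto simp: level_def)
  then show ?case using level_integral_Suc[OF assms(1), of m "\<lambda>w. h (anc l w)"] step by simp
qed

lemma ray_mem: "r \<in> rays \<Longrightarrow> r n \<in> level n"
proof (induction n)
  case 0
  then show ?case by (simp add: rays_def level_0)
next
  case (Suc n)
  then show ?case unfolding level_Suc by (auto simp: rays_def)
qed

lemma anc_ray: "r \<in> rays \<Longrightarrow> l \<le> n \<Longrightarrow> anc l (r n) = r l"
proof (induction n)
  case 0
  then show ?case using ray_mem[of r 0] by (simp add: anc_def level_def)
next
  case (Suc n)
  then have m: "r (Suc n) \<in> V" "lev (r (Suc n)) = Suc n" using ray_mem[of r "Suc n"] by (auto simp: level_def)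
  show ?case
  proof (cases "l = Suc n")
    case True
    then show ?thesis using m anc_self[of "r (Suc n)"] by simp
  next
    case False
    have "par (r (Suc n)) = r n" using Suc(2) childrenD(3) by (auto simp: rays_def)
    then show ?thesis using False Suc anc_par[OF m, of l] by simp
  qed
qed

text \<open>A property that always passes to some child can be followed to infinity. Up to w the ray
  is forced to run through the ancestors of w; afterwards it is chosen step by step.\<close>

lemma ray_through:
  assumes w: "w \<in> V" "Q w" and Q: "\<And>u. u \<in> V \<Longrightarrow> Q u \<Longrightarrow> \<exists>u'\<in>children u. Q u'"
  obtains r where "r \<in> rays" "r (lev w) = w" "\<And>k. lev w \<le> k \<Longrightarrow> Q (r k)"
proof -
  obtain nxt where nxt: "\<And>u. u \<in> V \<Longrightarrow> Q u \<Longrightarrow> nxt u \<in> children u \<and> Q (nxt u)" using Q by metis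
  define r where "r k = (if k \<le> lev w then anc k w else (nxt ^^ (k - lev w)) w)" for k
  have it: "(nxt ^^ k) w \<in> V \<and> Q ((nxt ^^ k) w)" for k
    by (induction k) (use w nxt childrenD(1) in auto)
  have r_ge: "r k = (nxt ^^ (k - lev w)) w" if "lev w \<le> k" for k
    using that anc_self[of w] by (auto simp: r_def)
  have "r (Suc k) \<in> children (r k)" for k
  proof (cases "lev w \<le> k")
    case True
    then have "Suc k - lev w = Suc (k - lev w)" by simp
    then show ?thesis using nxt it True by (simp add: r_ge)
  next
    case False
    have a: "anc (Suc k) w \<in> V" "lev (anc (Suc k) w) = Suc k"
      using anc_mem[OF w(1), of "Suc k"] False by (auto simp: level_def)
    have "anc k w = par (anc (Suc k) w)"
    proof -
      have "lev w - k = Suc (lev w - Suc k)" using False by simp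
      then show ?thesis unfolding anc_def by simp
    qed
    then show ?thesis using False child_of_par[OF a] by (simp add: r_def)
  qed
  moreover have "r 0 = root" using anc_mem[OF w(1), of 0] by (simp add: r_def level_0)
  ultimately have "r \<in> rays" by (simp add: rays_def)
  then show ?thesis using that[of r] it anc_self[of w] r_ge by (auto simp: r_def)
qed

section \<open>Uniqueness for the weighted Laplace equation\<close>

lemma balanced_uminus: "balanced \<kappa> g \<Longrightarrow> balanced \<kappa> (\<lambda>v. - g v)"
proof -
  assume g: "balanced \<kappa> g"
  have "(\<Sum>w\<in>children v. - g w - - g v) = - (\<Sum>w\<in>children v. g w - g v)" for v
    by (simp flip: sum_negf)
  then show ?thesis using g unfolding balanced_def by (auto simp: algebra_simps)
qed

lemma balanced_diff:
  assumes g: "balanced \<kappa> g" and h: "balanced \<kappa> h" shows "balanced \<kappa> (\<lambda>v. g v - h v)"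
  unfolding balanced_def
proof
  fix v assume v: "v \<in> V"
  have "(\<Sum>w\<in>children v. g w - h w - (g v - h v)) = (\<Sum>w\<in>children v. g w - g v) - (\<Sum>w\<in>children v. h w - h v)"
    unfolding sum_subtractf[symmetric] by (intro sum.cong) auto
  also have "\<dots> = (if v = root then 0 else \<kappa> * (g v - g (par v))) - (if v = root then 0 else \<kappa> * (h v - h (par v)))"
    using g h v by (simp only: balanced_def)
  also have "\<dots> = (if v = root then 0 else \<kappa> * (g v - h v - (g (par v) - h (par v))))"
    by (simp add: algebra_simps)
  finally show "(\<Sum>w\<in>children v. g w - h w - (g v - h v)) =
      (if v = root then 0 else \<kappa> * (g v - h v - (g (par v) - h (par v))))" .
qed

text \<open>An increase of a harmonic function along an edge propagates to a ray, along which the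
  function increases to its limit.\<close>

lemma balanced_increase_neg:
  assumes g: "balanced \<kappa> g" and \<kappa>: "\<kappa> > 0" and lim: "\<And>r. r \<in> rays \<Longrightarrow> (\<lambda>n. g (r n)) \<longlonglongrightarrow> 0"
    and w: "v \<in> V" "w \<in> children v" "g v < g w"
  shows "g w < 0"
proof -
  let ?Q = "\<lambda>u. lev u \<noteq> 0 \<and> g (par u) < g u"
  have "\<exists>u'\<in>children u. ?Q u'" if u: "u \<in> V" "?Q u" for u
  proof -
    have "u \<noteq> root" using u lev_root by auto
    then have "0 < (\<Sum>w\<in>children u. g w - g u)" using g u \<kappa> by (simp add: balanced_def)
    then obtain u' where "u' \<in> children u" "0 < g u' - g u" by (meson not_le sum_nonpos)
    then show ?thesis using childrenD by (intro bexI[of _ u']) auto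
  qed
  moreover have "w \<in> V" "?Q w" using w childrenD by auto
  ultimately obtain r where r: "r \<in> rays" "r (lev w) = w" "\<And>k. lev w \<le> k \<Longrightarrow> ?Q (r k)"
    using ray_through[of w ?Q] by blast
  have inc: "g (r k) < g (r (Suc k))" if "lev w \<le> k" for k
  proof -
    have "par (r (Suc k)) = r k" using r(1) childrenD(3) by (auto simp: rays_def)
    then show ?thesis using r(3)[of "Suc k"] that by simp
  qed
  have mono: "g (r (Suc (lev w))) \<le> g (r k)" if "Suc (lev w) \<le> k" for k
    using that
  proof (induction k rule: dec_induct)
    case (step k)
    then show ?case using inc[of k] by simp
  qed simp
  have "g (r (Suc (lev w))) \<le> 0"
    using lim[OF r(1)] by (rule LIMSEQ_le_const) (use mono in blast)
  then show ?thesis using inc[of "lev w"] r(2) by simp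
qed

text \<open>If the increments to the children of v sum to 0 but do not all vanish, one child u has a
  larger and one child u' a smaller value. By \<open>balanced_increase_neg\<close>, applied to g and
  to - g, this gives g v < g u < 0 < g u' < g v. At the root the sum is 0, so g is constant on the
  children, and inductively everywhere; the constant is its limit 0.\<close>

lemma balanced_eq_0:
  assumes g: "balanced \<kappa> g" and \<kappa>: "\<kappa> > 0" and lim: "\<And>r. r \<in> rays \<Longrightarrow> (\<lambda>n. g (r n)) \<longlonglongrightarrow> 0"
    and v: "v \<in> V"
  shows "g v = 0"
proof -
  have lim': "(\<lambda>n. - g (r n)) \<longlonglongrightarrow> 0" if "r \<in> rays" for r
    using tendsto_minus[OF lim[OF that]] by simp
  have up: "g w < 0" if "v \<in> V" "w \<in> children v" "g v < g w" for v w
    using balanced_increase_neg[OF g \<kappa> lim that] .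
  have down: "g w > 0" if "v \<in> V" "w \<in> children v" "g w < g v" for v w
    using balanced_increase_neg[OF balanced_uminus[OF g] \<kappa> lim', of v w] that by simp
  have eq: "g w = g v" if v: "v \<in> V" "(\<Sum>w\<in>children v. g w - g v) = 0" and w: "w \<in> children v" for v w
  proof (rule ccontr)
    assume ne: "g w \<noteq> g v"
    have "\<exists>u\<in>children v. g v < g u"
    proof (rule ccontr)
      assume "\<not> ?thesis"
      then have "(\<Sum>w\<in>children v. g v - g w) = 0 \<longleftrightarrow> (\<forall>w\<in>children v. g v - g w = 0)"
        by (intro sum_nonneg_eq_0_iff finite_children v(1)) (auto simp: not_less)
      moreover have "(\<Sum>w\<in>children v. g v - g w) = - (\<Sum>w\<in>children v. g w - g v)" by (simp flip: sum_negf)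
      ultimately show False using ne w v by simp
    qed
    moreover have "\<exists>u\<in>children v. g u < g v"
    proof (rule ccontr)
      assume "\<not> ?thesis"
      then have "(\<Sum>w\<in>children v. g w - g v) = 0 \<longleftrightarrow> (\<forall>w\<in>children v. g w - g v = 0)"
        by (intro sum_nonneg_eq_0_iff finite_children v(1)) (auto simp: not_less)
      then show False using ne w v by simp
    qed
    ultimately obtain u u' where "u \<in> children v" "g v < g u" "u' \<in> children v" "g u' < g v" by blast
    then show False using up[OF v(1), of u] down[OF v(1), of u'] by simp
  qed
  have const: "g v = g root" if "v \<in> level n" for n v
    using that
  proof (induction n arbitrary: v rule: less_induct)
    case (less n)
    show ?case
    proof (cases n)
      case 0
      then show ?thesis using less.prems by (simp add: level_0)
    next
      case (Suc m)
      then obtain u where u: "u \<in> level m" "v \<in> children u" using less.prems by (auto simp: level_Suc)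
      then have uV: "u \<in> V" "lev u = m" by (auto simp: level_def)
      have gu: "g u = g root" using less.IH[of m u] u(1) Suc by simp
      have "u = root \<or> g u = g (par u)"
      proof (cases m)
        case 0
        then show ?thesis using u by (simp add: level_0)
      next
        case (Suc k)
        then have "par u \<in> level k" using uV par_mem lev_par by (simp add: level_def)
        then have "g (par u) = g root" using less.IH[of k "par u"] \<open>n = Suc m\<close> Suc by simp
        then show ?thesis using gu by simp
      qed
      then have "(\<Sum>w\<in>children u. g w - g u) = 0" using g uV by (auto simp: balanced_def)
      then show ?thesis using eq[OF uV(1) _ u(2)] gu by simp
    qed
  qed
  have "\<exists>u'\<in>children u. True" if "u \<in> V" for u using children_nonempty[OF that] by auto
  then obtain r where r: "r \<in> rays" using ray_through[OF root_mem, of "\<lambda>_. True"] by metis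
  have "(\<lambda>n. g (r n)) = (\<lambda>_. g root)" using const ray_mem[OF r] by auto
  then have "g root = 0" using lim[OF r] by (simp add: tendsto_const_iff)
  then show ?thesis using const[of v "lev v"] v by (simp add: level_def)
qed

text \<open>The number of steps back to the root drives the recursion, because levels are known to
  decrease under \<open>par\<close> only on V.\<close>

primrec relax_aux :: "real \<Rightarrow> ('v \<Rightarrow> real) \<Rightarrow> nat \<Rightarrow> 'v \<Rightarrow> real" where
  "relax_aux \<theta> F 0 v = F v"
| "relax_aux \<theta> F (Suc n) v = \<theta> * relax_aux \<theta> F n (par v) + (1 - \<theta>) * F v"

text \<open>The harmonic extension of a martingale \<open>F\<close> of averages: it lags behind \<open>F\<close> by exponential
  smoothing along every ray.\<close>

definition relax :: "real \<Rightarrow> ('v \<Rightarrow> real) \<Rightarrow> 'v \<Rightarrow> real" where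
  "relax \<theta> F v = relax_aux \<theta> F (lev v) v"

lemma relax_root: "relax \<theta> F root = F root"
  by (simp add: relax_def lev_root)

lemma relax_child: "w \<in> children v \<Longrightarrow> relax \<theta> F w = \<theta> * relax \<theta> F v + (1 - \<theta>) * F w"
  by (simp add: relax_def childrenD)

text \<open>The lag of the extension behind F is proportional to its last increment. This converts
  the flux to the children into the flux from the parent.\<close>

lemma relax_par:
  assumes "v \<in> V" "v \<noteq> root"
  shows "(1 - \<theta>) * (F v - relax \<theta> F v) = \<theta> * (relax \<theta> F v - relax \<theta> F (par v))"
proof -
  obtain n where n: "lev v = Suc n" using assms lev_eq_0_iff[of v] by (cases "lev v") auto
  show ?thesis using relax_child[OF child_of_par[OF assms(1) n], of \<theta> F] by (simp add: algebra_simps)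
qed

lemma balanced_relax:
  assumes "martingale F" shows "balanced (real p * \<theta>) (relax \<theta> F)"
  unfolding balanced_def
proof
  fix v assume v: "v \<in> V"
  have "(\<Sum>w\<in>children v. relax \<theta> F w - relax \<theta> F v) =
      (\<Sum>w\<in>children v. (1 - \<theta>) * F w - (1 - \<theta>) * relax \<theta> F v)"
    by (intro sum.cong refl) (simp add: relax_child algebra_simps)
  also have "\<dots> = real (card (children v)) * ((1 - \<theta>) * (F v - relax \<theta> F v))"
    using assms v unfolding sum_subtractf sum_distrib_left[symmetric]
    by (simp add: martingale_def algebra_simps)
  also have "\<dots> = (if v = root then 0 else real p * \<theta> * (relax \<theta> F v - relax \<theta> F (par v)))"
    using relax_par[OF v, of \<theta> F] v by (auto simp: relax_root card_children')
  finally show "(\<Sum>w\<in>children v. relax \<theta> F w - relax \<theta> F v) =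
      (if v = root then 0 else real p * \<theta> * (relax \<theta> F v - relax \<theta> F (par v)))" .
qed

lemma relax_tendsto:
  assumes r: "r \<in> rays" and F: "\<And>n. N \<le> n \<Longrightarrow> F (r n) = c" and \<theta>: "0 < \<theta>" "\<theta> < 1"
  shows "(\<lambda>n. relax \<theta> F (r n)) \<longlonglongrightarrow> c"
proof -
  have eq: "relax \<theta> F (r (N + k)) = c + \<theta> ^ k * (relax \<theta> F (r N) - c)" for k
  proof (induction k)
    case (Suc k)
    have "r (Suc (N + k)) \<in> children (r (N + k))" using r by (simp add: rays_def)
    then have "relax \<theta> F (r (N + Suc k)) = \<theta> * relax \<theta> F (r (N + k)) + (1 - \<theta>) * c"
      using F[of "Suc (N + k)"] by (simp add: relax_child)
    then show ?case unfolding Suc by (simp add: algebra_simps)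
  qed simp
  have "(\<lambda>k. c + \<theta> ^ k * (relax \<theta> F (r N) - c)) \<longlonglongrightarrow> c + 0 * (relax \<theta> F (r N) - c)"
    using \<theta> by (intro tendsto_intros LIMSEQ_realpow_zero) auto
  then have "(\<lambda>k. relax \<theta> F (r (k + N))) \<longlonglongrightarrow> c" by (simp add: eq[symmetric] add.commute)
  then show ?thesis by (rule LIMSEQ_offset)
qed

section \<open>Energy of the extension, level by level\<close>

definition level_energy :: "('v \<Rightarrow> real) \<Rightarrow> nat \<Rightarrow> real" where
  "level_energy g n = (if n = 0 then 0 else (\<Sum>v\<in>level n. (g v - g (par v))\<^sup>2))"

definition square_mean :: "('v \<Rightarrow> real) \<Rightarrow> nat \<Rightarrow> real" where
  "square_mean F n = level_integral n (\<lambda>v. (F v)\<^sup>2)"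

text \<open>The increment to a child w is (1 - \<open>\<theta>\<close>) (F w - F v) plus
  \<open>\<theta>\<close> times the increment arriving at v. The first part has mean 0 over the
  siblings, so the cross term drops out, and its squares sum to the martingale variance.\<close>

lemma level_energy_relax_Suc:
  assumes F: "martingale F"
  shows "mass (Suc n) * level_energy (relax \<theta> F) (Suc n) =
    (1 - \<theta>)\<^sup>2 * (square_mean F (Suc n) - square_mean F n) + \<theta>\<^sup>2 * (mass n * level_energy (relax \<theta> F) n)"
proof -
  let ?g = "relax \<theta> F"
  define D where "D v = (if v = root then 0 else ?g v - ?g (par v))" for v
  have child: "(\<Sum>w\<in>children v. (?g w - ?g v)\<^sup>2) = (1 - \<theta>)\<^sup>2 * ((\<Sum>w\<in>children v. (F w)\<^sup>2) -
      real (card (children v)) * (F v)\<^sup>2) + real (card (children v)) * (\<theta>\<^sup>2 * (D v)\<^sup>2)" if v: "v \<in> V" for v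
  proof -
    have D: "(1 - \<theta>) * (F v - ?g v) = \<theta> * D v"
      using relax_par[OF v, of \<theta> F] by (auto simp: D_def relax_root)
    have "?g w - ?g v = (1 - \<theta>) * (F w - F v) + \<theta> * D v" if "w \<in> children v" for w
      unfolding D[symmetric] using that by (simp add: relax_child algebra_simps)
    then have "(\<Sum>w\<in>children v. (?g w - ?g v)\<^sup>2) = (\<Sum>w\<in>children v. ((1 - \<theta>) * (F w - F v) + \<theta> * D v)\<^sup>2)"
      by simp
    also have "\<dots> =
        (\<Sum>w\<in>children v. (1 - \<theta>)\<^sup>2 * (F w)\<^sup>2 + 2 * (1 - \<theta>) * (\<theta> * D v - (1 - \<theta>) * F v) * F w
          + (\<theta> * D v - (1 - \<theta>) * F v)\<^sup>2)"
      by (intro sum.cong refl) (simp add: power2_eq_square algebra_simps)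
    also have "\<dots> = (1 - \<theta>)\<^sup>2 * (\<Sum>w\<in>children v. (F w)\<^sup>2)
          + 2 * (1 - \<theta>) * (\<theta> * D v - (1 - \<theta>) * F v) * (\<Sum>w\<in>children v. F w)
          + real (card (children v)) * (\<theta> * D v - (1 - \<theta>) * F v)\<^sup>2"
      by (simp add: sum.distrib sum_distrib_left)
    also have "(\<Sum>w\<in>children v. F w) = real (card (children v)) * F v" using F v by (simp add: martingale_def)
    finally show ?thesis by (simp add: power2_eq_square algebra_simps)
  qed
  have E: "level_energy ?g n = (\<Sum>v\<in>level n. (D v)\<^sup>2)"
  proof (cases "n = 0")
    case False
    then have "v \<noteq> root" if "v \<in> level n" for v using that lev_root by (auto simp: level_def)
    then show ?thesis using False by (auto simp: level_energy_def D_def intro!: sum.cong)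
  qed (simp add: level_energy_def D_def level_0)
  have "mass (Suc n) * level_energy ?g (Suc n) =
      (\<Sum>v\<in>level n. mass (Suc n) * (\<Sum>w\<in>children v. (?g w - ?g (par w))\<^sup>2))"
    by (simp add: level_energy_def sum_level_Suc sum_distrib_left)
  also have "\<dots> = (\<Sum>v\<in>level n. (1 - \<theta>)\<^sup>2 * (mass (Suc n) * (\<Sum>w\<in>children v. (F w)\<^sup>2)) -
      (1 - \<theta>)\<^sup>2 * (mass n * (F v)\<^sup>2) + \<theta>\<^sup>2 * (mass n * (D v)\<^sup>2))"
  proof (rule sum.cong[OF refl])
    fix v assume "v \<in> level n"
    then have v: "v \<in> V" "lev v = n" by (auto simp: level_def)
    have "(\<Sum>w\<in>children v. (?g w - ?g (par w))\<^sup>2) = (\<Sum>w\<in>children v. (?g w - ?g v)\<^sup>2)"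
      by (intro sum.cong) (auto simp: childrenD)
    note eq = this[unfolded child[OF v(1)]]
    have mn: "mass n = mass (Suc n) * real (card (children v))" using mass_children[OF v(1)] v(2) by simp
    then show "mass (Suc n) * (\<Sum>w\<in>children v. (?g w - ?g (par w))\<^sup>2) =
      (1 - \<theta>)\<^sup>2 * (mass (Suc n) * (\<Sum>w\<in>children v. (F w)\<^sup>2)) -
      (1 - \<theta>)\<^sup>2 * (mass n * (F v)\<^sup>2) + \<theta>\<^sup>2 * (mass n * (D v)\<^sup>2)"
      unfolding eq mn by (simp add: algebra_simps)
  qed
  also have "\<dots> = (1 - \<theta>)\<^sup>2 * (square_mean F (Suc n) - square_mean F n) + \<theta>\<^sup>2 * (mass n * level_energy ?g n)"
    by (simp add: square_mean_def level_integral_def sum_level_Suc E sum.distrib sum_subtractf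
        sum_distrib_left right_diff_distrib)
  finally show ?thesis .
qed

lemma square_mean_Suc:
  assumes F: "martingale F" and N: "\<And>v. v \<in> V \<Longrightarrow> lev v = Suc n \<Longrightarrow> F v = F (par v)"
  shows "square_mean F (Suc n) = square_mean F n"
proof -
  have "square_mean F (Suc n) = level_integral (Suc n) (\<lambda>w. F w * F (par w))"
    unfolding square_mean_def level_integral_def using N
    by (intro arg_cong2[of _ _ _ _ "(*)"] sum.cong refl) (auto simp: level_def power2_eq_square)
  then show ?thesis using level_integral_Suc[OF F, of n F] by (simp add: square_mean_def power2_eq_square)
qed

text \<open>Beyond N the sequence y is geometric, hence summable. Summing the recurrence gives t =
  (sum of z) + \<open>\<theta>\<close> t for the total t of y.\<close>

lemma sums_linear_recurrence:
  fixes y z :: "nat \<Rightarrow> real"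
  assumes y0: "y 0 = 0" and rec: "\<And>n. y (Suc n) = z (Suc n) + \<theta> * y n"
    and z: "\<And>n. N < n \<Longrightarrow> z n = 0" and \<theta>: "0 < \<theta>" "\<theta> < 1"
  shows "y sums ((\<Sum>n=1..N. z n) / (1 - \<theta>))"
proof -
  have "y (k + N) = \<theta> ^ k * y N" for k
    by (induction k) (simp_all add: rec z)
  moreover have "summable (\<lambda>k. \<theta> ^ k * y N)" using \<theta> by (intro summable_mult2 summable_geometric) auto
  ultimately have "summable (\<lambda>k. y (k + N))" by simp
  then have sy: "summable y" by (simp only: summable_iff_shift)
  have zs: "(\<lambda>n. z (Suc n)) sums (\<Sum>n<N. z (Suc n))"
    using z by (intro sums_finite) auto
  have "(\<Sum>n<N. z (Suc n)) = (\<Sum>n=1..N. z n)"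
    by (rule sum.reindex_bij_witness[of _ "\<lambda>n. n - 1" Suc]) auto
  moreover have "suminf y = (\<Sum>n. y (Suc n))" using suminf_split_head[OF sy] y0 by simp
  moreover have "(\<Sum>n. y (Suc n)) = (\<Sum>n<N. z (Suc n)) + \<theta> * suminf y"
    unfolding rec using suminf_add[OF sums_summable[OF zs] summable_mult[OF sy, of \<theta>]] sums_unique[OF zs]
      suminf_mult[OF sy, of \<theta>] by simp
  ultimately have "suminf y = (\<Sum>n=1..N. z n) / (1 - \<theta>)" using \<theta> by (simp add: field_simps)
  then show ?thesis using summable_sums[OF sy] by simp
qed

text \<open>Dividing by \<open>\<theta>\<close>^n is dictated by the edge weights, since
  \<open>mass n\<close> / \<open>\<theta>\<close>^n = (p \<open>\<theta>\<close>)^(-n) for n > 0. It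
  reduces the factor \<open>\<theta>\<close>^2 of the energy recurrence to \<open>\<theta>\<close>,
  and one factor 1 - \<open>\<theta>\<close> cancels in the sum.\<close>

lemma relax_energy_sums:
  assumes F: "martingale F" and N: "\<And>v n. v \<in> V \<Longrightarrow> lev v = Suc n \<Longrightarrow> N \<le> n \<Longrightarrow> F v = F (par v)"
    and \<theta>: "0 < \<theta>" "\<theta> < 1"
  shows "(\<lambda>n. mass n * level_energy (relax \<theta> F) n / \<theta> ^ n) sums
    ((1 - \<theta>) * (\<Sum>n=1..N. (square_mean F n - square_mean F (n - 1)) / \<theta> ^ n))"
proof -
  define z where "z n = (1 - \<theta>)\<^sup>2 * (square_mean F n - square_mean F (n - 1)) / \<theta> ^ n" for n
  have "(\<lambda>n. mass n * level_energy (relax \<theta> F) n / \<theta> ^ n) sums ((\<Sum>n=1..N. z n) / (1 - \<theta>))"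
  proof (rule sums_linear_recurrence[OF _ _ _ \<theta>])
    show "mass (Suc n) * level_energy (relax \<theta> F) (Suc n) / \<theta> ^ Suc n =
        z (Suc n) + \<theta> * (mass n * level_energy (relax \<theta> F) n / \<theta> ^ n)" for n
      unfolding level_energy_relax_Suc[OF F] z_def using \<theta> by (simp add: field_simps power2_eq_square)
    show "z n = 0" if n: "N < n" for n
    proof -
      obtain m where m: "n = Suc m" "N \<le> m" using n by (cases n) auto
      then have "square_mean F n = square_mean F m" using square_mean_Suc[OF F] N by blast
      then show ?thesis by (simp add: z_def m)
    qed
  qed (simp add: level_energy_def)
  moreover have "(\<Sum>n=1..N. z n) = (1 - \<theta>)\<^sup>2 * (\<Sum>n=1..N. (square_mean F n - square_mean F (n - 1)) / \<theta> ^ n)"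
    unfolding z_def sum_distrib_left by simp
  ultimately show ?thesis using \<theta> by (simp add: power2_eq_square)
qed

lemma has_sum_levels:
  fixes t :: "'v \<Rightarrow> real"
  assumes nonneg: "\<And>v. v \<in> V \<Longrightarrow> 0 \<le> t v" and S: "(\<lambda>n. \<Sum>v\<in>level n. t v) sums S"
  shows "(t has_sum S) V"
proof -
  have lev: "((\<lambda>v. t (snd (n, v))) has_sum (\<Sum>v\<in>level n. t v)) (level n)" for n
    using finite_level by simp
  have g: "((\<lambda>n. \<Sum>v\<in>level n. t v) has_sum S) UNIV"
    using S by (rule sums_nonneg_imp_has_sum) (auto simp: level_def intro!: sum_nonneg nonneg)
  have "((\<lambda>x. t (snd x)) has_sum S) (SIGMA n:UNIV. level n)"
    using lev g
  proof (rule has_sum_SigmaI)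
    show "(\<lambda>x. t (snd x)) summable_on (SIGMA n:UNIV. level n)"
      using lev has_sum_imp_summable[OF g] by (rule summable_on_SigmaI) (auto simp: level_def nonneg)
  qed
  moreover have "bij_betw snd (SIGMA n:UNIV. level n) V"
    by (auto simp: bij_betw_def inj_on_def level_def image_iff)
  ultimately show ?thesis by (simp add: has_sum_reindex_bij_betw[of snd])
qed

end

subsection \<open>The Bruhat--Tits tree is a leveled tree\<close>

lemma ray_mono:
  fixes x :: "'p::prime_card padic"
  assumes "ray x n = ray y n" "m \<le> n" shows "ray x m = ray y m"
  using assms inverse_power_mono_card[of n m, where 'p='p] unfolding ray_eq_iff by linarith

text \<open>Every edge changes the level by one, so a walk of m edges from the base vertex ends at a
  level \<open>\<le>\<close> m; the ray itself attains the bound.\<close>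

lemma bt_dist_ray: "bt_dist bt_base (ray x n) = n" for x :: "'p::prime_card padic"
proof -
  let ?R = "{(v, w). bt_adj v w}"
  have reach: "(bt_base, ray x n) \<in> ?R ^^ n"
  proof (induction n)
    case 0
    then show ?case using bt_base_eq_ray[of x] by simp
  next
    case (Suc n)
    then show ?case by (rule relpow_Suc_I) (simp add: bt_adj_ray_iff)
  qed
  have lower: "\<exists>y k. v = ray y k \<and> k \<le> m" if "(bt_base, v) \<in> ?R ^^ m" for v :: "'p bt_vertex" and m
    using that
  proof (induction m arbitrary: v)
    case 0
    then have "v = ray x 0" using bt_base_eq_ray[of x] by simp
    then show ?case by blast
  next
    case (Suc m)
    then obtain w where w: "(bt_base, w) \<in> ?R ^^ m" "bt_adj w v" by (auto elim: relpow_Suc_E)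
    then obtain y k where y: "w = ray y k" "k \<le> m" using Suc.IH by blast
    obtain z l where z: "v = ray z l" using w(2) vertex_eq_ray unfolding bt_adj_def by blast
    have "l = Suc k \<or> k = Suc l" using w(2) unfolding y z bt_adj_ray_iff by blast
    then show ?case using y z by (intro exI[of _ z] exI[of _ l]) auto
  qed
  show ?thesis unfolding bt_dist_def
  proof (rule Least_equality)
    fix m assume "(bt_base, ray x n) \<in> ?R ^^ m"
    then obtain y k where "ray x n = ray y k" "k \<le> m" using lower by blast
    then show "n \<le> m" unfolding ray_eq_iff by simp
  qed (rule reach)
qed

text \<open>Any point x whose ray passes through v may be used, by \<open>bt_parent_ray\<close>. At
  the base vertex the truncated subtraction returns the base vertex itself.\<close>

definition bt_parent :: "'p::prime_card bt_vertex \<Rightarrow> 'p bt_vertex" where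
  "bt_parent v = ray (SOME x. v = ray x (bt_dist bt_base v)) (bt_dist bt_base v - 1)"

lemma vertex_ray_dist:
  assumes "v \<in> bt_vertices" obtains x where "v = ray x (bt_dist bt_base v)"
  using vertex_eq_ray[OF assms] bt_dist_ray by metis

lemma bt_parent_ray: "bt_parent (ray x (Suc n)) = ray x n"
proof -
  have "ray x (Suc n) = ray (SOME y. ray x (Suc n) = ray y (Suc n)) (Suc n)" by (rule someI) (rule refl)
  from ray_mono[OF this, of n] show ?thesis unfolding bt_parent_def bt_dist_ray by simp
qed

lemma bt_adj_iff:
  "bt_adj v w \<longleftrightarrow> v \<in> bt_vertices \<and> w \<in> bt_vertices \<and>
    (bt_dist bt_base w = Suc (bt_dist bt_base v) \<and> bt_parent w = v \<or>
     bt_dist bt_base v = Suc (bt_dist bt_base w) \<and> bt_parent v = w)"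
proof (cases "v \<in> bt_vertices \<and> w \<in> bt_vertices")
  case True
  obtain x n where v: "v = ray x n" by (rule vertex_eq_ray[of v]) (use True in auto)
  obtain y m where w: "w = ray y m" by (rule vertex_eq_ray[of w]) (use True in auto)
  show ?thesis unfolding v w bt_adj_ray_iff bt_dist_ray
    by (cases "m = Suc n"; cases "n = Suc m"; simp add: bt_parent_ray)
qed (auto simp: bt_adj_def)

section \<open>The chordal distance in coordinates and the masses of balls\<close>

lemma pmax_diff:
  assumes "pmax x \<noteq> pmax y" shows "padic_abs (x - y) = max (pmax x) (pmax y)"
proof -
  have "padic_abs x \<noteq> padic_abs y" using assms by (auto simp: pmax_def)
  then show ?thesis using assms unfolding pmax_def by (subst padic_abs_diff_eq_max) (auto simp: max_def split: if_splits)
qed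

lemma chord_eq: "chord x y = padic_abs (x - y) / (pmax x * pmax y)"
proof -
  have ints: "z \<noteq> 0" "pmax z = padic_abs z" if "z \<notin> padic_ints" for z :: "'a padic"
    using that padic_ints_0 by (auto simp: padic_ints_def pmax_def)
  have ints': "pmax z = 1" if "z \<in> padic_ints" for z :: "'a padic"
    using that by (auto simp: padic_ints_def pmax_def)
  show ?thesis
  proof (cases "x \<in> padic_ints"; cases "y \<in> padic_ints")
    assume x: "x \<in> padic_ints" and y: "y \<in> padic_ints"
    then show ?thesis by (simp add: chord_def det2_def prim_def ints')
  next
    assume x: "x \<in> padic_ints" and y: "y \<notin> padic_ints"
    have "det2 (prim x) (prim y) = (x - y) / y" using x y ints(1)[OF y] by (simp add: det2_def prim_def field_simps)
    then show ?thesis using x y by (simp add: chord_def padic_abs_divide ints ints')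
  next
    assume x: "x \<notin> padic_ints" and y: "y \<in> padic_ints"
    have "det2 (prim x) (prim y) = (x - y) / x" using x y ints(1)[OF x] by (simp add: det2_def prim_def field_simps)
    then show ?thesis using x y by (simp add: chord_def padic_abs_divide ints ints')
  next
    assume x: "x \<notin> padic_ints" and y: "y \<notin> padic_ints"
    have "det2 (prim x) (prim y) = (x - y) / (x * y)"
      using x y ints(1)[OF x] ints(1)[OF y] by (simp add: det2_def prim_def field_simps)
    then show ?thesis using x y by (simp add: chord_def padic_abs_divide padic_abs_mult ints)
  qed
qed

lemma chord_self: "chord x x = 0"
  by (simp add: chord_eq)

text \<open>If \<open>pmax x\<close> and \<open>pmax y\<close> differ, the absolute value of x - y
  is the larger of them, so the chordal distance is the inverse of the smaller.\<close>

lemma chord_less_imp_pmax_eq: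
  assumes "chord x y * min (pmax x) (pmax y) < 1" shows "pmax x = pmax y"
proof (rule ccontr)
  assume ne: "pmax x \<noteq> pmax y"
  have "max (pmax x) (pmax y) * min (pmax x) (pmax y) = pmax x * pmax y" by (simp add: max_def min_def)
  then have "chord x y * min (pmax x) (pmax y) = 1"
    unfolding chord_eq pmax_diff[OF ne] using pmax_pos[of x] pmax_pos[of y] by simp
  then show False using assms by simp
qed

text \<open>The same numbers as \<open>mass\<close>, available outside the tree locale: the count of
  children, an assumption of that locale, is itself derived from these masses.\<close>

definition bmass :: "real \<Rightarrow> nat \<Rightarrow> real" where
  "bmass P n = (if n = 0 then 1 + 1 / P else 1 / P ^ n)"

text \<open>This is the mass of the ball around infinity at level n. Each level set contributes the
  difference of the masses of two consecutive such balls, so the series telescopes.\<close>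

lemma has_integral_plev_ge:
  assumes M: "is_padic_haar_measure (M :: 'p::prime_card padic measure)"
  shows "has_bochner_integral M (\<lambda>z. if n \<le> plev z then 1 / (pmax z)\<^sup>2 else 0) (bmass (real CARD('p)) n)"
proof -
  let ?P = "real CARD('p)"
  have P: "?P > 1" by (rule prime_card_gt_1)
  define c where "c m = (if n \<le> m then 1 / (?P ^ m)\<^sup>2 else 0)" for m
  \<comment> \<open>Freezing the index at n makes the differences vanish for m < n, where c is
    0.\<close>
  define t where "t m = bmass ?P (max m n)" for m
  have ct: "c m * pvol ?P m = t m - t (Suc m)" for m
  proof (cases "n \<le> m")
    case True
    then have "max m n = m" "max (Suc m) n = Suc m" by auto
    moreover have "1 / (?P ^ m)\<^sup>2 * pvol ?P m = bmass ?P m - bmass ?P (Suc m)"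
    proof (cases m)
      case (Suc k)
      then show ?thesis using P by (simp add: pvol_def bmass_def field_simps power2_eq_square)
    qed (simp add: pvol_def bmass_def)
    ultimately show ?thesis using True by (simp add: c_def t_def)
  next
    case False
    then have "max m n = max (Suc m) n" by auto
    then show ?thesis using False by (simp add: c_def t_def)
  qed
  have t: "t \<longlonglongrightarrow> 0"
  proof (rule Lim_transform_eventually)
    show "(\<lambda>m. (1 / ?P) ^ m) \<longlonglongrightarrow> 0" using P by (intro LIMSEQ_realpow_zero) auto
    show "\<forall>\<^sub>F m in sequentially. (1 / ?P) ^ m = t m"
      unfolding eventually_sequentially
      by (intro exI[of _ "Suc n"] allI impI) (auto simp: t_def bmass_def max_def power_one_over)
  qed
  have S: "(\<lambda>m. c m * pvol ?P m) sums bmass ?P n"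
    using telescope_sums'[OF t] unfolding ct by (simp add: t_def)
  have "\<bar>c m\<bar> = c m" for m by (simp add: c_def)
  then have "summable (\<lambda>m. \<bar>c m\<bar> * pvol ?P m)" using sums_summable[OF S] by simp
  from has_integral_plev[OF M this S] show ?thesis
    unfolding c_def pmax_eq .
qed

text \<open>There are two kinds of balls. For n \<open>\<le>\<close> \<open>plev y\<close> the ball
  contains infinity and its finite points are the z with n \<open>\<le>\<close>
  \<open>plev z\<close>; otherwise it is an ordinary p-adic ball around y on which
  \<open>pmax\<close> is constant.\<close>

lemma has_integral_ray_ball:
  assumes M: "is_padic_haar_measure (M :: 'p::prime_card padic measure)"
  shows "has_bochner_integral M (\<lambda>z. (if ray z n = ray y n then 1 else 0) / (pmax z)\<^sup>2) (bmass (real CARD('p)) n)"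
proof (cases "plev y < n")
  case False
  let ?P = "real CARD('p)"
  have P: "?P > 1" by (rule prime_card_gt_1)
  have "ray z n = ray y n \<longleftrightarrow> n \<le> plev z" for z
  proof
    assume "ray z n = ray y n"
    then have c: "chord z y \<le> 1 / ?P ^ n" by (simp add: ray_eq_iff)
    show "n \<le> plev z"
    proof (rule ccontr)
      assume "\<not> n \<le> plev z"
      then have z: "plev z < n" by simp
      then have zP: "pmax z < ?P ^ n" unfolding pmax_eq using P by (intro power_strict_increasing) auto
      have "chord z y * min (pmax z) (pmax y) \<le> 1 / ?P ^ n * pmax z"
        using c pmax_pos[of z] pmax_pos[of y] by (intro mult_mono) (auto simp: chord_def)
      also have "\<dots> < 1" using zP P by (simp add: field_simps)
      finally have "pmax z = pmax y" by (rule chord_less_imp_pmax_eq)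
      then have "plev z = plev y" using plev_eq_iff[of z "plev y"] pmax_eq[of y] by simp
      then show False using False z by simp
    qed
  next
    assume z: "n \<le> plev z"
    have zP: "?P ^ n \<le> pmax z" "?P ^ n \<le> pmax y"
      unfolding pmax_eq using P z False by (auto intro!: power_increasing)
    have "padic_abs (z - y) \<le> max (pmax z) (pmax y)"
      by (intro order.trans[OF padic_abs_diff_le]) (auto simp: pmax_def)
    then have "padic_abs (z - y) * ?P ^ n \<le> max (pmax z) (pmax y) * min (pmax z) (pmax y)"
      using zP pmax_pos[of z] P by (intro mult_mono) (auto simp: le_max_iff_disj)
    also have "max (pmax z) (pmax y) * min (pmax z) (pmax y) = pmax z * pmax y"
      by (simp add: max_def min_def)
    finally have "padic_abs (z - y) * ?P ^ n \<le> pmax z * pmax y" .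
    then have "chord z y \<le> 1 / ?P ^ n"
      unfolding chord_eq using P pmax_pos[of z] pmax_pos[of y] by (simp add: field_simps)
    then show "ray z n = ray y n" by (simp add: ray_eq_iff)
  qed
  then have "(\<lambda>z. (if ray z n = ray y n then 1 else 0) / (pmax z)\<^sup>2) =
      (\<lambda>z. if n \<le> plev z then 1 / (pmax z)\<^sup>2 else 0)" by auto
  then show ?thesis using has_integral_plev_ge[OF M] by simp
next
  case True
  let ?P = "real CARD('p)"
  have P: "?P > 1" by (rule prime_card_gt_1)
  \<comment> \<open>Once \<open>pmax z = pmax y\<close>, chordal distance at most p^(-n) means that
    z - y has absolute value at most p^(2 \<open>plev y\<close>) / p^n; k is the exponent of this
    radius.\<close>
  define k where "k = 2 * int (plev y) - int n"
  have yn: "pmax y < ?P ^ n" unfolding pmax_eq using P True by (intro power_strict_increasing) auto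
  have Pk: "?P powi k = (pmax y)\<^sup>2 / ?P ^ n"
    unfolding k_def pmax_eq using P by (simp add: power_int_diff power_int_mult) (simp add: mult.commute flip: power_mult)
  have ball: "ray z n = ray y n \<longleftrightarrow> z \<in> pball y k" and pm: "z \<in> pball y k \<Longrightarrow> pmax z = pmax y" for z
  proof -
    have eq: "ray z n = ray y n \<longleftrightarrow> padic_abs (z - y) \<le> pmax z * pmax y / ?P ^ n"
      unfolding ray_eq_iff chord_eq using pmax_pos[of z] pmax_pos[of y] P by (simp add: field_simps)
    have 1: "pmax z = pmax y" if r: "ray z n = ray y n"
    proof (rule chord_less_imp_pmax_eq)
      have "chord z y \<le> 1 / ?P ^ n" using r by (simp add: ray_eq_iff)
      then have "chord z y * min (pmax z) (pmax y) \<le> 1 / ?P ^ n * pmax y"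
        using pmax_pos[of z] pmax_pos[of y] by (intro mult_mono) (auto simp: chord_def)
      also have "\<dots> < 1" using yn P by (simp add: field_simps)
      finally show "chord z y * min (pmax z) (pmax y) < 1" .
    qed
    show 2: "pmax z = pmax y" if z: "z \<in> pball y k"
    proof (rule ccontr)
      assume "pmax z \<noteq> pmax y"
      then have "pmax y \<le> padic_abs (z - y)" by (simp add: pmax_diff)
      also have "\<dots> \<le> (pmax y)\<^sup>2 / ?P ^ n" using z Pk by (simp add: pball_def)
      also have "\<dots> < pmax y" using yn pmax_pos[of y] P by (simp add: power2_eq_square field_simps)
      finally show False by simp
    qed
    show "ray z n = ray y n \<longleftrightarrow> z \<in> pball y k"
      using 1 2 eq by (auto simp: pball_def Pk power2_eq_square)
  qed
  have sM: "sets M = sets borel" using M by (simp add: is_padic_haar_measure_def)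
  have spM: "space M = UNIV" using sets_eq_imp_space_eq[OF sM] by simp
  have eq: "(\<lambda>z. (if ray z n = ray y n then 1 else 0) / (pmax z)\<^sup>2) =
      (\<lambda>z. indicator (pball y k) z / (pmax y)\<^sup>2)"
    using pm unfolding ball by (auto simp: fun_eq_iff indicator_def)
  have "has_bochner_integral M (indicator (pball y k)) (measure M (pball y k))"
    using sM by (intro has_bochner_integral_real_indicator) (auto simp: emeasure_pball[OF M])
  then have "has_bochner_integral M (\<lambda>z. indicator (pball y k) z / (pmax y)\<^sup>2) (measure M (pball y k) / (pmax y)\<^sup>2)"
    by (rule has_bochner_integral_divide_zero)
  moreover have "measure M (pball y k) / (pmax y)\<^sup>2 = bmass ?P n"
    using pmax_pos[of y] True by (simp add: measure_pball[OF M] Pk bmass_def)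
  ultimately show ?thesis unfolding eq by simp
qed

definition bt_children :: "'p::prime_card bt_vertex \<Rightarrow> 'p bt_vertex set" where
  "bt_children v = {w \<in> bt_vertices. bt_dist bt_base w = Suc (bt_dist bt_base v) \<and> bt_parent w = v}"

text \<open>The children are counted by comparing the \<open>\<mu>\<^sub>0\<close>-masses of the balls, pulled back to the
  p-adic numbers.\<close>

lemma card_bt_children:
  fixes v :: "'p::prime_card bt_vertex"
  assumes M: "is_padic_haar_measure (M :: 'p padic measure)" and v: "v \<in> bt_vertices"
  shows "card (bt_children v) = (if v = bt_base then Suc CARD('p) else CARD('p))"
proof -
  let ?P = "real CARD('p)"
  have P: "?P > 1" by (rule prime_card_gt_1)
  obtain y n where y: "v = ray y n" using vertex_eq_ray[OF v] .
  have m0: "bmass ?P (Suc n) > 0" using P by (simp add: bmass_def)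
  have child: "\<exists>x. w = ray x (Suc n) \<and> ray x n = ray y n" if w: "w \<in> bt_children v" for w
  proof -
    obtain x where "w = ray x (Suc n)"
      using w vertex_ray_dist[of w] unfolding bt_children_def y bt_dist_ray by auto
    then show ?thesis using w unfolding bt_children_def y by (auto simp: bt_parent_ray)
  qed
  have ch_iff: "ray z (Suc n) \<in> bt_children v \<longleftrightarrow> ray z n = ray y n" for z
    unfolding bt_children_def y by (simp add: bt_dist_ray bt_parent_ray)
  let ?f = "\<lambda>J z. (if ray z (Suc n) \<in> J then 1 else 0) / (pmax z)\<^sup>2"
  have J: "has_bochner_integral M (?f J) (real (card J) * bmass ?P (Suc n))"
    if fin: "finite J" and sub: "J \<subseteq> bt_children v" for J
  proof -
    have "has_bochner_integral M (\<lambda>z. \<Sum>w\<in>J. (if ray z (Suc n) = w then 1 else 0) / (pmax z)\<^sup>2)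
        (\<Sum>w\<in>J. bmass ?P (Suc n))"
    proof (rule has_bochner_integral_sum)
      fix w assume "w \<in> J"
      then obtain x where "w = ray x (Suc n)" using child sub by blast
      then show "has_bochner_integral M (\<lambda>z. (if ray z (Suc n) = w then 1 else 0) / (pmax z)\<^sup>2) (bmass ?P (Suc n))"
        using has_integral_ray_ball[OF M, of "Suc n" x] by (simp)
    qed
    moreover have "(\<Sum>w\<in>J. (if ray z (Suc n) = w then 1 else 0) / (pmax z)\<^sup>2) = ?f J z" for z
      using fin by (simp add: sum.delta flip: sum_divide_distrib)
    ultimately show ?thesis by simp
  qed
  have V: "has_bochner_integral M (?f (bt_children v)) (bmass ?P n)"
    unfolding ch_iff by (rule has_integral_ray_ball[OF M])
  have bound: "real (card J) * bmass ?P (Suc n) \<le> bmass ?P n" if "finite J" "J \<subseteq> bt_children v" for J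
  proof -
    have "integral\<^sup>L M (?f J) \<le> integral\<^sup>L M (?f (bt_children v))"
      using J[OF that] V that(2) by (intro integral_mono divide_right_mono) (auto simp: has_bochner_integral_iff)
    then show ?thesis using J[OF that] V by (simp add: has_bochner_integral_iff)
  qed
  \<comment> \<open>The cardinality of an infinite set is 0 by convention, so finiteness comes from
    a uniform bound on the finite subsets before the masses are compared.\<close>
  have "finite (bt_children v)"
  proof (rule finite_if_finite_subsets_card_bdd[THEN conjunct1])
    fix J assume "J \<subseteq> bt_children v" "finite J"
    from bound[OF this(2,1)] m0 have "real (card J) \<le> bmass ?P n / bmass ?P (Suc n)" by (simp add: field_simps)
    then show "card J \<le> nat \<lfloor>bmass ?P n / bmass ?P (Suc n)\<rfloor>" by (simp add: le_nat_floor)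
  qed
  from has_bochner_integral_eq[OF J[OF this subset_refl] V]
  have c: "real (card (bt_children v)) * bmass ?P (Suc n) = bmass ?P n" .
  have "v = bt_base \<longleftrightarrow> n = 0" unfolding y bt_base_eq_ray[of y] by (simp add: ray_eq_iff chord_self)
  then have "real (card (bt_children v)) = real (if v = bt_base then Suc CARD('p) else CARD('p))"
    using c P by (auto simp: bmass_def field_simps split: if_splits)
  then show ?thesis by (simp only: of_nat_eq_iff)
qed

lemma bt_leveled_tree:
  assumes "is_padic_haar_measure (M :: 'p::prime_card padic measure)"
  shows "leveled_tree (bt_vertices :: 'p bt_vertex set) bt_base (bt_dist bt_base) bt_parent CARD('p)"
proof
  show "bt_base \<in> (bt_vertices :: 'p bt_vertex set)" by (subst bt_base_eq_ray) (rule ray_in_vertices)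
  show "1 < CARD('p)" using prime_card_gt_1[where 'p='p] by simp
  fix v :: "'p bt_vertex" assume v: "v \<in> bt_vertices"
  then obtain y n where y: "v = ray y n" using vertex_eq_ray by blast
  show "bt_dist bt_base v = 0 \<longleftrightarrow> v = bt_base"
    unfolding y bt_dist_ray unfolding bt_base_eq_ray[of y] by (simp add: ray_eq_iff chord_self)
  show "bt_parent v \<in> bt_vertices" by (simp add: bt_parent_def)
  show "bt_dist bt_base (bt_parent v) = m" if "bt_dist bt_base v = Suc m" for m
    using that unfolding bt_parent_def by (simp add: bt_dist_ray)
  show "card {w \<in> bt_vertices. bt_dist bt_base w = Suc (bt_dist bt_base v) \<and> bt_parent w = v} =
      (if v = bt_base then Suc CARD('p) else CARD('p))"
    using card_bt_children[OF assms v] unfolding bt_children_def .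
qed

subsection \<open>Integrals over the p-adic numbers as sums over the tree\<close>

locale padic_haar =
  fixes M :: "'p::prime_card padic measure"
  assumes haar: "is_padic_haar_measure M"
begin

sublocale leveled_tree "bt_vertices :: 'p bt_vertex set" bt_base "bt_dist bt_base" bt_parent "CARD('p)"
  by (rule bt_leveled_tree[OF haar])

lemma mass_eq_bmass: "mass n = bmass (real CARD('p)) n"
  by (simp add: mass_def bmass_def)

lemma ray_level: "ray x n \<in> level n" for x :: "'p padic"
  by (simp add: level_def bt_dist_ray)

lemma level_eq_ray:
  assumes "v \<in> level n" obtains x where "v = ray (x :: 'p padic) n"
  using assms vertex_ray_dist[of v] unfolding level_def by blast

lemma ray_in_rays: "ray x \<in> rays" for x :: "'p padic"
proof -
  have "ray x (Suc n) \<in> children (ray x n)" for n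
    by (simp add: children_def bt_dist_ray bt_parent_ray)
  then show ?thesis using bt_base_eq_ray[of x] by (simp add: rays_def)
qed

text \<open>The bridge between the two sides: with the density 1 / \<open>pmax\<close>^2 the Haar
  measure gives each ball of level n its \<open>\<mu>\<^sub>0\<close>-mass, so a function of the
  level n vertex integrates to a finite sum over the tree.\<close>

lemma has_integral_level:
  "has_bochner_integral M (\<lambda>z. h (ray z n) / (pmax z)\<^sup>2) (level_integral n h)"
proof -
  have "has_bochner_integral M (\<lambda>z. \<Sum>v\<in>level n. h v * ((if ray z n = v then 1 else 0) / (pmax z)\<^sup>2))
      (\<Sum>v\<in>level n. h v * mass n)"
  proof (intro has_bochner_integral_sum has_bochner_integral_mult_right)
    fix v :: "'p bt_vertex" assume "v \<in> level n"
    then obtain y where y: "v = ray y n" using level_eq_ray by blast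
    show "has_bochner_integral M (\<lambda>z. (if ray z n = v then 1 else 0) / (pmax z)\<^sup>2) (mass n)"
      unfolding y mass_eq_bmass by (rule has_integral_ray_ball[OF haar])
  qed
  moreover have "(\<Sum>v\<in>level n. h v * ((if ray z n = v then 1 else 0) / (pmax z)\<^sup>2)) = h (ray z n) / (pmax z)\<^sup>2"
    for z :: "'p padic"
  proof -
    have "(\<Sum>v\<in>level n. h v * ((if ray z n = v then 1 else 0) / (pmax z)\<^sup>2)) =
        (\<Sum>v\<in>level n. if ray z n = v then h v / (pmax z)\<^sup>2 else 0)"
      by (intro sum.cong) auto
    then show ?thesis using ray_level[of z n] by (simp add: sum.delta finite_level)
  qed
  ultimately show ?thesis by (simp add: level_integral_def sum_distrib_left mult.commute)
qed

end

subsection \<open>The Vladimirov derivative\<close>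

lemma boundary_factor_eq: "boundary_factor s x = pmax x powr (s - 1)"
  by (auto simp: boundary_factor_def pmax_def padic_ints_def)

lemma factor_kernel_partial_sum:
  fixes P \<theta> :: real
  assumes P: "P > 1" and \<theta>: "0 < \<theta>" "\<theta> < 1" and k: "k \<le> n"
  shows "(\<Sum>m\<le>k. ((1 / (P * \<theta>)) ^ n - (1 / (P * \<theta>)) ^ m) * pvol P m) =
    (1 / (P * \<theta>)) ^ n * P ^ k - 1 - (1 - 1 / P) * (1 / \<theta> ^ k - 1) / (1 - \<theta>)"
proof -
  have "(\<Sum>m\<le>k. (B - (1 / (P * \<theta>)) ^ m) * pvol P m) = B * P ^ k - 1 - (1 - 1 / P) * (1 / \<theta> ^ k - 1) / (1 - \<theta>)" for B
  proof (induction k)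
    case 0
    then show ?case by (simp add: pvol_def)
  next
    case (Suc k)
    have b: "(1 / (P * \<theta>)) ^ Suc k * (P ^ Suc k - P ^ k) = (1 - 1 / P) * (1 / \<theta> ^ Suc k)"
      using P \<theta> by (simp add: power_divide power_mult_distrib field_simps)
    have g: "(1 / \<theta> ^ Suc k - 1) / (1 - \<theta>) = (1 / \<theta> ^ k - 1) / (1 - \<theta>) + 1 / \<theta> ^ Suc k"
      using \<theta> by (simp add: field_simps)
    have "(\<Sum>m\<le>Suc k. (B - (1 / (P * \<theta>)) ^ m) * pvol P m) =
        B * P ^ k - 1 - (1 - 1 / P) * (1 / \<theta> ^ k - 1) / (1 - \<theta>) + B * (P ^ Suc k - P ^ k)
          - (1 / (P * \<theta>)) ^ Suc k * (P ^ Suc k - P ^ k)"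
    proof -
      have "pvol P (Suc k) = P ^ Suc k - P ^ k" by (simp add: pvol_def)
      then show ?thesis unfolding sum.atMost_Suc Suc.IH by (simp only: left_diff_distrib)
    qed
    also have "\<dots> = B * P ^ Suc k - 1 - (1 - 1 / P) * ((1 / \<theta> ^ k - 1) / (1 - \<theta>) + 1 / \<theta> ^ Suc k)"
      unfolding b by (simp add: algebra_simps)
    finally show ?case unfolding g[symmetric] by simp
  qed
  then show ?thesis .
qed

text \<open>In the application this is the integral of D^s a at a point x of level n, summed over
  the level m of z: for m different from n the absolute value of x - z is P^(max n m), and for m = n
  the numerator vanishes. With P \<open>\<theta>\<close> = P powr (1 - s) and P /
  \<open>\<theta>\<close> = P powr (1 + s), the value is a constant times \<open>pmax x\<close> powr
  (- 1 - s).\<close>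

lemma factor_kernel_sums:
  fixes P \<theta> :: real and n :: nat
  assumes P: "P > 1" and \<theta>: "0 < \<theta>" "\<theta> < 1"
  defines "c \<equiv> \<lambda>m. ((1 / (P * \<theta>)) ^ n - (1 / (P * \<theta>)) ^ m) / (P / \<theta>) ^ max n m"
  shows "(\<lambda>m. c m * pvol P m) sums ((\<theta> - 1 / P) / (1 - \<theta>) / (P / \<theta>) ^ n)"
    and "summable (\<lambda>m. \<bar>c m\<bar> * pvol P m)"
proof -
  let ?b = "1 / (P * \<theta>)" and ?d = "P / \<theta>"
  let ?C = "(\<theta> - 1 / P) / (1 - \<theta>)"
  \<comment> \<open>For k > n, U k is the remainder of the series from index k on.\<close>
  define U where "U k = (1 - 1 / P) * (?b ^ n * \<theta> ^ k) / (1 - \<theta>) - 1 / P ^ k" for k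
  have bd: "?b ^ m / ?d ^ m * P ^ m = 1 / P ^ m" "P ^ m / ?d ^ m = \<theta> ^ m" for m
    using P \<theta> by (simp_all add: power_divide power_mult_distrib field_simps)
  have tail: "c (Suc k) * pvol P (Suc k) = U (Suc k) - U (Suc (Suc k))" if k: "n \<le> k" for k
  proof -
    have "c (Suc k) * pvol P (Suc k) = (1 - 1 / P) * (?b ^ n * (P ^ Suc k / ?d ^ Suc k) - ?b ^ Suc k / ?d ^ Suc k * P ^ Suc k)"
      using k P by (simp add: c_def pvol_def max_absorb2 field_simps)
    also have "\<dots> = (1 - 1 / P) * (?b ^ n * \<theta> ^ Suc k - 1 / P ^ Suc k)" unfolding bd ..
    also have "\<dots> = U (Suc k) - U (Suc (Suc k))"
    proof -
      define X where "X = ?b ^ n * \<theta> ^ Suc k"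
      have U: "U (Suc k) = (1 - 1 / P) * (X / (1 - \<theta>)) - 1 / P ^ Suc k"
        "U (Suc (Suc k)) = (1 - 1 / P) * (\<theta> * X / (1 - \<theta>)) - 1 / P ^ Suc (Suc k)"
        by (simp_all add: U_def X_def)
      have "X / (1 - \<theta>) - \<theta> * X / (1 - \<theta>) = (1 - \<theta>) * X / (1 - \<theta>)"
        by (simp only: diff_divide_distrib left_diff_distrib mult_1)
      also have "\<dots> = X" using \<theta> by simp
      finally have "(1 - 1 / P) * X = (1 - 1 / P) * (X / (1 - \<theta>)) - (1 - 1 / P) * (\<theta> * X / (1 - \<theta>))"
        by (metis right_diff_distrib)
      moreover have "(1 - 1 / P) * (1 / P ^ Suc k) = 1 / P ^ Suc k - 1 / P ^ Suc (Suc k)"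
        using P by (simp add: field_simps)
      ultimately show ?thesis unfolding U X_def[symmetric] by (simp only: right_diff_distrib)
    qed
    finally show ?thesis .
  qed
  have head: "(\<Sum>m\<le>n. c m * pvol P m) = ?C / ?d ^ n - U (Suc n)"
  proof -
    have "(\<Sum>m\<le>n. c m * pvol P m) = (\<Sum>m\<le>n. (?b ^ n - ?b ^ m) * pvol P m) / ?d ^ n"
      unfolding sum_divide_distrib by (intro sum.cong) (auto simp: c_def max_absorb1)
    also have "(\<Sum>m\<le>n. (?b ^ n - ?b ^ m) * pvol P m) = ?b ^ n * P ^ n - 1 - (1 - 1 / P) * (1 / \<theta> ^ n - 1) / (1 - \<theta>)"
      by (rule factor_kernel_partial_sum[OF P \<theta> order_refl])
    also have "?b ^ n * P ^ n = 1 / \<theta> ^ n" using P \<theta> by (simp add: power_divide power_mult_distrib)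
    also have "(1 / \<theta> ^ n - 1 - (1 - 1 / P) * (1 / \<theta> ^ n - 1) / (1 - \<theta>)) / ?d ^ n = ?C / ?d ^ n - U (Suc n)"
    proof -
      have alg: "(1 / X - 1 - (1 - 1 / P) * (1 / X - 1) / (1 - \<theta>)) / (Q / X) =
          ?C / (Q / X) - ((1 - 1 / P) * (\<theta> / Q) / (1 - \<theta>) - 1 / (P * Q))" if "X > 0" "Q > 0" for X Q
        using that P \<theta> by (simp add: divide_simps) (simp add: algebra_simps)
      have "?d ^ n = P ^ n / \<theta> ^ n" "?b ^ n * \<theta> ^ Suc n = \<theta> / P ^ n"
        using P \<theta> by (simp_all add: power_divide power_mult_distrib)
      then show ?thesis using alg[of "\<theta> ^ n" "P ^ n"] P \<theta> by (simp add: U_def)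
    qed
    finally show ?thesis .
  qed
  have part: "(\<Sum>m\<le>k. c m * pvol P m) = ?C / ?d ^ n - U (Suc k)" if "n \<le> k" for k
    using that
  proof (induction k rule: dec_induct)
    case (step k)
    then show ?case using tail[of k] by simp
  qed (rule head)
  have lim: "U \<longlonglongrightarrow> 0"
  proof -
    have "(\<lambda>k. (1 - 1 / P) * (?b ^ n * \<theta> ^ k) / (1 - \<theta>) - (1 / P) ^ k) \<longlonglongrightarrow> (1 - 1 / P) * (?b ^ n * 0) / (1 - \<theta>) - 0"
      using P \<theta> by (intro tendsto_intros LIMSEQ_realpow_zero) auto
    then show ?thesis by (simp add: U_def[abs_def] power_one_over)
  qed
  have "(\<lambda>k. ?C / ?d ^ n - U (Suc k)) \<longlonglongrightarrow> ?C / ?d ^ n - 0"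
    by (intro tendsto_diff tendsto_const LIMSEQ_Suc lim)
  then have "(\<lambda>k. ?C / ?d ^ n - U (Suc k)) \<longlonglongrightarrow> ?C / ?d ^ n" by (simp only: diff_zero)
  then have "(\<lambda>k. \<Sum>m\<le>k. c m * pvol P m) \<longlonglongrightarrow> ?C / ?d ^ n"
    by (rule Lim_transform_eventually) (intro eventually_sequentiallyI[of n], simp add: part)
  then show "(\<lambda>m. c m * pvol P m) sums (?C / ?d ^ n)" by (simp add: sums_def_le)
  show "summable (\<lambda>m. \<bar>c m\<bar> * pvol P m)"
  proof (rule summable_comparison_test_ev)
    have pv: "0 \<le> pvol P m" "pvol P m \<le> P ^ m" for m
      using P power_increasing[of "m - 1" m P] by (auto simp: pvol_def)
    have "norm (\<bar>c m\<bar> * pvol P m) \<le> ?b ^ n * \<theta> ^ m + (1 / P) ^ m" if "n \<le> m" for m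
    proof -
      have "\<bar>?b ^ n - ?b ^ m\<bar> \<le> ?b ^ n + ?b ^ m" using P \<theta> by (intro order.trans[OF abs_triangle_ineq4]) auto
      then have "\<bar>c m\<bar> \<le> (?b ^ n + ?b ^ m) / ?d ^ m"
        using P \<theta> that by (simp add: c_def max_absorb2 divide_right_mono)
      then have "\<bar>c m\<bar> * pvol P m \<le> (?b ^ n + ?b ^ m) / ?d ^ m * P ^ m"
        using pv P \<theta> by (intro mult_mono) auto
      also have "\<dots> = ?b ^ n * (P ^ m / ?d ^ m) + ?b ^ m / ?d ^ m * P ^ m"
        by (simp add: add_divide_distrib algebra_simps)
      finally show ?thesis unfolding bd using pv by (simp add: power_one_over)
    qed
    then show "\<forall>\<^sub>F m in sequentially. norm (\<bar>c m\<bar> * pvol P m) \<le> ?b ^ n * \<theta> ^ m + (1 / P) ^ m"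
      unfolding eventually_sequentially by blast
    show "summable (\<lambda>m. ?b ^ n * \<theta> ^ m + (1 / P) ^ m)"
      using P \<theta> by (intro summable_add summable_mult summable_geometric) auto
  qed
qed

context padic_haar
begin

definition "\<P> \<equiv> real CARD('p)"

lemma P_gt_1: "1 < \<P>"
  unfolding \<P>_def by (rule prime_card_gt_1)

lemma pmax_P: "pmax x = \<P> ^ plev (x :: 'p padic)"
  by (simp add: \<P>_def pmax_eq)

end

locale padic_haar_exponent = padic_haar M for M :: "'p::prime_card padic measure" +
  fixes s :: real
  assumes s_pos: "0 < s"
begin

definition \<theta> :: real where "\<theta> = \<P> powr (- s)"

lemma \<theta>: "0 < \<theta>" "\<theta> < 1"
  using P_gt_1 s_pos by (auto simp: \<theta>_def intro: powr_less_one)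

lemma P_powr:
  "\<P> powr s = 1 / \<theta>" "\<P> powr (s - 1) = 1 / (\<P> * \<theta>)" "\<P> powr (1 + s) = \<P> / \<theta>" "\<P> powr (1 - s) = \<P> * \<theta>"
  "\<P> powr (- 1 - s) = \<theta> / \<P>"
proof -
  have s: "\<P> powr s = 1 / \<theta>" using P_gt_1 by (simp add: \<theta>_def powr_minus_divide)
  then show "\<P> powr s = 1 / \<theta>" "\<P> powr (s - 1) = 1 / (\<P> * \<theta>)" "\<P> powr (1 + s) = \<P> / \<theta>"
    "\<P> powr (1 - s) = \<P> * \<theta>" "\<P> powr (- 1 - s) = \<theta> / \<P>"
    using P_gt_1 \<theta> by (simp_all add: powr_diff powr_add powr_minus_divide field_simps)
qed

lemma power_powr: "(\<P> ^ n) powr a = (\<P> powr a) ^ n"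
  using P_gt_1 by (simp add: powr_realpow[symmetric] powr_powr mult.commute)

lemma boundary_factor_power: "boundary_factor s x = (1 / (\<P> * \<theta>)) ^ plev (x :: 'p padic)"
  by (simp add: boundary_factor_eq pmax_P power_powr P_powr)

lemma has_integral_boundary_factor_kernel:
  "has_bochner_integral M (\<lambda>z. (boundary_factor s x - boundary_factor s z) / padic_abs (x - z) powr (1 + s))
    ((\<theta> - 1 / \<P>) / (1 - \<theta>) / (\<P> / \<theta>) ^ plev x)"
proof -
  let ?c = "\<lambda>m. ((1 / (\<P> * \<theta>)) ^ plev x - (1 / (\<P> * \<theta>)) ^ m) / (\<P> / \<theta>) ^ max (plev x) m"
  have "(boundary_factor s x - boundary_factor s z) / padic_abs (x - z) powr (1 + s) = ?c (plev z)" for z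
  proof (cases "plev x = plev z")
    case False
    then have "pmax x \<noteq> pmax z" using P_gt_1 by (simp add: pmax_P)
    then have "padic_abs (x - z) = max (pmax x) (pmax z)" by (rule pmax_diff)
    also have "\<dots> = \<P> ^ max (plev x) (plev z)"
      using P_gt_1 by (auto simp: pmax_P max_def)
    finally show ?thesis by (simp add: boundary_factor_power power_powr P_powr)
  qed (simp add: boundary_factor_power)
  moreover have "has_bochner_integral M (\<lambda>z. ?c (plev z)) ((\<theta> - 1 / \<P>) / (1 - \<theta>) / (\<P> / \<theta>) ^ plev x)"
    using factor_kernel_sums[OF P_gt_1 \<theta>, of "plev x"]
    unfolding \<P>_def by (intro has_integral_plev[OF haar])
  ultimately show ?thesis by simp
qed

text \<open>Summed over the common ancestors of \<open>x\<close> and \<open>z\<close> at levels \<open>l = 0, \<dots>, k\<close>, these coefficients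
  give \<open>p\<^sup>k\<^sup>(\<^sup>1\<^sup>+\<^sup>s\<^sup>)\<close>, the kernel \<open>chord x z powr (- 1 - s)\<close>.\<close>

definition shell_coeff :: "nat \<Rightarrow> real" where
  "shell_coeff l = (if l = 0 then 1 else (\<P> / \<theta>) ^ l - (\<P> / \<theta>) ^ (l - 1))"

lemma sum_shell_coeff: "(\<Sum>l\<le>k. shell_coeff l) = (\<P> / \<theta>) ^ k"
  by (induction k) (simp_all add: shell_coeff_def)

lemma chord_value:
  assumes "x \<noteq> (y :: 'p padic)" obtains k where "chord x y = 1 / \<P> ^ k"
proof -
  have "pmax x \<noteq> 0" "pmax y \<noteq> 0" using pmax_pos[of x] pmax_pos[of y] by auto
  moreover have "padic_abs (x - y) \<noteq> 0" using assms by simp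
  ultimately have "chord x y \<noteq> 0" unfolding chord_eq by (simp only: divide_eq_0_iff mult_eq_0_iff) simp
  moreover have "0 \<le> chord x y" "chord x y \<le> 1"
    using padic_abs_det2_le[of "prim x" "prim y"] by (simp_all add: chord_def)
  ultimately have "1 \<le> inverse (chord x y)" by (intro one_le_inverse) auto
  then have "1 \<le> padic_abs (inverse (det2 (prim x) (prim y)))"
    by (simp only: chord_def padic_abs_inverse)
  then obtain k where "padic_abs (inverse (det2 (prim x) (prim y))) = \<P> ^ k"
    unfolding \<P>_def by (rule padic_abs_eq_power)
  then have "inverse (chord x y) = \<P> ^ k" by (simp only: chord_def padic_abs_inverse)
  then have "chord x y = inverse (\<P> ^ k)" by (metis inverse_inverse_eq)
  then have "chord x y = 1 / \<P> ^ k" by (simp only: inverse_eq_divide)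
  then show ?thesis using that by blast
qed

lemma chord_powr_eq_sum:
  assumes ne: "ray x N \<noteq> ray (z :: 'p padic) N"
  shows "1 / chord x z powr (1 + s) = (\<Sum>l<N. shell_coeff l * (if ray z l = ray x l then 1 else 0))"
proof -
  have "x \<noteq> z" using ne by auto
  then obtain k where k: "chord x z = 1 / \<P> ^ k" by (rule chord_value)
  have iff: "ray z l = ray x l \<longleftrightarrow> l \<le> k" for l
    using inverse_power_mono_card[of k l, where 'p='p]
    by (auto simp: ray_eq_iff chord_commute[of z x] k \<P>_def)
  have "k < N" using ne iff[of N] by auto
  have "1 / chord x z powr (1 + s) = (\<P> / \<theta>) ^ k"
    using P_gt_1 \<theta> by (simp add: k powr_divide power_powr P_powr)
  also have "\<dots> = (\<Sum>l<N. if l \<le> k then shell_coeff l else 0)"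
    unfolding sum_shell_coeff[symmetric] using \<open>k < N\<close> by (intro sum.mono_neutral_cong_left) auto
  also have "\<dots> = (\<Sum>l<N. shell_coeff l * (if ray z l = ray x l then 1 else 0))"
    by (intro sum.cong) (auto simp: iff)
  finally show ?thesis .
qed

text \<open>This is what the factor a achieves: \<open>boundary_factor s z\<close> divided by
  \<open>pmax z\<close> powr (1 + s) is \<open>pmax z\<close> powr (-2), the density of
  \<open>\<mu>\<^sub>0\<close>.\<close>

lemma boundary_factor_chord:
  "boundary_factor s z * (a / padic_abs (x - z) powr (1 + s)) =
    (a / chord x z powr (1 + s)) / (pmax z)\<^sup>2 / (\<P> / \<theta>) ^ plev x" if "x \<noteq> (z :: 'p padic)"
proof -
  have d: "padic_abs (x - z) = chord x z * (pmax x * pmax z)"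
    using pmax_pos[of x] pmax_pos[of z] by (simp add: chord_eq)
  have x: "pmax x powr (1 + s) = (\<P> / \<theta>) ^ plev x" by (simp add: pmax_P power_powr P_powr)
  have z: "boundary_factor s z / pmax z powr (1 + s) = 1 / (pmax z)\<^sup>2"
    unfolding boundary_factor_eq powr_diff[symmetric] using pmax_pos[of z] by (simp add: powr_minus_divide)
  have "boundary_factor s z * (a / padic_abs (x - z) powr (1 + s)) =
      (a / chord x z powr (1 + s)) * (boundary_factor s z / pmax z powr (1 + s)) / pmax x powr (1 + s)"
    unfolding d using pmax_pos[of x] pmax_pos[of z] by (simp add: powr_mult chord_def mult.commute mult.left_commute)
  then show ?thesis unfolding x z by simp
qed

text \<open>With a the boundary factor, a(x) f(x) - a(z) f(z) = f(x) (a(x) - a(z)) + a(z) (f(x) -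
  f(z)). The first part is the integral of D^s a; the second becomes a
  \<open>\<mu>\<^sub>0\<close>-integral of a function of the level N vertex of z.\<close>

lemma has_integral_vladimirov:
  assumes F: "martingale F" and fF: "\<And>x :: 'p padic. f x = F (ray x N)"
  shows "has_bochner_integral M (vladimirov_integrand s (\<lambda>x. boundary_factor s x * f x) x)
    (((\<theta> - 1 / \<P>) / (1 - \<theta>) * F (ray x N) + (\<Sum>l<N. shell_coeff l * mass l * (F (ray x N) - F (ray x l))))
      / (\<P> / \<theta>) ^ plev x)"
proof -
  let ?a = "boundary_factor s" and ?d = "(\<P> / \<theta>) ^ plev x"
  \<comment> \<open>The second part of the integrand with its kernel expanded over common ancestors.
    If x and z share their level N vertex the expansion fails, but there F (ray x N) - F w is
    0.\<close>
  define h where "h w = (\<Sum>l<N. shell_coeff l * ((F (ray x N) - F w) * (if anc l w = ray x l then 1 else 0)))" for w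
  have int: "vladimirov_integrand s (\<lambda>x. ?a x * f x) x z =
      f x * ((?a x - ?a z) / padic_abs (x - z) powr (1 + s)) + h (ray z N) / (pmax z)\<^sup>2 / ?d" for z
  proof -
    have "?a z * ((f x - f z) / padic_abs (x - z) powr (1 + s)) = h (ray z N) / (pmax z)\<^sup>2 / ?d"
    proof (cases "ray x N = ray z N")
      case True
      then show ?thesis by (simp add: fF h_def)
    next
      case False
      then have ne: "x \<noteq> z" by blast
      have "(f x - f z) / chord x z powr (1 + s) = (f x - f z) * (1 / chord x z powr (1 + s))" by simp
      also have "\<dots> = h (ray z N)"
        unfolding chord_powr_eq_sum[OF False] h_def sum_distrib_left fF
        by (intro sum.cong) (auto simp: anc_ray[OF ray_in_rays])
      finally show ?thesis by (simp only: boundary_factor_chord[OF ne])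
    qed
    then show ?thesis
      by (simp add: vladimirov_integrand_def algebra_simps diff_divide_distrib)
  qed
  have total: "has_bochner_integral M
      (\<lambda>z. f x * ((?a x - ?a z) / padic_abs (x - z) powr (1 + s)) + h (ray z N) / (pmax z)\<^sup>2 / ?d)
      (f x * ((\<theta> - 1 / \<P>) / (1 - \<theta>) / ?d) + level_integral N h / ?d)"
    by (intro has_bochner_integral_add has_bochner_integral_mult_right has_bochner_integral_divide_zero
        has_integral_boundary_factor_kernel has_integral_level)
  have h: "level_integral N h = (\<Sum>l<N. shell_coeff l * mass l * (F (ray x N) - F (ray x l)))"
  proof -
    have "level_integral N h = (\<Sum>l<N. shell_coeff l *
        level_integral N (\<lambda>w. (F (ray x N) - F w) * (if anc l w = ray x l then 1 else 0)))"
      unfolding level_integral_def h_def sum_distrib_left by (subst sum.swap) (simp add: algebra_simps)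
    also have "\<dots> = (\<Sum>l<N. shell_coeff l * (mass l * (F (ray x N) - F (ray x l))))"
    proof (intro sum.cong refl arg_cong2[of _ _ _ _ "(*)"])
      fix l assume l: "l \<in> {..<N}"
      \<comment> \<open>Against the indicator of an ancestor at level l, the martingale property
        replaces F w by its value at that ancestor.\<close>
      have G: "martingale (\<lambda>w. F (ray x N) - F w)"
        using F by (simp add: martingale_def sum_subtractf right_diff_distrib)
      have "level_integral N (\<lambda>w. (F (ray x N) - F w) * (if anc l w = ray x l then 1 else 0)) =
          level_integral l (\<lambda>v. (F (ray x N) - F v) * (if v = ray x l then 1 else 0))"
        using l by (intro level_integral_anc[OF G, where h = "\<lambda>v. if v = ray x l then 1 else 0"]) simp
      also have "\<dots> = mass l * (\<Sum>v\<in>level l. if v = ray x l then F (ray x N) - F v else 0)"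
        unfolding level_integral_def by (intro arg_cong2[of _ _ _ _ "(*)"] sum.cong) auto
      also have "\<dots> = mass l * (F (ray x N) - F (ray x l))"
        using ray_level[of x l] by (simp add: finite_level)
      finally show "level_integral N (\<lambda>w. (F (ray x N) - F w) * (if anc l w = ray x l then 1 else 0)) =
          mass l * (F (ray x N) - F (ray x l))" .
    qed
    finally show ?thesis by (simp add: mult.assoc)
  qed
  have "f x * ((\<theta> - 1 / \<P>) / (1 - \<theta>) / ?d) + S / ?d = ((\<theta> - 1 / \<P>) / (1 - \<theta>) * F (ray x N) + S) / ?d" for S
    by (simp add: fF add_divide_distrib mult.commute)
  then show ?thesis using total unfolding h int[abs_def, symmetric] by simp
qed

lemma padic_Gamma_factor: "- (1 / padic_Gamma \<P> (- s)) = (1 - \<theta>) / (\<theta> * (1 - \<theta> / \<P>))"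
proof -
  have "\<P> powr (- s - 1) = \<theta> / \<P>" using P_powr(5) by (subst minus_diff_commute)
  then have G: "padic_Gamma \<P> (- s) = (1 - \<theta> / \<P>) / (1 - 1 / \<theta>)"
    using P_powr(1) by (simp add: padic_Gamma_def)
  have "1 - 1 / \<theta> = - ((1 - \<theta>) / \<theta>)" using \<theta> by (simp add: field_simps)
  then show ?thesis unfolding G by simp
qed

text \<open>The remaining factor a(x) / (P / \<open>\<theta>\<close>)^(plev x) is again the density
  1 / \<open>pmax\<close>^2, so this too is a level integral. Orthogonality of martingale increments
  turns the mean of F at level N times F at level l into the mean square at level l.\<close>

lemma has_integral_vladimirov_form:
  assumes F: "martingale F" and fF: "\<And>x :: 'p padic. f x = F (ray x N)"
  shows "has_bochner_integral M
    (\<lambda>x. boundary_factor s x * f x * vladimirov M s (\<lambda>x. boundary_factor s x * f x) x)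
    ((1 - \<theta>) / (\<theta> * (1 - \<theta> / \<P>)) * ((\<theta> - 1 / \<P>) / (1 - \<theta>) * square_mean F N
      + (\<Sum>l<N. shell_coeff l * mass l * (square_mean F N - square_mean F l))))"
proof -
  let ?k = "(1 - \<theta>) / (\<theta> * (1 - \<theta> / \<P>))" and ?C = "(\<theta> - 1 / \<P>) / (1 - \<theta>)"
  define h where "h v = ?k * (F v * (?C * F v + (\<Sum>l<N. shell_coeff l * mass l * (F v - F (anc l v)))))" for v
  have "boundary_factor s x * f x * vladimirov M s (\<lambda>x. boundary_factor s x * f x) x = h (ray x N) / (pmax x)\<^sup>2" for x
  proof -
    have v: "vladimirov M s (\<lambda>x. boundary_factor s x * f x) x = ?k *
        ((?C * F (ray x N) + (\<Sum>l<N. shell_coeff l * mass l * (F (ray x N) - F (ray x l)))) / (\<P> / \<theta>) ^ plev x)"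
      unfolding vladimirov_def has_bochner_integral_integral_eq[OF has_integral_vladimirov[OF F fF]]
      using padic_Gamma_factor by (simp only: \<P>_def)
    have anc: "(\<Sum>l<N. shell_coeff l * mass l * (F (ray x N) - F (ray x l))) =
        (\<Sum>l<N. shell_coeff l * mass l * (F (ray x N) - F (anc l (ray x N))))"
      by (intro sum.cong) (auto simp: anc_ray[OF ray_in_rays])
    have bd: "(1 / (\<P> * \<theta>)) ^ plev x / (\<P> / \<theta>) ^ plev x = 1 / (pmax x)\<^sup>2"
      using P_gt_1 \<theta> by (simp add: pmax_P power_divide power_mult_distrib power2_eq_square)
    have arr: "B * y * (K * (X / D)) = K * (y * X) * (B / D)" for B y K X D :: real by simp
    show ?thesis unfolding v unfolding fF boundary_factor_power arr bd anc h_def by simp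
  qed
  moreover have "has_bochner_integral M (\<lambda>x. h (ray x N) / (pmax x)\<^sup>2) (level_integral N h)"
    by (rule has_integral_level)
  moreover have "level_integral N h = ?k * (?C * square_mean F N
      + (\<Sum>l<N. shell_coeff l * mass l * (square_mean F N - square_mean F l)))"
  proof -
    have "h = (\<lambda>v. ?k * (?C * (F v)\<^sup>2 + (\<Sum>l<N. shell_coeff l * mass l * ((F v)\<^sup>2 - F v * F (anc l v)))))"
      by (simp add: fun_eq_iff h_def power2_eq_square distrib_left right_diff_distrib sum_distrib_left mult.left_commute)
    then have "level_integral N h = ?k * (?C * square_mean F N
        + (\<Sum>l<N. shell_coeff l * mass l * (square_mean F N - level_integral N (\<lambda>v. F v * F (anc l v)))))"
      unfolding square_mean_def
      by (simp only: level_integral_cmult level_integral_add level_integral_diff level_integral_sum)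
    moreover have "level_integral N (\<lambda>v. F v * F (anc l v)) = square_mean F l" if "l < N" for l
      using level_integral_anc[OF F, of l N F] that by (simp add: square_mean_def power2_eq_square)
    ultimately show ?thesis by simp
  qed
  ultimately show ?thesis by simp
qed

end

subsection \<open>The boundary\<close>

text \<open>It turns the boundary condition into a limit along the ray itself, the form in which
  \<open>balanced_eq_0\<close> takes it.\<close>

lemma bt_tends_to_ray:
  assumes r: "r \<in> bt_boundary" shows "filterlim r (bt_tends_to r) sequentially"
  unfolding bt_tends_to_def
proof (subst filterlim_INF, intro ballI)
  fix w assume "w \<in> range r"
  then obtain m where m: "w = r m" by blast
  have "r n \<in> bt_branch (r m)" if n: "m \<le> n" for n
  proof -
    have inj: "inj r" and adj: "\<And>k. bt_adj (r k) (r (Suc k))" and r0: "r 0 = bt_base"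
      using r by (auto simp: bt_boundary_def)
    have "bt_simple_path bt_base (r n) (map r [0..<Suc n])"
      unfolding bt_simple_path_def
    proof (intro conjI)
      show "distinct (map r [0..<Suc n])" using inj by (simp add: distinct_map inj_on_subset[OF inj] del: upt_Suc)
      show "successively bt_adj (map r [0..<Suc n])"
        unfolding successively_conv_nth using adj by (simp del: upt_Suc)
      show "set (map r [0..<Suc n]) \<subseteq> bt_vertices" using adj by (auto simp: bt_adj_def)
      show "hd (map r [0..<Suc n]) = bt_base" by (simp add: hd_map r0 del: upt_Suc)
    qed (simp_all add: last_map)
    moreover have "r m \<in> set (map r [0..<Suc n])"
      unfolding set_map by (rule imageI) (use n in \<open>simp del: upt_Suc\<close>)
    ultimately show ?thesis unfolding bt_branch_def by blast
  qed
  then show "filterlim r (principal (bt_branch w)) sequentially"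
    unfolding filterlim_principal eventually_sequentially m by blast
qed

context leveled_tree
begin

text \<open>Compactness of the boundary in the form of Koenig's lemma. A vertex is good if one level
  serves all rays through it. Since a vertex has finitely many children, a bad vertex has a bad
  child, so a bad root yields a ray of bad vertices, contradicting local constancy at that
  ray.\<close>

lemma uniformly_locally_constant:
  assumes f: "\<And>r. r \<in> rays \<Longrightarrow> \<exists>n. \<forall>r'\<in>rays. r' n = r n \<longrightarrow> f r' = f r"
  obtains N where "\<And>r r'. r \<in> rays \<Longrightarrow> r' \<in> rays \<Longrightarrow> r N = r' N \<Longrightarrow> f r = f r'"
proof -
  define good where "good v \<longleftrightarrow> (\<exists>N. \<forall>r\<in>rays. \<forall>r'\<in>rays. r (lev v) = v \<longrightarrow> r' (lev v) = v \<longrightarrow> r N = r' N \<longrightarrow> f r = f r')" for v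
  have "good root"
  proof (rule ccontr)
    assume "\<not> good root"
    moreover have "\<exists>w\<in>children v. \<not> good w" if v: "v \<in> V" "\<not> good v" for v
    proof (rule ccontr)
      assume "\<not> ?thesis"
      then have "\<forall>w\<in>children v. \<exists>N. \<forall>r\<in>rays. \<forall>r'\<in>rays. r (lev w) = w \<longrightarrow> r' (lev w) = w \<longrightarrow> r N = r' N \<longrightarrow> f r = f r'"
        unfolding good_def by blast
      then obtain N where N: "\<And>w r r'. w \<in> children v \<Longrightarrow> r \<in> rays \<Longrightarrow> r' \<in> rays \<Longrightarrow>
          r (lev w) = w \<Longrightarrow> r' (lev w) = w \<Longrightarrow> r (N w) = r' (N w) \<Longrightarrow> f r = f r'" by metis
      define K where "K = Max (insert (Suc (lev v)) (N ` children v))"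
      have K: "Suc (lev v) \<le> K" "\<And>w. w \<in> children v \<Longrightarrow> N w \<le> K"
        unfolding K_def using finite_children[OF v(1)] by auto
      have "f r = f r'" if r: "r \<in> rays" "r' \<in> rays" "r (lev v) = v" "r K = r' K" for r r'
      proof -
        have eq: "r k = r' k" if "k \<le> K" for k
          using anc_ray[OF r(1) that] anc_ray[OF r(2) that] r(4) by simp
        define w where "w = r (Suc (lev v))"
        have w: "w \<in> children v" using r(1,3) unfolding w_def rays_def by (metis (mono_tags, lifting) mem_Collect_eq)
        then have l: "lev w = Suc (lev v)" by (rule childrenD)
        have "r (lev w) = w" "r' (lev w) = w" unfolding l using eq[OF K(1)] by (simp_all add: w_def)
        then show ?thesis using N[OF w r(1,2)] eq[OF K(2)[OF w]] by blast
      qed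
      then have "good v" unfolding good_def by blast
      then show False using v by simp
    qed
    ultimately obtain r where r: "r \<in> rays" "\<And>k. lev root \<le> k \<Longrightarrow> \<not> good (r k)"
      using ray_through[OF root_mem, of "\<lambda>v. \<not> good v"] by metis
    obtain n where n: "\<And>r'. r' \<in> rays \<Longrightarrow> r' n = r n \<Longrightarrow> f r' = f r" using f[OF r(1)] by blast
    have "lev (r n) = n" using ray_mem[OF r(1), of n] by (simp add: level_def)
    then have "good (r n)" unfolding good_def using n by (intro exI[of _ 0]) metis
    then show False using r(2)[of n] by (simp add: lev_root)
  qed
  then obtain N where N: "\<And>r r'. r \<in> rays \<Longrightarrow> r' \<in> rays \<Longrightarrow> r 0 = root \<Longrightarrow> r' 0 = root \<Longrightarrow> r N = r' N \<Longrightarrow> f r = f r'"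
    unfolding good_def lev_root by blast
  have r0: "r 0 = root" if "r \<in> rays" for r using that by (simp add: rays_def)
  show ?thesis by (rule that[of N]) (rule N, simp_all add: r0)
qed

lemma exists_ray_through:
  assumes "v \<in> V" obtains r where "r \<in> rays" "r (lev v) = v"
proof -
  have "\<exists>u'\<in>children u. True" if "u \<in> V" for u using children_nonempty[OF that] by auto
  then show ?thesis using ray_through[OF assms, of "\<lambda>_. True"] that by metis
qed

end

context padic_haar
begin

lemma bt_boundary_eq_rays: "bt_boundary = rays"
proof
  show "rays \<subseteq> bt_boundary"
  proof
    fix r assume r: "r \<in> rays"
    have "inj r"
    proof (rule injI)
      fix n m assume "r n = r m"
      then show "n = m" using ray_mem[OF r, of n] ray_mem[OF r, of m] by (simp add: level_def)
    qed
    moreover have "bt_adj (r n) (r (Suc n))" for n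
      using r ray_mem[OF r, of n] childrenD[of "r (Suc n)" "r n"] unfolding bt_adj_iff
      by (simp add: rays_def level_def)
    ultimately show "r \<in> bt_boundary" using r by (simp add: bt_boundary_def rays_def)
  qed
  show "bt_boundary \<subseteq> rays"
  proof
    fix r :: "nat \<Rightarrow> 'p bt_vertex" assume "r \<in> bt_boundary"
    then have r: "r 0 = bt_base" "\<And>n. bt_adj (r n) (r (Suc n))" "inj r" by (auto simp: bt_boundary_def)
    have "r (Suc n) \<in> children (r n)" for n
    proof (induction n)
      case 0
      have "bt_dist bt_base (r 0) = 0" by (simp add: r lev_root)
      then show ?case using r(2)[of 0] unfolding bt_adj_iff children_def by auto
    next
      case (Suc n)
      have "bt_parent (r (Suc n)) = r n" using Suc by (rule childrenD)
      \<comment> \<open>An injective ray cannot turn back to the parent, so every further step leads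
        to a child.\<close>
      moreover have "r (Suc (Suc n)) \<noteq> r n" using r(3) by (auto dest: injD)
      ultimately show ?case using r(2)[of "Suc n"] unfolding bt_adj_iff children_def by auto
    qed
    then show "r \<in> rays" using r(1) by (simp add: rays_def)
  qed
qed

lemma bt_boundary_ball_eq: "v \<in> bt_vertices \<Longrightarrow> bt_boundary_ball v = {r \<in> rays. r (bt_dist bt_base v) = v}"
proof -
  assume "v \<in> bt_vertices"
  have "bt_dist bt_base (r n) = n" if "r \<in> rays" for r n using ray_mem[OF that, of n] by (simp add: level_def)
  then show ?thesis unfolding bt_boundary_ball_def bt_boundary_eq_rays by (force simp: image_iff)
qed

lemma openin_bt_boundary_ball: "v \<in> bt_vertices \<Longrightarrow> openin bt_boundary_topology (bt_boundary_ball v)"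
  unfolding bt_boundary_topology_def by (intro topology_generated_by_Basis) blast

lemma openin_bt_boundary_contains_ball:
  assumes U: "openin (bt_boundary_topology :: (nat \<Rightarrow> 'p bt_vertex) topology) U" and r: "r \<in> U"
  shows "r \<in> rays \<and> (\<exists>n. \<forall>r'\<in>rays. r' n = r n \<longrightarrow> r' \<in> U)"
proof -
  have "generate_topology_on (bt_boundary_ball ` (bt_vertices :: 'p bt_vertex set)) U"
    using U unfolding bt_boundary_topology_def by (simp add: openin_topology_generated_by_iff)
  then show ?thesis using r
  proof (induction U)
    case (Int A B)
    then obtain n m where n: "\<forall>r'\<in>rays. r' n = r n \<longrightarrow> r' \<in> A" and m: "\<forall>r'\<in>rays. r' m = r m \<longrightarrow> r' \<in> B"
      and rr: "r \<in> rays" by blast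
    have "r' \<in> A \<inter> B" if r': "r' \<in> rays" "r' (max n m) = r (max n m)" for r'
    proof -
      have "r' k = r k" if "k \<le> max n m" for k
        using anc_ray[OF r'(1) that] anc_ray[OF rr that] r'(2) by simp
      then show ?thesis using n m r' by simp
    qed
    then show ?case using rr by (intro conjI exI[of _ "max n m"]) simp_all
  next
    case (UN K)
    then obtain A where A: "A \<in> K" "r \<in> A" by blast
    obtain n where "r \<in> rays" "\<forall>r'\<in>rays. r' n = r n \<longrightarrow> r' \<in> A" using UN.IH[OF A] by blast
    then show ?case using A(1) by (intro conjI exI[of _ n]) auto
  next
    case (Basis B)
    then obtain v where v: "v \<in> bt_vertices" "B = bt_boundary_ball v" by blast
    then show ?case using Basis bt_boundary_ball_eq[OF v(1)] by auto
  qed simp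
qed

lemma topspace_bt_boundary: "topspace (bt_boundary_topology :: (nat \<Rightarrow> 'p bt_vertex) topology) = rays"
proof
  show "topspace bt_boundary_topology \<subseteq> rays"
    using openin_bt_boundary_contains_ball openin_topspace by blast
  have "rays \<subseteq> bt_boundary_ball bt_base"
    unfolding bt_boundary_ball_eq[OF root_mem] by (auto simp: lev_root rays_def)
  then show "rays \<subseteq> topspace (bt_boundary_topology :: (nat \<Rightarrow> 'p bt_vertex) topology)"
    using openin_subset[OF openin_bt_boundary_ball[OF root_mem]] by blast
qed

lemma locally_constant_level:
  fixes f :: "(nat \<Rightarrow> 'p bt_vertex) \<Rightarrow> real"
  assumes "locally_constant_on bt_boundary_topology f"
  obtains N where "0 < N" "\<And>r r'. r \<in> rays \<Longrightarrow> r' \<in> rays \<Longrightarrow> r N = r' N \<Longrightarrow> f r = f r'"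
proof -
  have "\<exists>n. \<forall>r'\<in>rays. r' n = r n \<longrightarrow> f r' = f r" if r: "r \<in> rays" for r
  proof -
    obtain U where U: "openin bt_boundary_topology U" "r \<in> U" "\<forall>y\<in>U. f y = f r"
      using assms r unfolding locally_constant_on_def topspace_bt_boundary by blast
    then show ?thesis using openin_bt_boundary_contains_ball[OF U(1,2)] by blast
  qed
  then obtain N where N: "\<And>r r'. r \<in> rays \<Longrightarrow> r' \<in> rays \<Longrightarrow> r N = r' N \<Longrightarrow> f r = f r'"
    using uniformly_locally_constant[of f] by blast
  \<comment> \<open>Raising the level by one makes it positive: the measure is prescribed for balls
    away from the base vertex.\<close>
  have "f r = f r'" if r: "r \<in> rays" "r' \<in> rays" "r (Suc N) = r' (Suc N)" for r r'
    using anc_ray[OF r(1), of N "Suc N"] anc_ray[OF r(2), of N "Suc N"] r(3) by (intro N r) simp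
  then show ?thesis using that[of "Suc N"] by blast
qed

end

section \<open>Averages over boundary balls\<close>

locale boundary_measure = padic_haar M for M :: "'p::prime_card padic measure" +
  fixes \<mu> :: "(nat \<Rightarrow> 'p bt_vertex) measure"
  assumes boundary: "is_boundary_measure \<mu>"
begin

lemma space_boundary: "space \<mu> = rays"
  using boundary by (simp add: is_boundary_measure_def bt_boundary_eq_rays)

lemma ball_sets [measurable]: "v \<in> bt_vertices \<Longrightarrow> bt_boundary_ball v \<in> sets \<mu>"
  using boundary openin_bt_boundary_ball by (auto simp: is_boundary_measure_def intro: sigma_sets.Basic)

lemma ball_root: "bt_boundary_ball bt_base = rays"
  unfolding bt_boundary_ball_eq[OF root_mem] by (auto simp: lev_root rays_def)

lemma ball_children: "v \<in> bt_vertices \<Longrightarrow> bt_boundary_ball v = (\<Union>w\<in>children v. bt_boundary_ball w)"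
proof -
  assume v: "v \<in> bt_vertices"
  have "r (bt_dist bt_base v) = v \<longleftrightarrow> r (Suc (bt_dist bt_base v)) \<in> children v" if r: "r \<in> rays" for r
    using r childrenD(3) unfolding rays_def by (metis (mono_tags, lifting) mem_Collect_eq)
  moreover have "bt_boundary_ball w = {r \<in> rays. r (Suc (bt_dist bt_base v)) = w}" if "w \<in> children v" for w
    using bt_boundary_ball_eq[of w] childrenD[OF that] by simp
  ultimately show ?thesis unfolding bt_boundary_ball_eq[OF v] by auto
qed

lemma disjoint_ball_children: "disjoint_family_on bt_boundary_ball (children v)"
proof -
  have "bt_boundary_ball w = {r \<in> rays. r (Suc (bt_dist bt_base v)) = w}" if "w \<in> children v" for w
    using bt_boundary_ball_eq[of w] childrenD[OF that] by simp
  then show ?thesis by (auto simp: disjoint_family_on_def)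
qed

lemma emeasure_ball:
  assumes "v \<in> bt_vertices" "v \<noteq> bt_base"
  shows "emeasure \<mu> (bt_boundary_ball v) = ennreal (mass (bt_dist bt_base v))"
  using assms boundary lev_eq_0_iff[OF assms(1)] by (auto simp: is_boundary_measure_def mass_def)

lemma finite_boundary_measure: "finite_measure \<mu>"
proof (rule finite_measureI)
  have "emeasure \<mu> (space \<mu>) = (\<Sum>w\<in>children bt_base. emeasure \<mu> (bt_boundary_ball w))"
    unfolding space_boundary ball_root[symmetric] ball_children[OF root_mem]
    by (intro sum_emeasure[symmetric] disjoint_ball_children finite_children root_mem)
      (auto dest: childrenD)
  also have "\<dots> \<noteq> \<infinity>"
  proof -
    have "emeasure \<mu> (bt_boundary_ball w) \<noteq> \<infinity>" if "w \<in> children bt_base" for w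
      using emeasure_ball[of w] childrenD[OF that] lev_root by (metis ennreal_neq_top infinity_ennreal_def nat.distinct(1))
    then show ?thesis using finite_children[OF root_mem] by simp
  qed
  finally show "emeasure \<mu> (space \<mu>) \<noteq> \<infinity>" .
qed

sublocale finite_measure \<mu> by (rule finite_boundary_measure)

lemma measure_ball:
  assumes "v \<in> bt_vertices" "v \<noteq> bt_base"
  shows "measure \<mu> (bt_boundary_ball v) = mass (bt_dist bt_base v)"
  using emeasure_ball[OF assms] mass_pos[of "bt_dist bt_base v"] by (simp add: measure_def)

definition average :: "((nat \<Rightarrow> 'p bt_vertex) \<Rightarrow> real) \<Rightarrow> 'p bt_vertex \<Rightarrow> real" where
  "average f v = (\<integral>r. f r * indicator (bt_boundary_ball v) r \<partial>\<mu>) / mass (bt_dist bt_base v)"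

text \<open>f is a finite combination of the indicators of the balls at level N, with the value on
  any ray of the ball as coefficient.\<close>

lemma integrable_level:
  assumes N: "\<And>r r'. r \<in> rays \<Longrightarrow> r' \<in> rays \<Longrightarrow> r N = r' N \<Longrightarrow> f r = (f r' :: real)"
  shows "integrable \<mu> f"
proof -
  define c where "c v = f (SOME r. r \<in> rays \<and> r N = v)" for v
  have "(\<Sum>v\<in>level N. c v * indicator (bt_boundary_ball v) r) = f r" if r: "r \<in> rays" for r
  proof -
    have "(\<Sum>v\<in>level N. c v * indicator (bt_boundary_ball v) r) = (\<Sum>v\<in>level N. if v = r N then c v else 0)"
    proof (rule sum.cong[OF refl])
      fix v assume "v \<in> level N"
      then have "bt_boundary_ball v = {r \<in> rays. r N = v}" using bt_boundary_ball_eq[of v] by (simp add: level_def)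
      then show "c v * indicator (bt_boundary_ball v) r = (if v = r N then c v else 0)" using r by auto
    qed
    also have "\<dots> = c (r N)" using ray_mem[OF r, of N] by (simp add: finite_level)
    also have "\<dots> = f r"
    proof -
      have "\<exists>q. q \<in> rays \<and> q N = r N" using r by blast
      then have "(SOME q. q \<in> rays \<and> q N = r N) \<in> rays \<and> (SOME q. q \<in> rays \<and> q N = r N) N = r N" by (rule someI_ex)
      then show ?thesis unfolding c_def using N r by blast
    qed
    finally show ?thesis .
  qed
  moreover have "integrable \<mu> (\<lambda>r. \<Sum>v\<in>level N. c v * indicator (bt_boundary_ball v) r)"
    by (intro Bochner_Integration.integrable_sum integrable_mult_right integrable_real_indicator)
      (auto simp: level_def emeasure_finite less_top[symmetric])
  moreover have "integrable \<mu> f \<longleftrightarrow> integrable \<mu> (\<lambda>r. \<Sum>v\<in>level N. c v * indicator (bt_boundary_ball v) r)"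
    by (intro Bochner_Integration.integrable_cong refl) (simp add: calculation(1) space_boundary)
  ultimately show ?thesis by simp
qed

lemma martingale_average:
  assumes f: "integrable \<mu> f" shows "martingale (average f)"
  unfolding martingale_def
proof
  fix v :: "'p bt_vertex" assume v: "v \<in> bt_vertices"
  have m: "mass (Suc (bt_dist bt_base v)) > 0" by (rule mass_pos)
  have "(\<integral>r. f r * indicator (bt_boundary_ball v) r \<partial>\<mu>) = (\<integral>r. (\<Sum>w\<in>children v. f r * indicator (bt_boundary_ball w) r) \<partial>\<mu>)"
    unfolding ball_children[OF v] sum_distrib_left[symmetric]
    by (simp add: indicator_UN_disjoint[OF finite_children[OF v] disjoint_ball_children])
  also have "\<dots> = (\<Sum>w\<in>children v. \<integral>r. f r * indicator (bt_boundary_ball w) r \<partial>\<mu>)"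
    using childrenD(1) by (intro Bochner_Integration.integral_sum integrable_real_mult_indicator f ball_sets) auto
  also have "\<dots> = (\<Sum>w\<in>children v. mass (Suc (bt_dist bt_base v)) * average f w)"
    using m by (intro sum.cong) (auto simp: average_def childrenD)
  also have "(\<integral>r. f r * indicator (bt_boundary_ball v) r \<partial>\<mu>) = mass (bt_dist bt_base v) * average f v"
    using mass_pos[of "bt_dist bt_base v"] by (simp add: average_def)
  finally have "mass (bt_dist bt_base v) * average f v = mass (Suc (bt_dist bt_base v)) * (\<Sum>w\<in>children v. average f w)"
    by (simp only: sum_distrib_left)
  then show "(\<Sum>w\<in>children v. average f w) = real (card (children v)) * average f v"
    using m unfolding mass_children[OF v, symmetric] by simp
qed

lemma average_eq:
  assumes N: "\<And>r r'. r \<in> rays \<Longrightarrow> r' \<in> rays \<Longrightarrow> r N = r' N \<Longrightarrow> f r = (f r' :: real)" "0 < N"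
    and r: "r \<in> rays" and n: "N \<le> n"
  shows "average f (r n) = f r"
proof -
  have rn: "r n \<in> bt_vertices" "bt_dist bt_base (r n) = n" using ray_mem[OF r, of n] by (auto simp: level_def)
  have ne: "r n \<noteq> bt_base" using rn N(2) n lev_root by auto
  have "f q * indicator (bt_boundary_ball (r n)) q = f r * indicator (bt_boundary_ball (r n)) q" for q
  proof (cases "q \<in> bt_boundary_ball (r n)")
    case True
    then have q: "q \<in> rays" "q n = r n" using bt_boundary_ball_eq[OF rn(1)] rn(2) by auto
    then have "q N = r N" using anc_ray[OF q(1) n] anc_ray[OF r n] by simp
    then show ?thesis using N(1)[OF q(1) r] by simp
  qed simp
  then have "(\<integral>q. f q * indicator (bt_boundary_ball (r n)) q \<partial>\<mu>) = f r * mass n"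
    using measure_ball[OF rn(1) ne] rn by (simp only: integral_mult_right_zero) simp
  then show ?thesis using mass_pos[of n] by (simp add: average_def rn)
qed

lemma average_root: "average f bt_base = (\<integral>r. f r \<partial>\<mu>) / mass 0"
proof -
  have "(\<integral>r. f r * indicator (bt_boundary_ball bt_base) r \<partial>\<mu>) = (\<integral>r. f r \<partial>\<mu>)"
    by (intro Bochner_Integration.integral_cong) (auto simp: ball_root space_boundary)
  then show ?thesis by (simp add: average_def lev_root)
qed

end

subsection \<open>Energy of the harmonic extension\<close>

context padic_haar
begin

lemma finite_neighbours_sum:
  fixes h :: "'p bt_vertex \<Rightarrow> real"
  assumes v: "v \<in> bt_vertices"
  shows "(\<Sum>w | bt_adj v w. h w) = (\<Sum>w\<in>children v. h w) + (if v = bt_base then 0 else h (bt_parent v))"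
proof (cases "v = bt_base")
  case True
  then have "{w. bt_adj v w} = children v"
    using v by (auto simp: bt_adj_iff children_def lev_root)
  then show ?thesis using True by simp
next
  case False
  then obtain n where n: "bt_dist bt_base v = Suc n" using lev_eq_0_iff[OF v] by (cases "bt_dist bt_base v") auto
  have "{w. bt_adj v w} = insert (bt_parent v) (children v)"
    using v n par_mem[OF v n] lev_par[OF v n] by (auto simp: bt_adj_iff children_def)
  moreover have "bt_parent v \<notin> children v"
    using lev_par[OF v n] n by (auto simp: children_def)
  ultimately show ?thesis using False finite_children[OF v] by simp
qed

end

context padic_haar_exponent
begin

lemma level_powr: "real CARD('p) powr (real n * (s - 1)) = (1 / (\<P> * \<theta>)) ^ n"
proof -
  have "real CARD('p) powr (real n * (s - 1)) = (\<P> powr real n) powr (s - 1)" by (simp add: \<P>_def powr_powr)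
  also have "\<P> powr real n = \<P> ^ n" using P_gt_1 by (simp add: powr_realpow)
  finally show ?thesis by (simp only: power_powr P_powr)
qed

lemma bt_weight_child:
  assumes "w \<in> children v" "bt_dist bt_base v = n"
  shows "bt_weight s v w = (1 / (\<P> * \<theta>)) ^ n * (1 + 1 / (\<P> * \<theta>))" (is ?a)
    and "bt_weight s w v = (1 / (\<P> * \<theta>)) ^ n * (1 + 1 / (\<P> * \<theta>))" (is ?b)
proof -
  have "bt_dist bt_base w = Suc n" using childrenD(2)[OF assms(1)] assms(2) by simp
  then show ?a ?b unfolding bt_weight_def assms(2) level_powr by (simp_all add: algebra_simps)
qed

text \<open>With b = 1 / (p \<open>\<theta>\<close>), both kinds of edges carry the factor 1 + b;
  cancelling it and the lower power of b leaves the ratio 1 / b = p \<open>\<theta>\<close>.\<close>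

lemma balanced_if_harmonic:
  assumes "\<And>v. v \<in> bt_vertices \<Longrightarrow> bt_laplacian s \<phi> v = 0"
  shows "balanced (\<P> * \<theta>) \<phi>"
  unfolding balanced_def
proof
  fix v :: "'p bt_vertex" assume v: "v \<in> bt_vertices"
  let ?b = "1 / (\<P> * \<theta>)"
  define n where "n = bt_dist bt_base v"
  have b: "0 < ?b" using P_gt_1 \<theta> by simp
  have "(\<Sum>w\<in>children v. bt_weight s v w * (\<phi> v - \<phi> w)) = (\<Sum>w\<in>children v. - (?b ^ n * (1 + ?b)) * (\<phi> w - \<phi> v))"
  proof (rule sum.cong[OF refl])
    fix w assume "w \<in> children v"
    then have "bt_weight s v w = ?b ^ n * (1 + ?b)" by (rule bt_weight_child(1)) (simp add: n_def)
    moreover have "c * (x - y) = - c * (y - x)" for c x y :: real by (simp add: algebra_simps)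
    ultimately show "bt_weight s v w * (\<phi> v - \<phi> w) = - (?b ^ n * (1 + ?b)) * (\<phi> w - \<phi> v)" by metis
  qed
  then have S: "(\<Sum>w\<in>children v. bt_weight s v w * (\<phi> v - \<phi> w)) = - (?b ^ n * (1 + ?b)) * (\<Sum>w\<in>children v. \<phi> w - \<phi> v)"
    by (simp only: sum_distrib_left)
  have L: "- (?b ^ n * (1 + ?b)) * (\<Sum>w\<in>children v. \<phi> w - \<phi> v)
      + (if v = bt_base then 0 else bt_weight s v (bt_parent v) * (\<phi> v - \<phi> (bt_parent v))) = 0"
    using assms[OF v] unfolding bt_laplacian_def finite_neighbours_sum[OF v] S .
  show "(\<Sum>w\<in>children v. \<phi> w - \<phi> v) = (if v = bt_base then 0 else \<P> * \<theta> * (\<phi> v - \<phi> (bt_parent v)))"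
  proof (cases "v = bt_base")
    case True
    have "0 < ?b ^ n * (1 + ?b)" using b by (intro mult_pos_pos add_pos_pos zero_less_power zero_less_one)
    moreover have "x = 0" if "0 < c" "- c * x + 0 = 0" for c x :: real using that by simp
    ultimately have "(\<Sum>w\<in>children v. \<phi> w - \<phi> v) = 0" using L unfolding if_P[OF True] by blast
    then show ?thesis using True by simp
  next
    case False
    then obtain m where m: "n = Suc m" using lev_eq_0_iff[OF v] by (cases n) (auto simp: n_def)
    have "v \<in> children (bt_parent v)" "bt_dist bt_base (bt_parent v) = m"
      using child_of_par[OF v, of m] lev_par[OF v, of m] m by (auto simp: n_def)
    then have wt: "bt_weight s v (bt_parent v) = ?b ^ m * (1 + ?b)" by (rule bt_weight_child(2))
    have cancel: "x = y" if "c * (x - y) = 0" "0 < c" for c x y :: real using that by simp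
    have "- (c ^ Suc m * (1 + c)) * x + c ^ m * (1 + c) * y = c ^ m * (1 + c) * (y - c * x)" for c x y :: real
      by (simp add: algebra_simps)
    then have "(?b ^ m * (1 + ?b)) * ((\<phi> v - \<phi> (bt_parent v)) - ?b * (\<Sum>w\<in>children v. \<phi> w - \<phi> v)) = 0"
      using L unfolding if_not_P[OF False] m wt by metis
    moreover have "0 < ?b ^ m * (1 + ?b)" using b by (intro mult_pos_pos add_pos_pos zero_less_power zero_less_one)
    ultimately have "\<phi> v - \<phi> (bt_parent v) = ?b * (\<Sum>w\<in>children v. \<phi> w - \<phi> v)"
      by (rule cancel)
    then show ?thesis using False P_gt_1 \<theta> by simp
  qed
qed

text \<open>The edges to the children count for level n + 1 of \<open>level_energy\<close>, the edge
  to the parent for level n; overall every edge occurs twice, with the weights of its two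
  ends.\<close>

lemma energy_level:
  "(\<Sum>v\<in>level n. \<Sum>w | bt_adj v w. (\<phi> w - \<phi> v)\<^sup>2 * real CARD('p) powr (real (bt_dist bt_base v) * (s - 1)))
    = (1 / (\<P> * \<theta>)) ^ n * (level_energy \<phi> (Suc n) + level_energy \<phi> n)"
proof -
  let ?b = "1 / (\<P> * \<theta>)"
  have "(\<Sum>v\<in>level n. \<Sum>w | bt_adj v w. (\<phi> w - \<phi> v)\<^sup>2 * real CARD('p) powr (real (bt_dist bt_base v) * (s - 1)))
      = (\<Sum>v\<in>level n. ?b ^ n * ((\<Sum>w\<in>children v. (\<phi> w - \<phi> (bt_parent w))\<^sup>2) + (if n = 0 then 0 else (\<phi> v - \<phi> (bt_parent v))\<^sup>2)))"
  proof (rule sum.cong[OF refl])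
    fix v assume "v \<in> level n"
    then have v: "v \<in> bt_vertices" "bt_dist bt_base v = n" by (auto simp: level_def)
    have "(\<Sum>w\<in>children v. (\<phi> w - \<phi> (bt_parent w))\<^sup>2) = (\<Sum>w\<in>children v. (\<phi> w - \<phi> v)\<^sup>2)"
      by (intro sum.cong) (auto simp: childrenD)
    moreover have "v = bt_base \<longleftrightarrow> n = 0" using lev_eq_0_iff[OF v(1)] v(2) by simp
    ultimately show "(\<Sum>w | bt_adj v w. (\<phi> w - \<phi> v)\<^sup>2 * real CARD('p) powr (real (bt_dist bt_base v) * (s - 1)))
      = ?b ^ n * ((\<Sum>w\<in>children v. (\<phi> w - \<phi> (bt_parent w))\<^sup>2) + (if n = 0 then 0 else (\<phi> v - \<phi> (bt_parent v))\<^sup>2))"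
      unfolding v(2) level_powr sum_distrib_right[symmetric] finite_neighbours_sum[OF v(1)]
      by (simp add: power2_commute[of "\<phi> (bt_parent v)"])
  qed
  also have "\<dots> = ?b ^ n * (level_energy \<phi> (Suc n) + level_energy \<phi> n)"
    by (simp add: level_energy_def sum_level_Suc sum.distrib sum_distrib_left distrib_left)
  finally show ?thesis .
qed

text \<open>With b = 1 / (p \<open>\<theta>\<close>), the two occurrences of an edge between levels
  n - 1 and n have total weight b^(n-1) + b^n = (1 + p \<open>\<theta>\<close>) b^n, which accounts
  for the factor 1 + p \<open>\<theta>\<close>.\<close>

lemma relax_energy_has_sum:
  assumes F: "martingale F" and N: "\<And>v n. v \<in> bt_vertices \<Longrightarrow> bt_dist bt_base v = Suc n \<Longrightarrow> N \<le> n \<Longrightarrow> F v = F (bt_parent v)"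
    and \<phi>: "\<And>v. v \<in> bt_vertices \<Longrightarrow> \<phi> v = relax \<theta> F v"
  shows "((\<lambda>v. \<Sum>w | bt_adj v w. (\<phi> w - \<phi> v)\<^sup>2 * real CARD('p) powr (real (bt_dist bt_base v) * (s - 1))) has_sum
    ((1 + \<P> * \<theta>) * ((1 - \<theta>) * (\<Sum>n=1..N. (square_mean F n - square_mean F (n - 1)) / \<theta> ^ n)))) bt_vertices"
proof (rule has_sum_levels)
  show "0 \<le> (\<Sum>w | bt_adj v w. (\<phi> w - \<phi> v)\<^sup>2 * real CARD('p) powr (real (bt_dist bt_base v) * (s - 1)))" for v
    by (intro sum_nonneg) auto
  let ?b = "1 / (\<P> * \<theta>)"
  define Y where "Y = (1 - \<theta>) * (\<Sum>n=1..N. (square_mean F n - square_mean F (n - 1)) / \<theta> ^ n)"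
  define y where "y n = mass n * level_energy (relax \<theta> F) n / \<theta> ^ n" for n
  have Y: "y sums Y" unfolding y_def[abs_def] Y_def by (rule relax_energy_sums[OF F N \<theta>])
  have y0: "y 0 = 0" by (simp add: y_def level_energy_def)
  then have Y': "(\<lambda>n. y (Suc n)) sums Y" using Y by (simp add: sums_Suc_iff)
  have E: "level_energy \<phi> n = level_energy (relax \<theta> F) n" for n
  proof (cases n)
    case (Suc m)
    then show ?thesis unfolding level_energy_def
      using \<phi> by (intro if_cong refl sum.cong) (auto simp: level_def par_mem)
  qed (simp add: level_energy_def)
  have b: "?b ^ n * level_energy (relax \<theta> F) n = y n" for n
    using P_gt_1 \<theta> by (cases n) (simp_all add: y_def mass_def level_energy_def \<P>_def power_divide power_mult_distrib)
  have "?b ^ n * (level_energy \<phi> (Suc n) + level_energy \<phi> n) = y n + \<P> * \<theta> * y (Suc n)" for n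
  proof -
    have "?b ^ n = \<P> * \<theta> * ?b ^ Suc n" using P_gt_1 \<theta> by simp
    then have "?b ^ n * level_energy (relax \<theta> F) (Suc n) = \<P> * \<theta> * y (Suc n)"
      using b[of "Suc n"] by (metis mult.assoc)
    then show ?thesis using b[of n] by (simp add: E distrib_left)
  qed
  then show "(\<lambda>n. \<Sum>v\<in>level n. \<Sum>w | bt_adj v w. (\<phi> w - \<phi> v)\<^sup>2 * real CARD('p) powr (real (bt_dist bt_base v) * (s - 1))) sums
      ((1 + \<P> * \<theta>) * ((1 - \<theta>) * (\<Sum>n=1..N. (square_mean F n - square_mean F (n - 1)) / \<theta> ^ n)))"
    using sums_add[OF Y sums_mult[OF Y', of "\<P> * \<theta>"]]
    unfolding energy_level Y_def[symmetric] by (simp add: distrib_right)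
qed

end

text \<open>Summation by parts for the weights 1 / \<open>\<theta>\<close>^l, whose successive
  differences are (1 / \<open>\<theta>\<close> - 1) / \<open>\<theta>\<close>^l. In the induction,
  raising the upper index adds the same increment a to every numerator, which multiplies a geometric
  sum.\<close>

lemma shell_abel_summation:
  fixes A :: "nat \<Rightarrow> real"
  assumes "0 < \<theta>"
  shows "(1 / \<theta> - 1) * (\<Sum>l<k. (A (Suc k) - A (Suc l)) / \<theta> ^ Suc l) =
    (\<Sum>n<Suc k. (A (Suc n) - A n) / \<theta> ^ Suc n) - (A (Suc k) - A 0) / \<theta>"
proof (induction k)
  case (Suc k)
  have geo: "(1 / \<theta> - 1) * (\<Sum>l<m. 1 / \<theta> ^ Suc l) = 1 / \<theta> ^ Suc m - 1 / \<theta>" for m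
  proof (induction m)
    case (Suc m)
    have "(1 / \<theta> - 1) * (1 / \<theta> ^ Suc m) = 1 / \<theta> ^ Suc (Suc m) - 1 / \<theta> ^ Suc m"
      using assms by (simp add: field_simps)
    then show ?case using Suc by (simp add: distrib_left)
  qed simp
  define a where "a = A (Suc (Suc k)) - A (Suc k)"
  have "(\<Sum>l<Suc k. (A (Suc (Suc k)) - A (Suc l)) / \<theta> ^ Suc l) =
      (\<Sum>l<Suc k. (A (Suc k) - A (Suc l)) / \<theta> ^ Suc l + a * (1 / \<theta> ^ Suc l))"
    by (intro sum.cong) (auto simp: a_def diff_divide_distrib)
  also have "\<dots> = (\<Sum>l<k. (A (Suc k) - A (Suc l)) / \<theta> ^ Suc l) + a * (\<Sum>l<Suc k. 1 / \<theta> ^ Suc l)"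
    unfolding sum.distrib sum_distrib_left by simp
  finally have "(1 / \<theta> - 1) * (\<Sum>l<Suc k. (A (Suc (Suc k)) - A (Suc l)) / \<theta> ^ Suc l) =
      (1 / \<theta> - 1) * (\<Sum>l<k. (A (Suc k) - A (Suc l)) / \<theta> ^ Suc l) + a * ((1 / \<theta> - 1) * (\<Sum>l<Suc k. 1 / \<theta> ^ Suc l))"
    by (simp only: distrib_left mult.left_commute)
  also have "\<dots> = (\<Sum>n<Suc k. (A (Suc n) - A n) / \<theta> ^ Suc n) - (A (Suc k) - A 0) / \<theta> + a * (1 / \<theta> ^ Suc (Suc k) - 1 / \<theta>)"
    unfolding Suc geo ..
  also have "\<dots> = (\<Sum>n<Suc (Suc k). (A (Suc n) - A n) / \<theta> ^ Suc n) - (A (Suc (Suc k)) - A 0) / \<theta>"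
    unfolding sum.lessThan_Suc[of _ "Suc k"] a_def by (simp add: right_diff_distrib diff_divide_distrib del: sum.lessThan_Suc power_Suc)
  finally show ?case .
qed simp

context padic_haar_exponent
begin

text \<open>The product of \<open>shell_coeff l\<close> and \<open>mass l\<close> is (1 -
  \<open>\<theta>\<close> / p) / \<open>\<theta>\<close>^l for l > 0, but 1 + 1/p for l = 0. After
  Abel summation only A 0, A N and the shell sum X remain; the term in A 0, later the square of the
  integral of f, absorbs what the root shell and D^s a leave over.\<close>

lemma energy_eq_boundary_form:
  assumes N: "0 < N"
  shows "(1 + \<P> * \<theta>) * ((1 - \<theta>) * (\<Sum>n=1..N. (A n - A (n - 1)) / \<theta> ^ n)) =
    (1 - \<theta>) * (1 / (\<P> * \<theta>) - \<P> * \<theta>) / ((1 + 1 / \<P>) * (1 - \<theta> / \<P>)) * (mass 0 * A 0)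
    + (1 - \<theta>) * (1 + \<P> * \<theta>) * ((1 - \<theta>) / (\<theta> * (1 - \<theta> / \<P>)) * ((\<theta> - 1 / \<P>) / (1 - \<theta>) * A N
      + (\<Sum>l<N. shell_coeff l * mass l * (A N - A l))))"
proof -
  obtain k where k: "N = Suc k" using N by (cases N) auto
  define S where "S = (\<Sum>n<Suc k. (A (Suc n) - A n) / \<theta> ^ Suc n)"
  define X where "X = (\<Sum>l<k. (A (Suc k) - A (Suc l)) / \<theta> ^ Suc l)"
  have P: "\<P> > 1" by (rule P_gt_1)
  have t: "0 < 1 - \<theta> / \<P>" using P \<theta> by (simp add: field_simps)
  have S: "(\<Sum>n=1..N. (A n - A (n - 1)) / \<theta> ^ n) = S"
    unfolding S_def k by (rule sum.reindex_bij_witness[of _ Suc "\<lambda>n. n - 1"]) auto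
  have c: "shell_coeff (Suc l) * mass (Suc l) = (1 - \<theta> / \<P>) / \<theta> ^ Suc l" for l
    using P \<theta> unfolding shell_coeff_def mass_def \<P>_def[symmetric] by (simp add: power_divide field_simps)
  have "(\<Sum>l<N. shell_coeff l * mass l * (A N - A l)) =
      (1 + 1 / \<P>) * (A N - A 0) + (\<Sum>l<k. shell_coeff (Suc l) * mass (Suc l) * (A N - A (Suc l)))"
    unfolding k sum.lessThan_Suc_shift by (simp add: shell_coeff_def mass_def \<P>_def)
  also have "(\<Sum>l<k. shell_coeff (Suc l) * mass (Suc l) * (A N - A (Suc l))) = (1 - \<theta> / \<P>) * X"
    unfolding c X_def sum_distrib_left k by simp
  finally have Q: "(\<Sum>l<N. shell_coeff l * mass l * (A N - A l)) = (1 + 1 / \<P>) * (A N - A 0) + (1 - \<theta> / \<P>) * X" .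
  have "(1 / \<theta> - 1) * X = S - (A N - A 0) / \<theta>"
    unfolding X_def S_def k by (rule shell_abel_summation) (use \<theta> in simp)
  moreover have "(1 - \<theta>) / \<theta> = 1 / \<theta> - 1" using \<theta> by (simp add: diff_divide_distrib)
  ultimately have S_eq: "S = (1 - \<theta>) / \<theta> * X + (A N - A 0) / \<theta>" by simp
  have m0: "mass 0 = 1 + 1 / \<P>" by (simp add: mass_def \<P>_def)
  \<comment> \<open>Here q is \<open>\<theta>\<close>, a is A N and b is A 0. X occurs on both sides
    with the same coefficient; the rest is the partial fraction identity 3.\<close>
  have alg: "(1 + p * q) * ((1 - q) * ((1 - q) / q * X + (a - b) / q)) =
    (1 - q) * (1 / (p * q) - p * q) / ((1 + 1 / p) * (1 - q / p)) * ((1 + 1 / p) * b)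
    + (1 - q) * (1 + p * q) * ((1 - q) / (q * (1 - q / p)) * ((q - 1 / p) / (1 - q) * a
      + ((1 + 1 / p) * (a - b) + (1 - q / p) * X)))"
    if "1 < p" "0 < q" "q < 1" for p q a b :: real
  proof -
    have nz: "p \<noteq> 0" "q \<noteq> 0" "1 - q \<noteq> 0" "p - q \<noteq> 0" "p + 1 \<noteq> 0" using that by auto
    have r: "1 - q / p = (p - q) / p" "1 + 1 / p = (p + 1) / p" "q - 1 / p = (p * q - 1) / p"
      "1 / (p * q) - p * q = (1 - p * q) * (1 + p * q) / (p * q)"
      using nz by (simp_all add: field_simps)
    have 1: "(1 - q) / (q * ((p - q) / p)) * ((p * q - 1) / p / (1 - q) * a + ((p + 1) / p * (a - b) + (p - q) / p * X))
      = (1 - q) / q * X + ((p * q - 1) * a + (1 - q) * (p + 1) * (a - b)) / (q * (p - q))"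
      using nz by (simp add: divide_simps) (simp add: algebra_simps)
    have 2: "(1 - q) * ((1 - p * q) * (1 + p * q) / (p * q)) / ((p + 1) / p * ((p - q) / p)) * ((p + 1) / p * b)
      = (1 - q) * (1 + p * q) * ((1 - p * q) * b / (q * (p - q)))"
      using nz by (simp add: divide_simps)
    have 3: "(a - b) / q = (1 - p * q) * b / (q * (p - q)) + ((p * q - 1) * a + (1 - q) * (p + 1) * (a - b)) / (q * (p - q))"
      using nz by (simp add: divide_simps) (simp add: algebra_simps)
    have 4: "c * (d * (x + (y + z))) = d * c * y + d * c * (x + z)" for c d x y z :: real
      by (simp add: algebra_simps)
    show ?thesis unfolding r 1 2 unfolding 3 by (rule 4)
  qed
  show ?thesis unfolding S Q S_eq m0 by (rule alg[OF P \<theta>])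
qed

end

theorem theorem1p2:
  fixes s p :: real
    and f :: "(nat \<Rightarrow> 'p::prime_card bt_vertex) \<Rightarrow> real"
    and \<phi> :: "'p bt_vertex \<Rightarrow> real"
    and \<mu>\<^sub>0 :: "(nat \<Rightarrow> 'p bt_vertex) measure"
    and dx :: "'p padic measure"
    and f' u :: "'p padic \<Rightarrow> real"
  assumes p: "p = real CARD('p)"
    and s: "s > 0"
    and \<mu>\<^sub>0: "is_boundary_measure \<mu>\<^sub>0"
    and dx: "is_padic_haar_measure dx"
    and f: "locally_constant_on bt_boundary_topology f"
    and \<phi>: "solves_extension_problem s f \<phi>"
    and f': "f' = (\<lambda>x. f (proj_line_ray (Some x)))"
    and u: "u = (\<lambda>x. boundary_factor s x * f' x)"
  shows "integrable \<mu>\<^sub>0 f \<and>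
    (\<forall>x. integrable dx (vladimirov_integrand s u x)) \<and>
    integrable dx (\<lambda>x. boundary_factor s x * f' x * vladimirov dx s u x) \<and>
    ((\<lambda>i. \<Sum>j | bt_adj i j. (\<phi> j - \<phi> i)\<^sup>2 * p powr (real (bt_dist bt_base i) * (s - 1)))
       has_sum
       ((1 - p powr (- s)) * (p powr (s - 1) - p powr (1 - s))
          / ((1 + p powr (- 1)) * (1 - p powr (- 1 - s))) * (\<integral>x. f x \<partial>\<mu>\<^sub>0)\<^sup>2
        + (1 - p powr (- s)) * (1 + p powr (1 - s))
          * (\<integral>x. boundary_factor s x * f' x * vladimirov dx s u x \<partial>dx)))
      bt_vertices"
proof -
  interpret padic_haar_exponent dx s using dx s by unfold_locales
  interpret boundary_measure dx \<mu>\<^sub>0 using \<mu>\<^sub>0 by unfold_locales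
  obtain N where N: "0 < N" "\<And>r r'. r \<in> rays \<Longrightarrow> r' \<in> rays \<Longrightarrow> r N = r' N \<Longrightarrow> f r = f r'"
    using locally_constant_level[OF f] by blast
  define F where "F = average f"
  have int_f: "integrable \<mu>\<^sub>0 f" by (rule integrable_level[of N]) (rule N(2))
  have F: "martingale F" unfolding F_def by (rule martingale_average[OF int_f])
  have F_ray: "F (r n) = f r" if "r \<in> rays" "N \<le> n" for r n
    unfolding F_def by (rule average_eq[OF N(2) N(1) that])
  have F_par: "F v = F (bt_parent v)" if v: "v \<in> bt_vertices" "bt_dist bt_base v = Suc n" "N \<le> n" for v n
  proof -
    obtain r where r: "r \<in> rays" "r (bt_dist bt_base v) = v" using exists_ray_through[OF v(1)] by blast
    have "r (Suc n) \<in> children (r n)" using r(1) by (simp add: rays_def)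
    then have "bt_parent v = r n" using r(2) v(2) childrenD(3) by metis
    then show ?thesis using F_ray[OF r(1), of n] F_ray[OF r(1), of "Suc n"] r(2) v by simp
  qed
  have \<phi>_eq: "\<phi> v = relax \<theta> F v" if v: "v \<in> bt_vertices" for v
  proof -
    \<comment> \<open>The given solution and the explicit extension solve the same equation and have
      the same limit along every ray, so their difference vanishes.\<close>
    have "balanced (\<P> * \<theta>) \<phi>" using \<phi> by (intro balanced_if_harmonic) (auto simp: solves_extension_problem_def)
    moreover have "balanced (\<P> * \<theta>) (relax \<theta> F)" unfolding \<P>_def by (rule balanced_relax[OF F])
    ultimately have bal: "balanced (\<P> * \<theta>) (\<lambda>v. \<phi> v - relax \<theta> F v)"
      by (rule balanced_diff)
    have lim: "(\<lambda>n. \<phi> (r n) - relax \<theta> F (r n)) \<longlonglongrightarrow> 0" if r: "r \<in> rays" for r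
    proof -
      have "r \<in> bt_boundary" using r by (simp add: bt_boundary_eq_rays)
      then have "(\<phi> \<longlongrightarrow> f r) (bt_tends_to r)" "filterlim r (bt_tends_to r) sequentially"
        using \<phi> bt_tends_to_ray by (auto simp: solves_extension_problem_def)
      then have "(\<lambda>n. \<phi> (r n)) \<longlonglongrightarrow> f r" by (rule filterlim_compose)
      moreover have "(\<lambda>n. relax \<theta> F (r n)) \<longlonglongrightarrow> f r"
        using F_ray[OF r] by (rule relax_tendsto[OF r _ \<theta>])
      ultimately show ?thesis using tendsto_diff[of "\<lambda>n. \<phi> (r n)" "f r" sequentially "\<lambda>n. relax \<theta> F (r n)" "f r"] by simp
    qed
    have "0 < \<P> * \<theta>" using P_gt_1 \<theta> by simp
    from balanced_eq_0[OF bal this lim v] have "\<phi> v - relax \<theta> F v = 0" .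
    then show ?thesis by simp
  qed
  have f'F: "f' x = F (ray x N)" for x
    unfolding f' by (rule F_ray[OF ray_in_rays order_refl, symmetric])
  have int_u: "integrable dx (vladimirov_integrand s u x)" for x
    using has_integral_vladimirov[OF F f'F] unfolding u by (auto simp: has_bochner_integral_iff)
  note form = has_integral_vladimirov_form[OF F f'F, folded u]
  \<comment> \<open>The value of F at the base vertex is the integral of f divided by the total
    mass, and \<open>square_mean\<close> multiplies its square by that mass once.\<close>
  have sq: "(\<integral>x. f x \<partial>\<mu>\<^sub>0)\<^sup>2 = mass 0 * square_mean F 0"
    using mass_pos[of 0] by (simp add: square_mean_def level_integral_def level_0 F_def average_root power2_eq_square)
  have pP: "p = \<P>" by (simp add: p \<P>_def)
  have "\<P> powr (- s) = \<theta>" "\<P> powr (- 1) = 1 / \<P>"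
    using P_gt_1 by (simp add: \<theta>_def, simp add: powr_minus_divide)
  note pw = this P_powr(2,4,5)
  have "((\<lambda>i. \<Sum>j | bt_adj i j. (\<phi> j - \<phi> i)\<^sup>2 * p powr (real (bt_dist bt_base i) * (s - 1))) has_sum
      ((1 + \<P> * \<theta>) * ((1 - \<theta>) * (\<Sum>n=1..N. (square_mean F n - square_mean F (n - 1)) / \<theta> ^ n)))) bt_vertices"
    unfolding p by (rule relax_energy_has_sum[OF F F_par \<phi>_eq])
  then show ?thesis
    using int_f int_u form
    unfolding energy_eq_boundary_form[OF N(1)] has_bochner_integral_iff sq pP pw by simp
qed

end
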